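(* Let $n \geq 1$, let $M^n$ be a closed, convex hypersurface in $\mathbb{R}^{n+1}$, let $\alpha : M \to M$ be a continuous map, let $\mu(\alpha) = \min_{x \in M} d_M(x,\alpha(x))$ be its minimum intrinsic displacement, and let $\Xi(M)$ be the mean width of $M$. Then $$\Xi(M) \geq \frac{2}{\pi}\, \mu(\alpha).$$ For $n \geq 2$, equality holds if and only if $M$ is a round sphere and $\alpha$ is the antipodal map.
   Context: A closed, convex hypersurface $M^n$ in $\mathbb{R}^{n+1}$ is the boundary of a compact convex set with nonempty interior in $\mathbb{R}^{n+1}$; no smoothness is assumed. The intrinsic distance $d_M(x,y)$ is the minimal length of a path contained in $M$ connecting $x$ and $y$. For a line $\ell$ in $\mathbb{R}^{n+1}$, the width $w_\ell(M)$ of $M$ along $\ell$ is the length of the orthogonal projection of $M$ onto $\ell$. The mean width of $M$ is $\Xi(M) = \int_{Gr(1,n+1)} w_\ell(M)\, d\ell$, where $Gr(1,n+1)$ is the Grassmannian of unoriented lines through the origin in $\mathbb{R}^{n+1}$ and $d\ell$ is the $SO(n+1)$-invariant measure on it of total measure $1$. The antipodal map of a round sphere sends each point to its reflection through the center of the sphere. *)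

theory Defs
  imports "HOL-Analysis.Analysis"
begin

definition closed_convex_hypersurface :: "'a::euclidean_space set \<Rightarrow> bool" where
  "closed_convex_hypersurface M \<longleftrightarrow>
     (\<exists>K. compact K \<and> convex K \<and> interior K \<noteq> {} \<and> M = frontier K)"

section \<open>Intrinsic distance\<close>

text \<open>Lengths are extended nonnegative reals, so that non-rectifiable paths have length
  \<open>\<infinity>\<close> and points that cannot be joined by a path have distance \<open>\<infinity>\<close>.\<close>

definition path_length :: "(real \<Rightarrow> 'a::metric_space) \<Rightarrow> ennreal" where
  "path_length g =
     (SUP (m, t) \<in> {(m::nat, t::nat \<Rightarrow> real). mono_on {..m} t \<and> t ` {..m} \<subseteq> {0..1}}.
        \<Sum>i<m. ennreal (dist (g (t i)) (g (t (Suc i)))))"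

definition intrinsic_dist :: "'a::metric_space set \<Rightarrow> 'a \<Rightarrow> 'a \<Rightarrow> ennreal" where
  "intrinsic_dist M x y =
     (INF g \<in> {g. path g \<and> path_image g \<subseteq> M \<and> pathstart g = x \<and> pathfinish g = y}.
        path_length g)"

definition min_displacement :: "'a::metric_space set \<Rightarrow> ('a \<Rightarrow> 'a) \<Rightarrow> ennreal" where
  "min_displacement M \<alpha> = (INF x\<in>M. intrinsic_dist M x (\<alpha> x))"

section \<open>The Grassmannian of lines and its invariant probability measure\<close>

definition lines :: "'a::euclidean_space set set" where
  "lines = {L. subspace L \<and> dim L = 1}"

text \<open>A set of lines is measurable if the cone over it (without the origin) is a Borel set;
  this is the Borel \<open>\<sigma>\<close>-algebra of the quotient topology.\<close>

definition line_borel :: "'a::euclidean_space set measure" where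
  "line_borel = sigma lines {A. A \<subseteq> lines \<and> {x. x \<noteq> 0 \<and> span {x} \<in> A} \<in> sets borel}"

text \<open>The measure is the law of the line spanned by a uniformly distributed point of the
  unit ball. The lemmas \<open>emeasure_line_measure_lines\<close> and \<open>emeasure_line_measure_image\<close> below show
  that it has total mass one and is invariant under all orthogonal transformations; these
  properties (already with rotations only) determine it.\<close>

definition line_measure :: "'a::euclidean_space set measure" where
  "line_measure =
     distr (uniform_measure (restrict_space lborel (- {0})) (ball 0 1 - {0})) line_borel
       (\<lambda>x. span {x})"

section \<open>Width and mean width\<close>

definition orth_proj :: "'a::euclidean_space set \<Rightarrow> 'a \<Rightarrow> 'a" where
  "orth_proj L x = (THE y. y \<in> L \<and> (\<forall>z\<in>L. orthogonal (x - y) z))"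

text \<open>The projection of a connected compact set to a line is a segment, whose length is its
  diameter.\<close>

definition width :: "'a::euclidean_space set \<Rightarrow> 'a set \<Rightarrow> real" where
  "width L M = diameter (orth_proj L ` M)"

definition mean_width :: "'a::euclidean_space set \<Rightarrow> real" where
  "mean_width M = (\<integral>L. width L M \<partial>line_measure)"

section \<open>Characteristic properties of the measure on lines\<close>

lemma span_singleton_in_lines:
  fixes x :: "'a::euclidean_space"
  assumes "x \<noteq> 0" shows "span {x} \<in> lines"
proof -
  have "dim (span {x}) = 1"
    using assms by (simp add: dim_eq_card_independent)
  then show ?thesis by (simp add: lines_def)
qed

lemma line_borel_sigma_algebra:
  "sigma_algebra (lines :: 'a::euclidean_space set set)
     {A. A \<subseteq> lines \<and> {x. x \<noteq> 0 \<and> span {x} \<in> A} \<in> sets borel}"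
proof (rule sigma_algebra_iff2[THEN iffD2], intro conjI ballI allI impI)
  show "{A. A \<subseteq> lines \<and> {x. x \<noteq> 0 \<and> span {x} \<in> A} \<in> sets borel}
      \<subseteq> Pow (lines :: 'a set set)" by auto
  show "{} \<in> {A. A \<subseteq> (lines :: 'a set set) \<and> {x. x \<noteq> 0 \<and> span {x} \<in> A} \<in> sets borel}"
    by simp
next
  fix A :: "'a set set"
  assume A: "A \<in> {A. A \<subseteq> lines \<and> {x. x \<noteq> 0 \<and> span {x} \<in> A} \<in> sets borel}"
  have "{x::'a. x \<noteq> 0 \<and> span {x} \<in> lines - A} = - {0} - {x. x \<noteq> 0 \<and> span {x} \<in> A}"
    using span_singleton_in_lines by auto
  then show "lines - A \<in> {A. A \<subseteq> lines \<and> {x. x \<noteq> 0 \<and> span {x} \<in> A} \<in> sets borel}"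
    using A by auto
next
  fix A :: "nat \<Rightarrow> 'a set set"
  assume A: "range A \<subseteq> {A. A \<subseteq> lines \<and> {x. x \<noteq> 0 \<and> span {x} \<in> A} \<in> sets borel}"
  have "{x::'a. x \<noteq> 0 \<and> span {x} \<in> (\<Union>i. A i)} = (\<Union>i. {x. x \<noteq> 0 \<and> span {x} \<in> A i})"
    by auto
  moreover have "(\<Union>i. {x. x \<noteq> 0 \<and> span {x} \<in> A i}) \<in> sets borel"
    using A by (intro sets.countable_UN) auto
  ultimately show "(\<Union>i. A i) \<in> {A. A \<subseteq> lines \<and> {x. x \<noteq> 0 \<and> span {x} \<in> A} \<in> sets borel}"
    using A by auto
qed

lemma space_line_borel [simp]: "space line_borel = lines"
  unfolding line_borel_def by (rule space_measure_of) auto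

lemma sets_line_borel:
  "sets (line_borel :: 'a::euclidean_space set measure) =
     {A. A \<subseteq> lines \<and> {x. x \<noteq> 0 \<and> span {x} \<in> A} \<in> sets borel}"
  unfolding line_borel_def
  by (subst sets_measure_of) (auto simp: sigma_algebra.sigma_sets_eq[OF line_borel_sigma_algebra])

lemma measurable_span_singleton:
  "(\<lambda>x. span {x}) \<in> measurable
     (uniform_measure (restrict_space lborel (- {0::'a::euclidean_space})) (ball 0 1 - {0}))
     line_borel"
proof (rule measurableI)
  fix A :: "'a set set" assume "A \<in> sets line_borel"
  then have "{x. x \<noteq> 0 \<and> span {x} \<in> A} \<in> sets borel" by (simp add: sets_line_borel)
  moreover have "(\<lambda>x. span {x}) -` A \<inter> - {0} = {x. x \<noteq> 0 \<and> span {x} \<in> A}" by auto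
  ultimately show "(\<lambda>x. span {x}) -` A \<inter>
      space (uniform_measure (restrict_space lborel (- {0})) (ball 0 1 - {0}))
      \<in> sets (uniform_measure (restrict_space lborel (- {0})) (ball 0 1 - {0}))"
    by (auto simp: space_restrict_space sets_restrict_space_iff)
qed (auto simp: space_restrict_space span_singleton_in_lines)

lemma emeasure_line_measure:
  fixes A :: "'a::euclidean_space set set"
  assumes "A \<in> sets line_borel"
  shows "emeasure line_measure A =
    emeasure lborel (ball 0 1 \<inter> {x. x \<noteq> 0 \<and> span {x} \<in> A}) / emeasure lborel (ball (0::'a) 1 - {0})"
proof -
  let ?R = "restrict_space lborel (- {0::'a})"
  let ?C = "{x. x \<noteq> 0 \<and> span {x} \<in> A}"
  have C: "?C \<in> sets borel" using assms by (simp add: sets_line_borel)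
  have eq: "(\<lambda>x. span {x}) -` A \<inter> - {0} = ?C" by auto
  have "emeasure line_measure A = emeasure (uniform_measure ?R (ball 0 1 - {0})) ?C"
    unfolding line_measure_def
    by (subst emeasure_distr[OF measurable_span_singleton assms])
       (simp add: space_restrict_space eq)
  also have "\<dots> = emeasure ?R ((ball 0 1 - {0}) \<inter> ?C) / emeasure ?R (ball 0 1 - {0})"
    using C by (intro emeasure_uniform_measure) (auto simp: sets_restrict_space_iff)
  also have "(ball 0 1 - {0}) \<inter> ?C = ball 0 1 \<inter> ?C" by auto
  also have "emeasure ?R (ball 0 1 \<inter> ?C) = emeasure lborel (ball 0 1 \<inter> ?C)"
    by (rule emeasure_restrict_space) auto
  also have "emeasure ?R (ball 0 1 - {0}) = emeasure lborel (ball (0::'a) 1 - {0})"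
    by (rule emeasure_restrict_space) auto
  finally show ?thesis .
qed

lemma emeasure_line_measure_lines: "emeasure line_measure (lines :: 'a::euclidean_space set set) = 1"
proof -
  have "(lines :: 'a set set) \<in> sets line_borel"
    using sets.top[of line_borel] by simp
  moreover have "ball 0 1 \<inter> {x::'a. x \<noteq> 0 \<and> span {x} \<in> lines} = ball 0 1 - {0}"
    using span_singleton_in_lines by auto
  moreover have "emeasure lborel (ball (0::'a) 1 - {0}) = emeasure lborel (ball (0::'a) 1)"
    by (rule emeasure_Diff_null_set) auto
  moreover have "emeasure lborel (ball (0::'a) 1) \<noteq> 0"
    using unit_ball_vol_pos[of "real DIM('a)"] by (simp add: emeasure_ball less_imp_neq[symmetric])
  moreover have "emeasure lborel (ball (0::'a) 1) \<noteq> \<infinity>"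
    by (simp add: emeasure_ball)
  ultimately show ?thesis
    by (simp add: emeasure_line_measure ennreal_divide_self top.not_eq_extremum)
qed

lemma emeasure_lborel_orthogonal_image_open:
  fixes f :: "'a::euclidean_space \<Rightarrow> 'a"
  assumes f: "orthogonal_transformation f" and U: "open U"
  shows "emeasure lborel (f ` U) = emeasure lborel U"
proof -
  have inj: "inj f" using f by (rule orthogonal_transformation_inj)
  have surj: "surj f" using f by (rule orthogonal_transformation_surj)
  have lin: "linear f" using f by (rule orthogonal_transformation_linear)
  define B :: "'a \<times> real \<Rightarrow> 'a set" where "B = (\<lambda>i. ball (fst i) (snd i))"
  define K where "K = {i. 0 < snd i \<and> B i \<subseteq> U}"
  have cov: "\<exists>i. i \<in> K \<and> x \<in> ball (fst i) (snd i) \<and> snd i < d" if x: "x \<in> U" and d: "0 < d" for x d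
  proof -
    obtain e where e: "0 < e" "ball x e \<subseteq> U"
      using U x open_contains_ball by blast
    have "ball x (min e (d / 2)) \<subseteq> U"
      using e(2) subset_ball[of "min e (d / 2)" e x] by simp
    then show ?thesis
      using e(1) d by (intro exI[of _ "(x, min e (d / 2))"]) (simp add: K_def B_def)
  qed
  obtain C where C: "countable C" "C \<subseteq> K"
    and disj: "pairwise (\<lambda>i j. disjnt (B i) (B j)) C"
    and neg: "negligible (U - (\<Union>i \<in> C. B i))"
    by (rule Vitali_covering_theorem_balls[of U K fst snd, OF cov]) (auto simp: B_def)
  define V where "V = (\<Union>i \<in> C. B i)"
  have VU: "V \<subseteq> U" using C(2) by (auto simp: V_def K_def)
  have V: "open V" by (auto simp: V_def B_def)
  have opf: "open (f ` W)" if "open W" for W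
    using that lin surj by (rule open_surjective_linear_image)
  have fUV: "f ` (U - V) = f ` U - f ` V" using inj by (rule image_set_diff)
  have null: "emeasure lborel W = emeasure lborel W'"
    if "open W" "open W'" "W' \<subseteq> W" "negligible (W - W')" for W W' :: "'a set"
  proof -
    have "W - W' \<in> null_sets lborel"
      using that by (simp add: negligible_iff_null_sets null_sets_completion_iff)
    then have "emeasure lborel (W' \<union> (W - W')) = emeasure lborel W'"
      using that by (intro emeasure_Un_null_set) auto
    then show ?thesis using that(3) by (simp add: Un_absorb1)
  qed
  have "negligible (f ` (U - V))"
    using neg unfolding V_def
    by (rule negligible_differentiable_image_negligible[OF order_refl])
       (rule linear_imp_differentiable_on[OF lin])
  then have 1: "emeasure lborel (f ` U) = emeasure lborel (f ` V)"
    using opf U V VU unfolding fUV by (intro null image_mono)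
  have 2: "emeasure lborel U = emeasure lborel V"
    using U V VU neg unfolding V_def by (rule null)
  have dB: "disjoint_family_on B C"
    using disj by (auto simp: disjoint_family_on_def pairwise_def disjnt_def)
  then have dfB: "disjoint_family_on (\<lambda>i. f ` B i) C"
    using inj by (simp add: disjoint_family_on_def image_Int[symmetric])
  have fB: "emeasure lborel (f ` B i) = emeasure lborel (B i)" if "i \<in> C" for i
  proof -
    have "0 < snd i" using that C(2) by (auto simp: K_def)
    then show ?thesis
      by (simp add: B_def image_orthogonal_transformation_ball[OF f] emeasure_ball)
  qed
  have "emeasure lborel (f ` V) = (\<integral>\<^sup>+i. emeasure lborel (f ` B i) \<partial>count_space C)"
    unfolding V_def image_UN using C(1) dfB opf
    by (intro emeasure_UN_countable) (auto simp: B_def)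
  also have "\<dots> = (\<integral>\<^sup>+i. emeasure lborel (B i) \<partial>count_space C)"
    using fB by (intro nn_integral_cong) simp
  also have "\<dots> = emeasure lborel V"
    unfolding V_def using C(1) dB
    by (intro emeasure_UN_countable[symmetric]) (auto simp: B_def)
  finally show ?thesis using 1 2 by simp
qed

lemma emeasure_lborel_orthogonal_image:
  fixes f :: "'a::euclidean_space \<Rightarrow> 'a"
  assumes f: "orthogonal_transformation f" and X: "X \<in> sets borel"
  shows "f ` X \<in> sets borel" "emeasure lborel (f ` X) = emeasure lborel X"
proof -
  define g where "g = inv f"
  have bij: "bij f" using f by (rule orthogonal_transformation_bij)
  have g: "orthogonal_transformation g"
    unfolding g_def using f by (rule orthogonal_transformation_inv)
  have vim: "g -` Y = f ` Y" for Y
    unfolding g_def using bij by (simp add: bij_vimage_eq_inv_image inv_inv_eq bij_imp_bij_inv)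
  have meas: "g \<in> borel_measurable borel"
    using orthogonal_transformation_linear[OF g]
    by (intro borel_measurable_continuous_onI linear_continuous_on linear_conv_bounded_linear[THEN iffD1])
  show "f ` X \<in> sets borel"
    using measurable_sets[OF meas X] by (simp add: vim)
  have "lborel = distr lborel borel g"
  proof (rule lborel_eqI)
    fix l u :: 'a assume lu: "\<And>b. b \<in> Basis \<Longrightarrow> l \<bullet> b \<le> u \<bullet> b"
    have "emeasure (distr lborel borel g) (box l u) = emeasure lborel (f ` box l u)"
      using meas by (simp add: emeasure_distr vim)
    also have "\<dots> = (\<Prod>b\<in>Basis. (u - l) \<bullet> b)"
      using lu by (simp add: emeasure_lborel_orthogonal_image_open[OF f open_box] emeasure_lborel_box)
    finally show "emeasure (distr lborel borel g) (box l u) = (\<Prod>b\<in>Basis. (u - l) \<bullet> b)" .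
  qed simp
  then have "emeasure lborel X = emeasure (distr lborel borel g) X" by simp
  also have "\<dots> = emeasure lborel (f ` X)"
    using meas X by (simp add: emeasure_distr vim)
  finally show "emeasure lborel (f ` X) = emeasure lborel X" ..
qed

lemma emeasure_line_measure_image:
  fixes f :: "'a::euclidean_space \<Rightarrow> 'a"
  assumes f: "orthogonal_transformation f" and A: "A \<in> sets line_borel"
  shows "(`) f ` A \<in> sets line_borel"
    "emeasure line_measure ((`) f ` A) = emeasure line_measure A"
proof -
  have inj: "inj f" using f by (rule orthogonal_transformation_inj)
  have surj: "surj f" using f by (rule orthogonal_transformation_surj)
  have lin: "linear f" using f by (rule orthogonal_transformation_linear)
  define cone where "cone A = {x::'a. x \<noteq> 0 \<and> span {x} \<in> A}" for A
  have span: "span {f x} = f ` span {x}" for x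
    using linear_span_image[OF lin, of "{x}"] by simp
  have 0: "f x = 0 \<longleftrightarrow> x = 0" for x
    using inj lin linear_injective_0 linear_0 by blast
  have mem: "f ` L \<in> (`) f ` A \<longleftrightarrow> L \<in> A" for L
    using inj by (simp add: inj_image_mem_iff inj_image_eq_iff inj_def)
  have cone: "cone ((`) f ` A) = f ` cone A"
  proof (rule set_eqI)
    fix y obtain x where y: "y = f x" using surj by (rule surjE)
    show "y \<in> cone ((`) f ` A) \<longleftrightarrow> y \<in> f ` cone A"
      unfolding y inj_image_mem_iff[OF inj] by (simp add: cone_def 0 span mem)
  qed
  have bA: "cone A \<in> sets borel" and sub: "A \<subseteq> lines"
    using A by (simp_all add: sets_line_borel cone_def)
  have "f ` L \<in> lines" if "L \<in> lines" for L
    using that inj lin dim_image_eq[OF lin, of L] linear_subspace_image[OF lin, of L]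
    by (auto simp: lines_def intro: inj_on_subset)
  then have "(`) f ` A \<subseteq> lines" using sub by auto
  moreover have "cone ((`) f ` A) \<in> sets borel"
    unfolding cone using f bA by (rule emeasure_lborel_orthogonal_image)
  ultimately show meas: "(`) f ` A \<in> sets line_borel"
    by (simp add: sets_line_borel cone_def)
  have "ball 0 1 \<inter> f ` cone A = f ` (ball 0 1 \<inter> cone A)"
    using image_orthogonal_transformation_ball[OF f, of 0 1] inj
    by (simp add: image_Int linear_0[OF lin])
  then have "emeasure lborel (ball 0 1 \<inter> cone ((`) f ` A)) = emeasure lborel (ball 0 1 \<inter> cone A)"
    unfolding cone using bA by (simp add: emeasure_lborel_orthogonal_image(2)[OF f])
  then show "emeasure line_measure ((`) f ` A) = emeasure line_measure A"
    using meas A by (simp add: emeasure_line_measure cone_def)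
qed

end

theory Submission
  imports Defs
begin

text \<open>Write \<open>M\<close> as the frontier of a convex body \<open>K\<close>, let \<open>h\<close> be the support function of \<open>K\<close> and let
\<open>\<mu>\<close> be the minimum displacement of \<open>\<alpha>\<close>.

\<^bold>\<open>The inequality.\<close> By Brouwer's theorem, for every line through the origin some point \<open>x\<close> of \<open>M\<close> is
displaced parallel to that line (\<open>displacement_in_direction\<close>). Every plane through \<open>x\<close> that
contains the direction then contains both \<open>x\<close> and \<open>\<alpha> x\<close>. It cuts \<open>K\<close> in a convex set whose boundary
curve lies in \<open>M\<close> and is divided by the two points into two arcs, so \<open>\<mu>\<close> is at most half the
perimeter of the slice (\<open>intrinsic_dist_le_slice\<close>). By Cauchy's formula the perimeter is the
integral of the support function of the slice over the unit circle of the plane, and this is at most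
the integral of \<open>h\<close> over the same circle. So the integral of \<open>h\<close> over every great circle is at least
\<open>2 * \<mu>\<close>. Averaging over all great circles gives a mean of at least \<open>\<mu> / pi\<close> for \<open>h\<close> over the
sphere (\<open>circle_integral_bound_mean\<close>), and the mean width is twice the mean of \<open>h\<close>
(\<open>mean_width_eq_sphere_mean\<close>).

The average over great circles involves no measure on a Grassmannian. Averages of \<open>h\<close> over
finitely many rotations inherit the bound on all great circles, have the same mean and the same
Lipschitz constant, and their maximum can be brought arbitrarily close to the mean; for a function that
hardly exceeds its mean the claim is evident.

\<^bold>\<open>Equality.\<close> If equality holds then the integral of \<open>h\<close> over every great circle is exactly \<open>2 * \<mu>\<close>
(\<open>circle_integral_strict_bound_mean\<close>). So for every direction \<open>v\<close> there is a line parallel to \<open>v\<close>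
such that each plane slice of \<open>K\<close> through this line has the same support function as \<open>K\<close> on its
circle of directions. In dimension at least three this forces \<open>K\<close> to be a ball
(\<open>ball_from_full_slices\<close>): the line meets both faces of \<open>K\<close> with normals \<open>v\<close> and \<open>- v\<close>, so \<open>K\<close> has a
double normal in every direction and therefore constant width; then the faces are single points and
any two double normals meet; so all of them pass through one point, the centre. On a sphere
of radius \<open>r\<close> equality says \<open>\<mu> = pi * r\<close>, and only antipodal points have intrinsic distance as large
as this. Conversely a path joining antipodal points has length at least \<open>pi * r\<close>
(\<open>path_length_antipodal\<close>).\<close>

section \<open>Lengths of paths and the intrinsic distance\<close>

lemma path_length_ge_sum:
  assumes "mono_on {..m} t" "t ` {..m} \<subseteq> {0..1}"
  shows "(\<Sum>i<m. ennreal (dist (g (t i)) (g (t (Suc i))))) \<le> path_length g"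
  unfolding path_length_def
  by (rule SUP_upper2[where i="(m,t)"]) (use assms in auto)

lemma path_length_le:
  assumes "\<And>(m::nat) t. mono_on {..m} t \<Longrightarrow> t ` {..m} \<subseteq> {0..1} \<Longrightarrow>
    (\<Sum>i<m. ennreal (dist (g (t i)) (g (t (Suc i))))) \<le> B"
  shows "path_length g \<le> B"
  unfolding path_length_def
  by (rule SUP_least) (use assms in auto)

lemma path_length_lipschitz:
  assumes "L-lipschitz_on {0..1} g"
  shows "path_length g \<le> ennreal L"
proof (rule path_length_le)
  fix m and t :: "nat \<Rightarrow> real"
  assume mono: "mono_on {..m} t" and sub: "t ` {..m} \<subseteq> {0..1}"
  have L: "0 \<le> L" using assms by (rule lipschitz_on_nonneg)
  have step: "dist (g (t i)) (g (t (Suc i))) \<le> L * (t (Suc i) - t i)" if "i < m" for i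
  proof -
    have "t i \<le> t (Suc i)" using that by (intro mono_onD[OF mono]) auto
    moreover have "t i \<in> {0..1}" "t (Suc i) \<in> {0..1}" using sub that by (auto simp: image_subset_iff)
    ultimately show ?thesis
      using lipschitz_onD[OF assms, of "t i" "t (Suc i)"] by (simp add: dist_real_def)
  qed
  have "(\<Sum>i<m. dist (g (t i)) (g (t (Suc i)))) \<le> (\<Sum>i<m. L * (t (Suc i) - t i))"
    by (rule sum_mono) (use step in auto)
  also have "\<dots> = L * (t m - t 0)"
    by (simp add: sum_distrib_left[symmetric] sum_lessThan_telescope)
  also have "\<dots> \<le> L * 1"
  proof (rule mult_left_mono[OF _ L])
    have "t m \<le> 1" "0 \<le> t 0" using sub by (auto simp: image_subset_iff)
    then show "t m - t 0 \<le> 1" by simp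
  qed
  finally show "(\<Sum>i<m. ennreal (dist (g (t i)) (g (t (Suc i))))) \<le> ennreal L"
    by (simp add: sum_ennreal ennreal_leI)
qed

text \<open>A partition for the joined path yields partitions for the two pieces by clamping its points to the
left and to the right half of the parameter interval. The triangle inequality at the junction
covers the one interval that may straddle it, so the partition need not be refined.\<close>

lemma path_length_join:
  assumes "pathfinish g1 = pathstart g2"
  shows "path_length (g1 +++ g2) \<le> path_length g1 + path_length g2"
proof (rule path_length_le)
  fix m and t :: "nat \<Rightarrow> real"
  assume mono: "mono_on {..m} t" and sub: "t ` {..m} \<subseteq> {0..1}"
  let ?g = "g1 +++ g2"
  define a where "a i = 2 * min (t i) (1/2)" for i
  define b where "b i = 2 * max (t i) (1/2) - 1" for i
  have *: "ennreal (dist (?g (t i)) (?g (t (Suc i))))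
    \<le> ennreal (dist (g1 (a i)) (g1 (a (Suc i)))) + ennreal (dist (g2 (b i)) (g2 (b (Suc i))))"
    if "i < m" for i
  proof -
    have le: "t i \<le> t (Suc i)" using that by (intro mono_onD[OF mono]) auto
    have eq: "g1 1 = g2 0" using assms by (simp add: pathfinish_def pathstart_def)
    have "dist (?g (t i)) (?g (t (Suc i)))
        \<le> dist (g1 (a i)) (g1 (a (Suc i))) + dist (g2 (b i)) (g2 (b (Suc i)))"
      using le eq dist_triangle[of "g1 (2 * t i)" "g2 (2 * t (Suc i) - 1)" "g2 0"]
      by (auto simp: joinpaths_def a_def b_def min_def max_def)
    then show ?thesis
      by (metis ennreal_leI ennreal_plus zero_le_dist)
  qed
  have "(\<Sum>i<m. ennreal (dist (?g (t i)) (?g (t (Suc i)))))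
    \<le> (\<Sum>i<m. ennreal (dist (g1 (a i)) (g1 (a (Suc i)))))
      + (\<Sum>i<m. ennreal (dist (g2 (b i)) (g2 (b (Suc i)))))"
    unfolding sum.distrib[symmetric] by (rule sum_mono) (use * in auto)
  also have "\<dots> \<le> path_length g1 + path_length g2"
    by (intro add_mono path_length_ge_sum)
       (use mono sub in \<open>fastforce simp: a_def b_def monotone_on_def min_def max_def image_subset_iff\<close>)+
  finally show "(\<Sum>i<m. ennreal (dist (?g (t i)) (?g (t (Suc i))))) \<le> path_length g1 + path_length g2" .
qed

lemma path_length_reversepath_le: "path_length (reversepath g) \<le> path_length g"
proof (rule path_length_le)
  fix m and t :: "nat \<Rightarrow> real"
  assume mono: "mono_on {..m} t" and sub: "t ` {..m} \<subseteq> {0..1}"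
  define s where "s i = 1 - t (m - i)" for i
  have "(\<Sum>i<m. ennreal (dist (reversepath g (t i)) (reversepath g (t (Suc i)))))
      = (\<Sum>i<m. ennreal (dist (g (s i)) (g (s (Suc i)))))"
    by (subst sum.nat_diff_reindex[symmetric])
       (auto intro!: sum.cong simp: s_def reversepath_def dist_commute Suc_diff_Suc)
  also have "\<dots> \<le> path_length g"
    by (rule path_length_ge_sum)
       (use mono sub in \<open>auto simp: s_def monotone_on_def image_subset_iff\<close>)
  finally show "(\<Sum>i<m. ennreal (dist (reversepath g (t i)) (reversepath g (t (Suc i))))) \<le> path_length g" .
qed

lemma intrinsic_dist_le:
  assumes "path g" "path_image g \<subseteq> M" "pathstart g = x" "pathfinish g = y"
  shows "intrinsic_dist M x y \<le> path_length g"
  unfolding intrinsic_dist_def by (rule INF_lower) (use assms in auto)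

lemma intrinsic_dist_commute: "intrinsic_dist M x y = intrinsic_dist M y x"
proof -
  have "intrinsic_dist M x y \<le> intrinsic_dist M y x" for x y :: 'a
    unfolding intrinsic_dist_def[of M y x]
  proof (rule INF_greatest, clarify)
    fix g assume "path g" "path_image g \<subseteq> M" "x = pathfinish g" "y = pathstart g"
    then have "intrinsic_dist M x y \<le> path_length (reversepath g)"
      by (intro intrinsic_dist_le) auto
    then show "intrinsic_dist M (pathfinish g) (pathstart g) \<le> path_length g"
      using path_length_reversepath_le[of g] \<open>x = _\<close> \<open>y = _\<close> by (metis order_trans)
  qed
  then show ?thesis by (simp add: antisym)
qed

lemma intrinsic_dist_triangle:
  "intrinsic_dist M x z \<le> intrinsic_dist M x y + intrinsic_dist M y z"
proof -
  let ?P = "\<lambda>x y. {g. path g \<and> path_image g \<subseteq> M \<and> pathstart g = x \<and> pathfinish g = y}"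
  have "intrinsic_dist M x z \<le> path_length g1 + path_length g2"
    if "g1 \<in> ?P x y" "g2 \<in> ?P y z" for g1 g2
  proof -
    have "intrinsic_dist M x z \<le> path_length (g1 +++ g2)"
      using that by (intro intrinsic_dist_le) (auto simp: path_image_join)
    also have "\<dots> \<le> path_length g1 + path_length g2"
      using that by (intro path_length_join) auto
    finally show ?thesis .
  qed
  note le = this
  show ?thesis
  proof (rule ennreal_le_epsilon)
    fix r :: real assume fin: "intrinsic_dist M x y + intrinsic_dist M y z < top" and r: "0 < r"
    have lt: "d < d + ennreal (r / 2)" if "d < top" for d
      using that r by (cases d) (auto simp: ennreal_plus[symmetric] ennreal_less_iff simp del: ennreal_plus)
    have "intrinsic_dist M x y < intrinsic_dist M x y + ennreal (r / 2)"
      "intrinsic_dist M y z < intrinsic_dist M y z + ennreal (r / 2)"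
      using fin r by (auto intro!: lt)
    then obtain g1 g2 where g: "g1 \<in> ?P x y" "g2 \<in> ?P y z"
      "path_length g1 < intrinsic_dist M x y + ennreal (r / 2)"
      "path_length g2 < intrinsic_dist M y z + ennreal (r / 2)"
      unfolding intrinsic_dist_def[of M x y] intrinsic_dist_def[of M y z] INF_less_iff by blast
    have "intrinsic_dist M x z \<le> path_length g1 + path_length g2" using g by (intro le)
    also have "\<dots> \<le> (intrinsic_dist M x y + ennreal (r / 2)) + (intrinsic_dist M y z + ennreal (r / 2))"
      using g by (intro add_mono) auto
    also have "\<dots> = intrinsic_dist M x y + intrinsic_dist M y z + (ennreal (r / 2) + ennreal (r / 2))"
      by (simp add: ac_simps)
    also have "ennreal (r / 2) + ennreal (r / 2) = ennreal r"
      using r by (simp flip: ennreal_plus)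
    finally show "intrinsic_dist M x z \<le> intrinsic_dist M x y + intrinsic_dist M y z + ennreal r" .
  qed
qed

lemma closest_point_in_frontier:
  fixes K :: "'a::euclidean_space set"
  assumes "compact K" "K \<noteq> {}" "x \<notin> interior K"
  shows "closest_point K x \<in> frontier K"
proof -
  have "closed K" using assms by (simp add: compact_imp_closed)
  show ?thesis
  proof (cases "x \<in> K")
    case True then show ?thesis
      using assms by (simp add: closest_point_self frontier_def closure_closed[OF \<open>closed K\<close>])
  next
    case False
    let ?p = "closest_point K x"
    have pK: "?p \<in> K" using \<open>closed K\<close> assms by (simp add: closest_point_in_set)
    have "?p \<notin> interior K"
    proof
      assume "?p \<in> interior K"
      then have "x \<noteq> ?p" using False pK by auto
      obtain e where e: "0 < e" "ball ?p e \<subseteq> K"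
        using \<open>?p \<in> interior K\<close> by (auto simp: mem_interior)
      define d where "d = min (1/2) (e / (2 * dist x ?p))"
      define q where "q = ?p + d *\<^sub>R (x - ?p)"
      have xp: "0 < dist x ?p" using \<open>x \<noteq> ?p\<close> by simp
      have d: "0 < d" "d \<le> 1/2" "d * dist x ?p \<le> e/2"
        using e xp by (auto simp: d_def min_def field_simps)
      have "dist ?p q = d * dist x ?p" using d by (simp add: q_def dist_norm)
      then have "q \<in> K" using d e by (intro subsetD[OF e(2)]) simp
      then have "dist x ?p \<le> dist x q" using \<open>closed K\<close> by (rule closest_point_le[rotated])
      also have "x - q = (1 - d) *\<^sub>R (x - ?p)" by (simp add: q_def algebra_simps)
      then have "dist x q = (1 - d) * dist x ?p" using d by (simp add: dist_norm)
      finally show False using d xp by (simp add: algebra_simps mult_le_0_iff)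
    qed
    then show ?thesis using pK by (simp add: frontier_def closure_closed[OF \<open>closed K\<close>])
  qed
qed

text \<open>The nearest-point map onto a convex body is distance-nonincreasing and sends everything outside
the interior to the frontier. Segments that avoid the interior can thus be pushed onto the
hypersurface. This is how curves in \<open>M\<close> of controlled length are produced without parametrizing
\<open>M\<close>.\<close>

lemma intrinsic_dist_closest_point_le:
  fixes K :: "'a::euclidean_space set"
  assumes K: "compact K" "convex K" "K \<noteq> {}"
    and out: "closed_segment a b \<inter> interior K = {}"
  shows "intrinsic_dist (frontier K) (closest_point K a) (closest_point K b) \<le> ennreal (dist a b)"
proof -
  let ?g = "closest_point K \<circ> linepath a b"
  have cl: "closed K" using K by (simp add: compact_imp_closed)
  have lip: "(dist a b)-lipschitz_on {0..1} ?g"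
  proof (rule lipschitz_onI)
    fix s t :: real
    have "dist (?g s) (?g t) \<le> dist (linepath a b s) (linepath a b t)"
      using closest_point_lipschitz[OF K(2) cl K(3)] by simp
    also have "linepath a b s - linepath a b t = (t - s) *\<^sub>R (a - b)"
      by (simp add: linepath_def algebra_simps)
    then have "dist (linepath a b s) (linepath a b t) = dist a b * dist s t"
      by (simp add: dist_norm dist_real_def abs_minus_commute)
    finally show "dist (?g s) (?g t) \<le> dist a b * dist s t" .
  qed simp
  have "path ?g"
    using lip unfolding path_def by (rule lipschitz_on_continuous_on)
  moreover have "path_image ?g \<subseteq> frontier K"
    using out closest_point_in_frontier[OF K(1,3)] by (auto simp: path_image_compose)
  ultimately have "intrinsic_dist (frontier K) (closest_point K a) (closest_point K b) \<le> path_length ?g"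
    by (intro intrinsic_dist_le) (auto simp: pathstart_compose pathfinish_compose)
  also have "\<dots> \<le> ennreal (dist a b)" using lip by (rule path_length_lipschitz)
  finally show ?thesis .
qed

section \<open>Support functions\<close>

definition support_fun :: "'a::euclidean_space set \<Rightarrow> 'a \<Rightarrow> real" where
  "support_fun S u = (SUP p\<in>S. p \<bullet> u)"

lemma bdd_above_inner_image:
  assumes "bounded (S :: 'a::euclidean_space set)"
  shows "bdd_above ((\<lambda>p. p \<bullet> u) ` S)"
proof -
  obtain B where B: "\<And>p. p \<in> S \<Longrightarrow> norm p \<le> B" using assms by (auto simp: bounded_iff)
  have "p \<bullet> u \<le> B * norm u" if "p \<in> S" for p
    using norm_cauchy_schwarz[of p u] B[OF that] by (meson mult_right_mono norm_ge_zero order_trans)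
  then show ?thesis by (auto simp: bdd_above_def)
qed

lemma support_fun_ge: "bounded S \<Longrightarrow> p \<in> S \<Longrightarrow> p \<bullet> u \<le> support_fun S u"
  unfolding support_fun_def by (rule cSUP_upper) (auto intro: bdd_above_inner_image)

lemma support_fun_le: "S \<noteq> {} \<Longrightarrow> (\<And>p. p \<in> S \<Longrightarrow> p \<bullet> u \<le> c) \<Longrightarrow> support_fun S u \<le> c"
  unfolding support_fun_def by (rule cSUP_least)

lemma support_fun_attained:
  assumes "compact S" "S \<noteq> {}"
  obtains p where "p \<in> S" "p \<bullet> u = support_fun S u"
proof -
  have "continuous_on S (\<lambda>p. p \<bullet> u)" by (intro continuous_intros)
  then obtain p where p: "p \<in> S" "\<And>q. q \<in> S \<Longrightarrow> q \<bullet> u \<le> p \<bullet> u"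
    using continuous_attains_sup[OF assms] by blast
  have "p \<bullet> u = support_fun S u"
    using p assms by (intro antisym support_fun_ge support_fun_le) (auto simp: compact_imp_bounded)
  then show ?thesis using p that by blast
qed

lemma support_fun_mono:
  assumes "bounded T" "S \<subseteq> T" "S \<noteq> {}"
  shows "support_fun S u \<le> support_fun T u"
  using assms by (intro support_fun_le) (auto intro: support_fun_ge)

lemma support_fun_lipschitz:
  assumes "S \<noteq> {}" "\<And>p. p \<in> S \<Longrightarrow> norm p \<le> B"
  shows "B-lipschitz_on UNIV (support_fun S)"
proof (rule lipschitz_onI)
  have bd: "bounded S" using assms by (auto simp: bounded_iff)
  show "0 \<le> B" using assms by (metis all_not_in_conv norm_ge_zero order_trans)
  have "support_fun S u \<le> support_fun S v + B * norm (u - v)" for u v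
  proof (rule support_fun_le[OF assms(1)])
    fix p assume p: "p \<in> S"
    have "p \<bullet> u = p \<bullet> v + p \<bullet> (u - v)" by (simp add: inner_diff_right)
    also have "p \<bullet> (u - v) \<le> norm p * norm (u - v)" by (rule norm_cauchy_schwarz)
    also have "\<dots> \<le> B * norm (u - v)" using assms(2)[OF p] by (rule mult_right_mono) simp
    finally show "p \<bullet> u \<le> support_fun S v + B * norm (u - v)" using support_fun_ge[OF bd p, of v] by simp
  qed
  note * = this
  show "dist (support_fun S u) (support_fun S v) \<le> B * dist u v" for u v
    using *[of u v] *[of v u]
    by (simp add: dist_real_def dist_norm norm_minus_commute abs_le_iff)
qed

lemma continuous_on_support_fun:
  assumes "bounded S" "S \<noteq> {}"
  shows "continuous_on A (support_fun S)"
proof -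
  obtain B where "\<And>p. p \<in> S \<Longrightarrow> norm p \<le> B" using assms by (auto simp: bounded_iff)
  then show ?thesis
    using support_fun_lipschitz[OF assms(2)] lipschitz_on_continuous_on continuous_on_subset
    by (metis top_greatest)
qed

section \<open>Circles spanned by orthonormal pairs\<close>

definition circle_pt :: "'a::euclidean_space \<Rightarrow> 'a \<Rightarrow> real \<Rightarrow> 'a" where
  "circle_pt e f t = cos t *\<^sub>R e + sin t *\<^sub>R f"

definition orthonormal_pair :: "'a::euclidean_space \<Rightarrow> 'a \<Rightarrow> bool" where
  "orthonormal_pair e f \<longleftrightarrow> norm e = 1 \<and> norm f = 1 \<and> e \<bullet> f = 0"

lemma inner_circle_pt: "circle_pt e f s \<bullet> circle_pt e f t = cos (s - t)"
  if "orthonormal_pair e f"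
  using that
  by (simp add: circle_pt_def orthonormal_pair_def inner_add_left inner_add_right cos_diff
      inner_commute[of f e] dot_square_norm)

lemma norm_circle_pt [simp]: "orthonormal_pair e f \<Longrightarrow> norm (circle_pt e f t) = 1"
  by (simp add: norm_eq_1 inner_circle_pt)

lemma circle_pt_lipschitz:
  assumes "orthonormal_pair e f"
  shows "norm (circle_pt e f s - circle_pt e f t) \<le> \<bar>s - t\<bar>"
proof -
  have "norm (circle_pt e f s - circle_pt e f t) ^ 2 = 2 - 2 * cos (s - t)"
    unfolding power2_norm_eq_inner
    using assms by (simp add: inner_diff_left inner_diff_right inner_circle_pt cos_diff algebra_simps)
  also have "\<dots> = (2 * sin ((s - t) / 2)) ^ 2"
  proof -
    have "cos (s - t) = 1 - 2 * (sin ((s - t) / 2))\<^sup>2"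
      using cos_double_sin[of "(s - t) / 2"] by (simp only: times_divide_eq_right nonzero_mult_div_cancel_left)
    then show ?thesis by (simp add: power_mult_distrib)
  qed
  also have "\<dots> \<le> (s - t) ^ 2"
    using abs_sin_x_le_abs_x[of "(s - t) / 2"] by (intro abs_le_square_iff[THEN iffD1]) simp
  finally show ?thesis by (metis abs_le_square_iff abs_norm_cancel)
qed

lemma continuous_on_circle_pt [continuous_intros]: "continuous_on A (circle_pt e f)"
  unfolding circle_pt_def by (intro continuous_intros)

lemma circle_pt_periodic: "circle_pt e f (t + 2 * pi) = circle_pt e f t"
  by (simp add: circle_pt_def)

text \<open>The angle is placed in a half-open interval that starts at a prescribed \<open>b0\<close>, so that a second
angle can be chosen to follow a given first one within one turn.\<close>

lemma exists_circle_pt: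
  assumes "a\<^sup>2 + b\<^sup>2 = 1"
  obtains t where "b0 \<le> t" "t < b0 + 2 * pi" "a *\<^sub>R e + b *\<^sub>R f = circle_pt e f t"
proof -
  obtain s where s: "a = cos s" "b = sin s" using assms by (metis sincos_total_2pi)
  define k where "k = \<lfloor>(s - b0) / (2 * pi)\<rfloor>"
  define t where "t = s - 2 * pi * k"
  have "of_int k \<le> (s - b0) / (2 * pi)" "(s - b0) / (2 * pi) < of_int k + 1"
    unfolding k_def by linarith+
  then have "b0 \<le> t" "t < b0 + 2 * pi" by (simp_all add: t_def field_simps)
  moreover have "cos t = a" "sin t = b"
    using cos.minus_of_int[of s k] sin.minus_of_int[of s k] s by (simp_all add: t_def mult.commute)
  ultimately show ?thesis using that by (simp add: circle_pt_def)
qed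

lemma integral_circle_shift:
  fixes h :: "real \<Rightarrow> real"
  assumes cont: "continuous_on UNIV h" and per: "\<And>t. h (t + 2 * pi) = h t"
  shows "integral {b..b + 2 * pi} h = integral {0..2 * pi} h"
proof -
  have int: "h integrable_on {x..y}" for x y
    using continuous_on_subset[OF cont] integrable_continuous_real by blast
  have perk: "h (t + 2 * pi * real_of_int k) = h t" for t k
  proof (induction k rule: int_induct[of _ 0])
    case (step1 i) then show ?case using per[of "t + 2 * pi * i"] by (simp add: algebra_simps)
  next
    case (step2 i) then show ?case using per[of "t + 2 * pi * (i - 1)"] by (simp add: algebra_simps)
  qed simp
  define k where "k = \<lfloor>b / (2 * pi)\<rfloor>"
  define c where "c = b - 2 * pi * k"
  have "of_int k \<le> b / (2 * pi)" "b / (2 * pi) < of_int k + 1"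
    unfolding k_def by linarith+
  then have c: "0 \<le> c" "c \<le> 2 * pi" by (simp_all add: c_def field_simps)
  have sh: "integral {x + d..y + d} h = integral {x..y} (\<lambda>t. h (t + d))" for x y d
    using integral_shift_real_ivl[of "x + d" d "y + d" h] by simp
  have "integral {b..b + 2 * pi} h = integral {c..c + 2 * pi} h"
    using sh[of c "2 * pi * k" "c + 2 * pi"] by (simp add: perk) (simp add: c_def add_ac)
  also have "\<dots> = integral {c..2 * pi} h + integral {0 + 2 * pi..c + 2 * pi} h"
    using c by (simp add: Henstock_Kurzweil_Integration.integral_combine[OF _ _ int])
  also have "integral {0 + 2 * pi..c + 2 * pi} h = integral {0..c} h"
    by (subst sh) (simp add: per)
  also have "integral {c..2 * pi} h + integral {0..c} h = integral {0..2 * pi} h"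
    using c Henstock_Kurzweil_Integration.integral_combine[OF _ _ int, of 0 c "2 * pi"] by simp
  finally show ?thesis .
qed

section \<open>Arcs of planar convex curves\<close>

text \<open>A compact set \<open>S\<close> in the plane \<open>c + span {e, f}\<close>, contained in the convex body \<open>K\<close>, such that no
tangent line of \<open>S\<close> in this plane enters the interior of \<open>K\<close>. There are two instances: the full slice
of \<open>K\<close> by a plane that meets the interior, and a segment in a plane that misses it.

For unit directions \<open>u\<close> at angle \<open>t\<close> and \<open>n\<close> at angle \<open>t + pi / 2\<close>, the point \<open>tangent_pt t s\<close> lies on
the tangent line with normal \<open>u\<close>, at height \<open>s\<close> in the direction \<open>n = circle_pt f (- e) t\<close>.\<close>

locale planar_section =
  fixes K S :: "'a::euclidean_space set" and e f c :: 'a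
  assumes compact_K: "compact K" and convex_K: "convex K"
    and compact_S: "compact S" and S_nonempty: "S \<noteq> {}" and S_subset: "S \<subseteq> K"
    and frame: "orthonormal_pair e f"
    and planar: "\<And>p. p \<in> S \<Longrightarrow> p = c + (p \<bullet> e) *\<^sub>R e + (p \<bullet> f) *\<^sub>R f"
    and tangent_outside:
      "\<And>t s. c + support_fun S (circle_pt e f t) *\<^sub>R circle_pt e f t + s *\<^sub>R circle_pt f (- e) t \<notin> interior K"
begin

definition H :: "real \<Rightarrow> real" where "H t = support_fun S (circle_pt e f t)"

definition tangent_pt :: "real \<Rightarrow> real \<Rightarrow> 'a" where
  "tangent_pt t s = c + H t *\<^sub>R circle_pt e f t + s *\<^sub>R circle_pt f (- e) t"

lemma frame_simps: "e \<bullet> e = 1" "f \<bullet> f = 1" "e \<bullet> f = 0" "f \<bullet> e = 0"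
  using frame by (auto simp: orthonormal_pair_def norm_eq_1 inner_commute)

lemma c_orthogonal: "c \<bullet> e = 0" "c \<bullet> f = 0"
proof -
  obtain p where "p \<in> S" using S_nonempty by blast
  from planar[OF this] have p: "c = p - (p \<bullet> e) *\<^sub>R e - (p \<bullet> f) *\<^sub>R f" by (simp add: algebra_simps)
  show "c \<bullet> e = 0" "c \<bullet> f = 0" by (subst p, simp add: inner_diff_left frame_simps)+
qed

lemma frame': "orthonormal_pair f (- e)"
  using frame by (simp add: orthonormal_pair_def inner_commute)

lemma bounded_S: "bounded S" using compact_S by (rule compact_imp_bounded)

lemma K_nonempty: "K \<noteq> {}" using S_nonempty S_subset by blast

lemma planar_circle:
  assumes "p \<in> S"
  shows "p = c + (p \<bullet> circle_pt e f t) *\<^sub>R circle_pt e f t + (p \<bullet> circle_pt f (- e) t) *\<^sub>R circle_pt f (- e) t"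
proof -
  define a b where "a = p \<bullet> e" and "b = p \<bullet> f"
  have "(p \<bullet> circle_pt e f t) *\<^sub>R circle_pt e f t + (p \<bullet> circle_pt f (- e) t) *\<^sub>R circle_pt f (- e) t
    = ((a * cos t + b * sin t) * cos t - (b * cos t - a * sin t) * sin t) *\<^sub>R e
     + ((a * cos t + b * sin t) * sin t + (b * cos t - a * sin t) * cos t) *\<^sub>R f"
    by (simp add: circle_pt_def a_def b_def inner_add_right inner_diff_right algebra_simps)
  also have "(a * cos t + b * sin t) * cos t - (b * cos t - a * sin t) * sin t = a * ((cos t)\<^sup>2 + (sin t)\<^sup>2)"
    by algebra
  also have "(a * cos t + b * sin t) * sin t + (b * cos t - a * sin t) * cos t = b * ((cos t)\<^sup>2 + (sin t)\<^sup>2)"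
    by algebra
  finally show ?thesis using planar[OF assms] by (simp add: a_def b_def add.assoc)
qed

lemma touching_pt:
  obtains s where "tangent_pt t s \<in> S"
proof -
  obtain p where p: "p \<in> S" "p \<bullet> circle_pt e f t = H t"
    using support_fun_attained[OF compact_S S_nonempty] unfolding H_def by metis
  then have "tangent_pt t (p \<bullet> circle_pt f (- e) t) = p"
    using planar_circle[OF p(1), of t] by (simp add: tangent_pt_def)
  then show ?thesis using that p by metis
qed

lemma tangent_pt_notin_interior: "tangent_pt t s \<notin> interior K"
  unfolding tangent_pt_def H_def by (rule tangent_outside)

lemma tangent_pt_segment: "closed_segment (tangent_pt t a) (tangent_pt t b) \<inter> interior K = {}"
proof -
  have "z \<notin> interior K" if z: "z \<in> closed_segment (tangent_pt t a) (tangent_pt t b)" for z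
  proof -
    obtain u where "z = (1 - u) *\<^sub>R tangent_pt t a + u *\<^sub>R tangent_pt t b"
      using z unfolding in_segment by blast
    then have "z = tangent_pt t ((1 - u) * a + u * b)"
      by (simp add: tangent_pt_def algebra_simps)
    then show ?thesis using tangent_pt_notin_interior by simp
  qed
  then show ?thesis by auto
qed

lemma dist_tangent_pt: "dist (tangent_pt t a) (tangent_pt t b) = \<bar>a - b\<bar>"
proof -
  have "tangent_pt t a - tangent_pt t b = (a - b) *\<^sub>R circle_pt f (- e) t"
    by (simp add: tangent_pt_def algebra_simps)
  then show ?thesis by (simp add: dist_norm frame')
qed

text \<open>The common point of the tangent lines at the angles \<open>t\<close> and \<open>t + d\<close>, that is, a vertex of a
circumscribed polygon, in the coordinates of either line.\<close>

lemma tangent_pt_vertex: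
  assumes "sin d \<noteq> 0"
  shows "tangent_pt t ((H (t + d) - H t * cos d) / sin d) = tangent_pt (t + d) ((H (t + d) * cos d - H t) / sin d)"
proof -
  define u n where "u = circle_pt e f t" and "n = circle_pt f (- e) t"
  have u: "circle_pt e f (t + d) = cos d *\<^sub>R u + sin d *\<^sub>R n"
    by (simp add: u_def n_def circle_pt_def cos_add sin_add algebra_simps)
  have n: "circle_pt f (- e) (t + d) = cos d *\<^sub>R n - sin d *\<^sub>R u"
    by (simp add: u_def n_def circle_pt_def cos_add sin_add algebra_simps)
  let ?a = "H t" and ?b = "H (t + d)" and ?s = "(H (t + d) * cos d - H t) / sin d"
  have "tangent_pt (t + d) ?s = c + (?b * cos d - ?s * sin d) *\<^sub>R u + (?b * sin d + ?s * cos d) *\<^sub>R n"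
    unfolding tangent_pt_def u n by (simp add: algebra_simps)
  also have "?b * cos d - ?s * sin d = ?a" using assms by simp
  also have "?b * sin d + ?s * cos d = (?b * (sin d)\<^sup>2 + ?b * (cos d)\<^sup>2 - ?a * cos d) / sin d"
    using assms by (simp add: power2_eq_square add_divide_distrib diff_divide_distrib left_diff_distrib)
  also have "?b * (sin d)\<^sup>2 + ?b * (cos d)\<^sup>2 = ?b" by (simp flip: distrib_left)
  finally show ?thesis by (simp add: tangent_pt_def u_def n_def)
qed

lemma inner_tangent_pt: "tangent_pt t s \<bullet> circle_pt e f (t + d) = H t * cos d + s * sin d"
proof -
  have 1: "c \<bullet> circle_pt e f (t + d) = 0" by (simp add: circle_pt_def inner_add_right c_orthogonal)
  have 2: "circle_pt f (- e) t \<bullet> circle_pt e f (t + d) = sin d"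
    using sin_diff[of "t + d" t]
    by (simp add: circle_pt_def inner_add_right inner_add_left inner_diff_left frame_simps algebra_simps)
  show ?thesis
    by (simp add: tangent_pt_def inner_add_left 1 2 inner_circle_pt[OF frame])
qed

lemma closest_point_touching: "p \<in> S \<Longrightarrow> closest_point K p = p"
  using S_subset by (intro closest_point_self) auto

text \<open>From a contact point go along its tangent line to the vertex and along the next tangent line to the
next contact point, and project onto the frontier. The heights add up so that the contribution
\<open>s' - s\<close> telescopes along a polygon, and what remains is a term of a trapezoidal sum for the integral
of the support function.\<close>

lemma touching_step:
  assumes d: "0 < d" "d < pi" and S: "tangent_pt t s \<in> S" "tangent_pt (t + d) s' \<in> S"
  shows "0 \<le> s' - s + (H t + H (t + d)) * tan (d / 2)"
    and "intrinsic_dist (frontier K) (tangent_pt t s) (tangent_pt (t + d) s')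
      \<le> ennreal (s' - s + (H t + H (t + d)) * tan (d / 2))"
proof -
  have sd: "sin d > 0" using d by (rule sin_gt_zero)
  define a b where "a = (H (t + d) - H t * cos d) / sin d" and "b = (H (t + d) * cos d - H t) / sin d"
  have "H t * cos d + s * sin d \<le> H (t + d)"
    using support_fun_ge[OF bounded_S S(1), of "circle_pt e f (t + d)"] by (simp add: inner_tangent_pt H_def)
  then have a: "s \<le> a" using sd by (simp add: a_def field_simps)
  have "H (t + d) * cos (- d) + s' * sin (- d) \<le> H t"
    using support_fun_ge[OF bounded_S S(2), of "circle_pt e f t"] inner_tangent_pt[of "t + d" s' "- d"]
    by (simp add: H_def)
  then have b: "b \<le> s'" using sd by (simp add: b_def field_simps)
  have V: "tangent_pt t a = tangent_pt (t + d) b"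
    unfolding a_def b_def using sd by (intro tangent_pt_vertex) simp
  have tan: "tan (d / 2) = (1 - cos d) / sin d"
  proof -
    have c2: "cos (d / 2) > 0" using d by (intro cos_gt_zero) auto
    have s2: "sin (d / 2) > 0" using d by (intro sin_gt_zero) auto
    have "cos d = 1 - 2 * (sin (d / 2))\<^sup>2" "sin d = 2 * sin (d / 2) * cos (d / 2)"
      using cos_double_sin[of "d / 2"] sin_double[of "d / 2"] by simp_all
    then show ?thesis using c2 s2 by (simp add: tan_def field_simps power2_eq_square)
  qed
  have sum: "(a - s) + (s' - b) = s' - s + (H t + H (t + d)) * tan (d / 2)"
    using sd by (simp add: a_def b_def tan field_simps)
  show "0 \<le> s' - s + (H t + H (t + d)) * tan (d / 2)" using a b unfolding sum[symmetric] by simp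
  let ?P = "closest_point K" and ?D = "intrinsic_dist (frontier K)"
  have 1: "?D (?P (tangent_pt t s)) (?P (tangent_pt t a)) \<le> ennreal (a - s)"
    using intrinsic_dist_closest_point_le[OF compact_K convex_K K_nonempty tangent_pt_segment[of t s a]] a
    by (simp add: dist_tangent_pt)
  have 2: "?D (?P (tangent_pt (t + d) b)) (?P (tangent_pt (t + d) s')) \<le> ennreal (s' - b)"
    using intrinsic_dist_closest_point_le[OF compact_K convex_K K_nonempty tangent_pt_segment[of "t + d" b s']] b
    by (simp add: dist_tangent_pt)
  have "?D (?P (tangent_pt t s)) (?P (tangent_pt (t + d) s')) \<le> ennreal (a - s) + ennreal (s' - b)"
    by (rule order_trans[OF intrinsic_dist_triangle add_mono[OF 1[unfolded V] 2]])
  also have "\<dots> = ennreal (s' - s + (H t + H (t + d)) * tan (d / 2))"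
    using a b by (simp add: sum flip: ennreal_plus)
  finally show "?D (tangent_pt t s) (tangent_pt (t + d) s') \<le> ennreal (s' - s + (H t + H (t + d)) * tan (d / 2))"
    using S by (simp add: closest_point_touching)
qed

lemma touching_chain:
  fixes s :: "nat \<Rightarrow> real" and t d :: real and m :: nat
  assumes d: "0 < d" "d < pi" and S: "\<And>i::nat. i \<le> m \<Longrightarrow> tangent_pt (t + real i * d) (s i) \<in> S"
  shows "0 \<le> s m - s 0 + tan (d / 2) * (\<Sum>i<m. H (t + real i * d) + H (t + real (Suc i) * d)) \<and>
    intrinsic_dist (frontier K) (tangent_pt t (s 0)) (tangent_pt (t + real m * d) (s m))
      \<le> ennreal (s m - s 0 + tan (d / 2) * (\<Sum>i<m. H (t + real i * d) + H (t + real (Suc i) * d)))"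
  using S
proof (induction m)
  case 0
  have "intrinsic_dist (frontier K) (closest_point K (tangent_pt t (s 0))) (closest_point K (tangent_pt t (s 0))) \<le> ennreal 0"
    using intrinsic_dist_closest_point_le[OF compact_K convex_K K_nonempty tangent_pt_segment[of t "s 0" "s 0"]] by simp
  then show ?case using 0[of 0] by (simp add: closest_point_touching)
next
  case (Suc m)
  let ?D = "intrinsic_dist (frontier K)"
  let ?r = "s m - s 0 + tan (d / 2) * (\<Sum>i<m. H (t + real i * d) + H (t + real (Suc i) * d))"
  have IH: "0 \<le> ?r" "?D (tangent_pt t (s 0)) (tangent_pt (t + real m * d) (s m)) \<le> ennreal ?r"
    using Suc.IH Suc.prems by auto
  have eq: "t + real (Suc m) * d = (t + real m * d) + d" by (simp add: algebra_simps)
  let ?q = "s (Suc m) - s m + (H (t + real m * d) + H ((t + real m * d) + d)) * tan (d / 2)"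
  have step: "0 \<le> ?q" "?D (tangent_pt (t + real m * d) (s m)) (tangent_pt (t + real (Suc m) * d) (s (Suc m))) \<le> ennreal ?q"
    unfolding eq using Suc.prems[of m] Suc.prems[of "Suc m"] d
    by (auto intro!: touching_step simp: eq simp del: of_nat_Suc)
  have "?D (tangent_pt t (s 0)) (tangent_pt (t + real (Suc m) * d) (s (Suc m))) \<le> ennreal ?r + ennreal ?q"
    by (rule order_trans[OF intrinsic_dist_triangle add_mono[OF IH(2) step(2)]])
  also have "\<dots> = ennreal (?r + ?q)" by (rule ennreal_plus[symmetric, OF IH(1) step(1)])
  also have "?r + ?q = s (Suc m) - s 0 + tan (d / 2) * (\<Sum>i<Suc m. H (t + real i * d) + H (t + real (Suc i) * d))"
    unfolding eq[symmetric] by (simp add: algebra_simps)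
  finally show ?case using IH(1) step(1)
    by (simp only: \<open>?r + ?q = _\<close>[symmetric]) simp
qed

lemma continuous_on_H: "continuous_on A H"
  unfolding H_def
  by (rule continuous_on_compose2[OF continuous_on_support_fun[OF bounded_S S_nonempty, of UNIV]])
     (auto intro: continuous_intros)

lemma H_integrable: "H integrable_on {a..b}"
  using continuous_on_H by (rule integrable_continuous_real)

lemma H_periodic: "H (t + 2 * pi) = H t"
  by (simp add: H_def circle_pt_periodic)

lemma H_lipschitz:
  obtains B where "0 \<le> B" "\<And>s t. \<bar>H s - H t\<bar> \<le> B * \<bar>s - t\<bar>"
proof -
  obtain B where B: "\<And>p. p \<in> S \<Longrightarrow> norm p \<le> B" using bounded_S by (auto simp: bounded_iff)
  have lip: "B-lipschitz_on UNIV (support_fun S)" by (rule support_fun_lipschitz[OF S_nonempty B])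
  have "0 \<le> B" using lip by (rule lipschitz_on_nonneg)
  moreover have "\<bar>H s - H t\<bar> \<le> B * \<bar>s - t\<bar>" for s t
  proof -
    have "\<bar>H s - H t\<bar> \<le> B * norm (circle_pt e f s - circle_pt e f t)"
      using lipschitz_onD[OF lip, of "circle_pt e f s" "circle_pt e f t"]
      by (simp add: H_def dist_real_def dist_norm)
    also have "\<dots> \<le> B * \<bar>s - t\<bar>"
      using circle_pt_lipschitz[OF frame] \<open>0 \<le> B\<close> by (rule mult_left_mono)
    finally show ?thesis .
  qed
  ultimately show ?thesis using that by blast
qed

lemma trapezoid_sum_le:
  fixes t d B :: real and m :: nat
  assumes B: "0 \<le> B" "\<And>s t. \<bar>H s - H t\<bar> \<le> B * \<bar>s - t\<bar>" and d: "0 \<le> d"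
  shows "d / 2 * (\<Sum>i<m. H (t + real i * d) + H (t + real (Suc i) * d)) \<le> integral {t..t + real m * d} H + m * (B * d\<^sup>2)"
proof (induction m)
  case (Suc m)
  let ?x = "t + real m * d" and ?y = "t + real (Suc m) * d"
  have y: "?y = ?x + d" by (simp add: algebra_simps)
  have lower: "(H ?x + H ?y) / 2 - B * d \<le> H z" if "z \<in> {?x..?y}" for z
  proof -
    have "\<bar>H ?x - H z\<bar> \<le> B * d" "\<bar>H ?y - H z\<bar> \<le> B * d"
      using that B(1) y by (auto intro!: order_trans[OF B(2)] mult_left_mono)
    moreover have "(p + q) / 2 - k \<le> r" if "\<bar>p - r\<bar> \<le> k" "\<bar>q - r\<bar> \<le> k" for p q r k :: real
    proof -
      have "p \<le> r + k" "q \<le> r + k" using that by (simp_all add: abs_le_iff)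
      then show ?thesis by argo
    qed
    ultimately show ?thesis by blast
  qed
  have "d * ((H ?x + H ?y) / 2 - B * d) = integral {?x..?y} (\<lambda>_. (H ?x + H ?y) / 2 - B * d)"
    using d y by simp
  also have "\<dots> \<le> integral {?x..?y} H"
    using lower by (intro integral_le H_integrable) auto
  finally have "d / 2 * (H ?x + H ?y) \<le> integral {?x..?y} H + B * d\<^sup>2"
    by (simp add: power2_eq_square algebra_simps)
  moreover have "integral {t..?y} H = integral {t..?x} H + integral {?x..?y} H"
    using d y by (intro Henstock_Kurzweil_Integration.integral_combine[symmetric] H_integrable) auto
  ultimately show ?case using Suc.IH by (simp add: algebra_simps del: of_nat_Suc) (simp add: algebra_simps)
qed simp

text \<open>Refining the circumscribed polygon between two contact points turns the trapezoidal sums into the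
integral: this is Cauchy's formula for the length of an arc, as an upper bound. In the degenerate case
of a single tangent line the arc is a segment, traversed in the positive direction.\<close>

lemma arc_bound:
  assumes le: "a \<le> b" and S: "tangent_pt a sa \<in> S" "tangent_pt b sb \<in> S" and eq: "a = b \<Longrightarrow> sa \<le> sb"
  shows "0 \<le> sb - sa + integral {a..b} H"
    and "intrinsic_dist (frontier K) (tangent_pt a sa) (tangent_pt b sb) \<le> ennreal (sb - sa + integral {a..b} H)"
proof -
  let ?D = "intrinsic_dist (frontier K) (tangent_pt a sa) (tangent_pt b sb)"
  let ?r = "sb - sa + integral {a..b} H"
  have "0 \<le> ?r \<and> ?D \<le> ennreal ?r"
  proof (cases "a = b")
    case True
    have "intrinsic_dist (frontier K) (closest_point K (tangent_pt a sa)) (closest_point K (tangent_pt a sb)) \<le> ennreal (sb - sa)"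
      using intrinsic_dist_closest_point_le[OF compact_K convex_K K_nonempty tangent_pt_segment[of a sa sb]] eq[OF True]
      by (simp add: dist_tangent_pt)
    then show ?thesis using eq True S by (simp add: closest_point_touching)
  next
    case False
    with le have ab: "a < b" by simp
    obtain B where B: "0 \<le> B" "\<And>s t. \<bar>H s - H t\<bar> \<le> B * \<bar>s - t\<bar>" using H_lipschitz by blast
    obtain \<sigma> where \<sigma>: "\<And>t. tangent_pt t (\<sigma> t) \<in> S"
    proof -
      have "\<forall>t. \<exists>s. tangent_pt t s \<in> S" by (metis touching_pt)
      then show ?thesis using that by metis
    qed
    \<comment> \<open>The step \<open>d = (b - a) / m\<close> must be less than \<open>pi\<close> for consecutive tangents to meet on the right side;
        the quotient \<open>tan (d / 2) / (d / 2)\<close> turns the weights of the polygon into those of the trapezoidal rule.\<close>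
    define q where "q m = sb - sa + tan ((b - a) / real m / 2) / ((b - a) / real m / 2) *
      (integral {a..b} H + B * (b - a)\<^sup>2 / real m)" for m
    have bound: "0 \<le> q m \<and> ?D \<le> ennreal (q m)" if m: "real m > (b - a) / pi" for m
    proof -
      have m0: "0 < real m" using m ab by (meson diff_gt_0_iff_gt divide_pos_pos less_trans pi_gt_zero)
      define d where "d = (b - a) / real m"
      have d: "0 < d" "d < pi" using m0 m ab by (simp_all add: d_def field_simps)
      have md: "a + real m * d = b" using m0 by (simp add: d_def)
      define s where "s i = (if i = 0 then sa else if i = m then sb else \<sigma> (a + real i * d))" for i
      have sS: "tangent_pt (a + real i * d) (s i) \<in> S" for i
        using \<sigma> S md by (auto simp: s_def)
      have s: "s 0 = sa" "s m = sb" using m0 by (auto simp: s_def)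
      let ?\<Sigma> = "\<Sum>i<m. H (a + real i * d) + H (a + real (Suc i) * d)"
      have chain: "0 \<le> sb - sa + tan (d / 2) * ?\<Sigma>" "?D \<le> ennreal (sb - sa + tan (d / 2) * ?\<Sigma>)"
        using touching_chain[OF d, of m a s] sS s md by auto
      have tan: "tan (d / 2) > 0" using d by (intro tan_gt_zero) auto
      have "d / 2 * ?\<Sigma> \<le> integral {a..a + real m * d} H + m * (B * d\<^sup>2)"
        using d by (intro trapezoid_sum_le B) auto
      also have "m * (B * d\<^sup>2) = B * (b - a)\<^sup>2 / m" using m0 by (simp add: d_def power2_eq_square)
      finally have "tan (d / 2) / (d / 2) * (d / 2 * ?\<Sigma>) \<le> tan (d / 2) / (d / 2) * (integral {a..b} H + B * (b - a)\<^sup>2 / m)"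
        using tan d unfolding md by (intro mult_left_mono) auto
      then have "tan (d / 2) * ?\<Sigma> \<le> tan (d / 2) / (d / 2) * (integral {a..b} H + B * (b - a)\<^sup>2 / m)"
        using d by simp
      then have "sb - sa + tan (d / 2) * ?\<Sigma> \<le> q m" unfolding q_def d_def[symmetric] by simp
      then show ?thesis using chain by (meson ennreal_leI order_trans)
    qed
    have lim: "q \<longlonglongrightarrow> ?r"
    proof -
      have tan: "((\<lambda>x. tan x / x) \<longlongrightarrow> 1) (at (0::real))"
        using DERIV_tan[of 0] by (simp add: has_field_derivative_iff)
      have "(\<lambda>m. (b - a) / real m / 2) \<longlonglongrightarrow> 0"
        using lim_const_over_n[of "(b - a) / 2"] by (simp add: divide_divide_eq_left mult.commute)
      then have "filterlim (\<lambda>m. (b - a) / real m / 2) (at 0) sequentially"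
        using ab by (auto simp: filterlim_at intro!: eventually_sequentiallyI[of 1])
      from filterlim_compose[OF tan this]
      have 1: "(\<lambda>m. tan ((b - a) / real m / 2) / ((b - a) / real m / 2)) \<longlonglongrightarrow> 1" .
      have 2: "(\<lambda>m. integral {a..b} H + B * (b - a)\<^sup>2 / real m) \<longlonglongrightarrow> integral {a..b} H + 0"
        by (intro tendsto_add tendsto_const lim_const_over_n)
      have "q \<longlonglongrightarrow> sb - sa + 1 * (integral {a..b} H + 0)"
        unfolding q_def by (intro tendsto_add tendsto_const tendsto_mult 1 2)
      then show ?thesis by simp
    qed
    obtain N where N: "real N > (b - a) / pi" using reals_Archimedean2 by blast
    have ev: "\<forall>\<^sub>F m in sequentially. 0 \<le> q m \<and> ?D \<le> ennreal (q m)"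
      using eventually_ge_at_top[of N]
    proof eventually_elim
      case (elim m) then show ?case using N by (intro bound) (auto intro: less_le_trans)
    qed
    have "0 \<le> ?r"
      using lim by (rule tendsto_lowerbound) (rule eventually_mono[OF ev], auto)
    moreover have "?D \<le> ennreal ?r"
      using tendsto_ennrealI[OF lim] by (rule tendsto_lowerbound) (rule eventually_mono[OF ev], auto)
    ultimately show ?thesis ..
  qed
  then show "0 \<le> ?r" "?D \<le> ennreal ?r" by auto
qed

text \<open>The heights enter the bounds for the two complementary arcs with opposite signs, so the bounds add
up to the integral over a full turn, and the smaller one is at most half of it.\<close>

lemma two_arcs_bound:
  assumes ab: "a \<le> b" "b < a + 2 * pi" and S: "tangent_pt a sa \<in> S" "tangent_pt b sb \<in> S"
  shows "intrinsic_dist (frontier K) (tangent_pt a sa) (tangent_pt b sb) \<le> ennreal (integral {0..2 * pi} H / 2)"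
proof -
  let ?D = "intrinsic_dist (frontier K)"
  have main: "?D (tangent_pt a sa) (tangent_pt b sb) \<le> ennreal (integral {0..2 * pi} H / 2)"
    if ab: "a \<le> b" "b < a + 2 * pi" and S: "tangent_pt a sa \<in> S" "tangent_pt b sb \<in> S"
      and eq: "a = b \<Longrightarrow> sa \<le> sb" for a b sa sb
  proof -
    have per: "tangent_pt (a + 2 * pi) s = tangent_pt a s" for s
      by (simp add: tangent_pt_def circle_pt_periodic H_periodic)
    let ?r1 = "sb - sa + integral {a..b} H" and ?r2 = "sa - sb + integral {b..a + 2 * pi} H"
    have 1: "0 \<le> ?r1" "?D (tangent_pt a sa) (tangent_pt b sb) \<le> ennreal ?r1"
      using arc_bound[OF ab(1) S eq] by auto
    have 2: "0 \<le> ?r2" "?D (tangent_pt a sa) (tangent_pt b sb) \<le> ennreal ?r2"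
      using arc_bound[of b "a + 2 * pi" sb sa] ab S by (auto simp: per intrinsic_dist_commute[of _ "tangent_pt a sa"])
    have "integral {a..b} H + integral {b..a + 2 * pi} H = integral {0..2 * pi} H"
      using ab integral_circle_shift[OF continuous_on_H H_periodic, of a]
      by (simp add: Henstock_Kurzweil_Integration.integral_combine[OF _ _ H_integrable])
    then have "min ?r1 ?r2 \<le> integral {0..2 * pi} H / 2" by linarith
    moreover have "?D (tangent_pt a sa) (tangent_pt b sb) \<le> ennreal (min ?r1 ?r2)"
      using 1 2 by (simp add: min_def)
    ultimately show ?thesis by (meson ennreal_leI order_trans)
  qed
  show ?thesis
  proof (cases "a = b \<and> sb < sa")
    case True
    then show ?thesis using main[of b a sb sa] S by (simp add: intrinsic_dist_commute)
  next
    case False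
    then show ?thesis using ab S by (intro main) auto
  qed
qed


lemma tangent_pt_eq:
  assumes "p \<in> S" "\<And>q. q \<in> S \<Longrightarrow> q \<bullet> circle_pt e f t \<le> p \<bullet> circle_pt e f t"
  shows "tangent_pt t (p \<bullet> circle_pt f (- e) t) = p"
proof -
  have "H t = p \<bullet> circle_pt e f t"
    unfolding H_def using assms bounded_S by (intro antisym support_fun_le support_fun_ge) auto
  then show ?thesis using planar_circle[OF assms(1), of t] by (simp add: tangent_pt_def)
qed

lemma normal_angle:
  assumes p: "p \<in> S" and nz: "(A, B) \<noteq> (0, 0)"
    and max: "\<And>q. q \<in> S \<Longrightarrow> (q - p) \<bullet> (A *\<^sub>R e + B *\<^sub>R f) \<le> 0"
  obtains t s where "b \<le> t" "t < b + 2 * pi" "tangent_pt t s = p"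
proof -
  define r where "r = sqrt (A\<^sup>2 + B\<^sup>2)"
  have r: "0 < r" using nz by (auto simp: r_def sum_power2_gt_zero_iff)
  have "(A / r)\<^sup>2 + (B / r)\<^sup>2 = 1"
    using r by (simp add: power_divide add_divide_distrib[symmetric]) (simp add: r_def)
  then obtain t where t: "b \<le> t" "t < b + 2 * pi" "(A / r) *\<^sub>R e + (B / r) *\<^sub>R f = circle_pt e f t"
    by (rule exists_circle_pt)
  have eq: "circle_pt e f t = (1 / r) *\<^sub>R (A *\<^sub>R e + B *\<^sub>R f)"
    using t(3) by (simp add: scaleR_add_right)
  have "tangent_pt t (p \<bullet> circle_pt f (- e) t) = p"
  proof (rule tangent_pt_eq[OF p])
    fix q assume "q \<in> S"
    then have "(q - p) \<bullet> circle_pt e f t \<le> 0"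
      unfolding eq using max[of q] r by (simp add: divide_le_0_iff)
    then show "q \<bullet> circle_pt e f t \<le> p \<bullet> circle_pt e f t" by (simp add: inner_diff_left)
  qed
  then show ?thesis using t that by blast
qed

lemma intrinsic_dist_le_half_perimeter:
  assumes x: "x \<in> S" "(A, B) \<noteq> (0, 0)" "\<And>q. q \<in> S \<Longrightarrow> (q - x) \<bullet> (A *\<^sub>R e + B *\<^sub>R f) \<le> 0"
    and y: "y \<in> S" "(A', B') \<noteq> (0, 0)" "\<And>q. q \<in> S \<Longrightarrow> (q - y) \<bullet> (A' *\<^sub>R e + B' *\<^sub>R f) \<le> 0"
  shows "intrinsic_dist (frontier K) x y \<le> ennreal (integral {0..2 * pi} H / 2)"
proof -
  obtain a sa where a: "tangent_pt a sa = x" using normal_angle[OF x, of 0] by metis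
  obtain b sb where b: "a \<le> b" "b < a + 2 * pi" "tangent_pt b sb = y" using normal_angle[OF y, of a] by metis
  show ?thesis using two_arcs_bound[OF b(1,2), of sa sb] a b x(1) y(1) by simp
qed

end

section \<open>Distance in a hypersurface and the perimeter of a plane slice\<close>

definition plane_slice :: "'a::euclidean_space set \<Rightarrow> 'a \<Rightarrow> 'a \<Rightarrow> 'a \<Rightarrow> 'a set" where
  "plane_slice K e f c = {p \<in> K. p = c + (p \<bullet> e) *\<^sub>R e + (p \<bullet> f) *\<^sub>R f}"

lemma compact_plane_slice:
  assumes "compact K" shows "compact (plane_slice K e f c)"
proof -
  have "closed {p. p = c + (p \<bullet> e) *\<^sub>R e + (p \<bullet> f) *\<^sub>R f}"
    by (intro closed_Collect_eq continuous_intros)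
  then show ?thesis
    unfolding plane_slice_def using compact_Int_closed[OF assms] by (simp add: Collect_conj_eq)
qed

text \<open>If the slice meets the interior of \<open>K\<close>, then a supporting hyperplane of \<open>K\<close> at a frontier point cuts
the plane in a tangent line of the slice, and the arcs of the slice can be used. Otherwise the slice
lies in \<open>M\<close>, and so does the segment from \<open>x\<close> to \<open>y\<close>. A segment is compared to its own
perimeter in the same way, with its end points as contact points.\<close>

lemma intrinsic_dist_le_slice:
  fixes K :: "'a::euclidean_space set"
  assumes K: "compact K" "convex K" "interior K \<noteq> {}" and frame: "orthonormal_pair e f"
    and x: "x \<in> frontier K" "x \<in> plane_slice K e f c"
    and y: "y \<in> frontier K" "y \<in> plane_slice K e f c"
  shows "intrinsic_dist (frontier K) x y
    \<le> ennreal (integral {0..2 * pi} (\<lambda>t. support_fun (plane_slice K e f c) (circle_pt e f t)) / 2)"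
proof -
  let ?S = "plane_slice K e f c"
  have fs: "e \<bullet> e = 1" "f \<bullet> f = 1" "e \<bullet> f = 0" "f \<bullet> e = 0"
    using frame by (auto simp: orthonormal_pair_def norm_eq_1 inner_commute)
  have in_plane: "p = c + (p \<bullet> e) *\<^sub>R e + (p \<bullet> f) *\<^sub>R f" if "p \<in> ?S" for p
    using that unfolding plane_slice_def by blast
  have c: "c \<bullet> e = 0" "c \<bullet> f = 0"
  proof -
    have p: "c = x - (x \<bullet> e) *\<^sub>R e - (x \<bullet> f) *\<^sub>R f" using in_plane[OF x(2)] by (simp add: algebra_simps)
    show "c \<bullet> e = 0" "c \<bullet> f = 0" by (subst p, simp add: inner_diff_left fs)+
  qed
  have SK: "?S \<subseteq> K" by (auto simp: plane_slice_def)
  have cS: "compact ?S" using K by (intro compact_plane_slice)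
  have in_S: "z \<in> ?S" if "z \<in> K" "z = c + a *\<^sub>R circle_pt e f t + s *\<^sub>R circle_pt f (- e) t" for z a s t
  proof -
    have z: "z = c + (a * cos t - s * sin t) *\<^sub>R e + (a * sin t + s * cos t) *\<^sub>R f"
      unfolding that(2) by (simp add: circle_pt_def algebra_simps)
    then have "z \<bullet> e = a * cos t - s * sin t" "z \<bullet> f = a * sin t + s * cos t"
      by (simp_all add: inner_add_left c fs)
    then show ?thesis using z that(1) by (simp add: plane_slice_def)
  qed
  show ?thesis
  proof (cases "?S \<inter> interior K = {}")
    case False
    then obtain k where k: "k \<in> ?S" "k \<in> interior K" by auto
    interpret planar_section K ?S e f c
    proof
      fix t s
      let ?u = "circle_pt e f t" and ?n = "circle_pt f (- e) t"
      let ?z = "c + support_fun ?S ?u *\<^sub>R ?u + s *\<^sub>R ?n"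
      show "?z \<notin> interior K"
      proof
        assume "?z \<in> interior K"
        then obtain r where r: "0 < r" "ball ?z r \<subseteq> K" by (auto simp: mem_interior)
        let ?w = "?z + (r / 2) *\<^sub>R ?u"
        have "?w \<in> ball ?z r" using r frame by (simp add: dist_norm)
        then have wK: "?w \<in> K" using r(2) by blast
        have "?w \<in> ?S"
          by (rule in_S[OF wK, where t = t and a = "support_fun ?S ?u + r / 2" and s = s]) (simp add: algebra_simps)
        then have "?w \<bullet> ?u \<le> support_fun ?S ?u"
          using cS by (intro support_fun_ge) (auto simp: compact_imp_bounded)
        moreover have "?w \<bullet> ?u = support_fun ?S ?u + r / 2"
        proof -
          have "?n \<bullet> ?u = 0" "c \<bullet> ?u = 0" by (simp_all add: circle_pt_def inner_add_left inner_add_right inner_diff_left fs c)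
          then show ?thesis by (simp add: inner_add_left inner_circle_pt[OF frame])
        qed
        ultimately show False using r by simp
      qed
    qed (use K frame cS SK k in_plane in auto)
    have normal: "\<exists>A B. (A, B) \<noteq> (0, 0) \<and> (\<forall>q\<in>?S. (q - p) \<bullet> (A *\<^sub>R e + B *\<^sub>R f) \<le> 0)"
      if p: "p \<in> frontier K" "p \<in> ?S" for p
    proof -
      have ri: "rel_interior K = interior K" using K(3) by (rule rel_interior_nonempty_interior)
      have "p \<in> K" "p \<notin> rel_interior K" using p SK ri by (auto simp: frontier_def)
      then obtain a where a: "\<And>q. q \<in> K \<Longrightarrow> a \<bullet> p \<le> a \<bullet> q" "\<And>q. q \<in> rel_interior K \<Longrightarrow> a \<bullet> p < a \<bullet> q"
        using supporting_hyperplane_rel_boundary[OF K(2)] by metis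
      let ?A = "- (a \<bullet> e)" and ?B = "- (a \<bullet> f)"
      have eq: "(q - p) \<bullet> (?A *\<^sub>R e + ?B *\<^sub>R f) = a \<bullet> p - a \<bullet> q" if "q \<in> ?S" for q
      proof -
        have "a \<bullet> z = a \<bullet> c + (z \<bullet> e) * (a \<bullet> e) + (z \<bullet> f) * (a \<bullet> f)" if "z \<in> ?S" for z
          by (subst in_plane[OF that]) (simp add: inner_add_right)
        from this[OF \<open>q \<in> ?S\<close>] this[OF p(2)] show ?thesis
          by (simp add: inner_add_right inner_diff_left algebra_simps)
      qed
      have "(?A, ?B) \<noteq> (0, 0)" using eq[OF k(1)] a(2)[of k] k(2) ri by auto
      moreover have "(q - p) \<bullet> (?A *\<^sub>R e + ?B *\<^sub>R f) \<le> 0" if "q \<in> ?S" for q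
        using eq[OF that] a(1)[of q] that SK by auto
      ultimately show ?thesis by blast
    qed
    show ?thesis
      using normal[OF x] normal[OF y] x(2) y(2) intrinsic_dist_le_half_perimeter unfolding H_def by blast
  next
    case outside: True
    have SM: "z \<notin> interior K" if "z = c + a *\<^sub>R circle_pt e f t + s *\<^sub>R circle_pt f (- e) t" for z a s t
      using in_S[of z, OF _ that] outside interior_subset[of K] by blast
    let ?T = "closed_segment x y"
    have TS: "?T \<subseteq> ?S"
    proof
      fix z assume z: "z \<in> ?T"
      then obtain u where u: "0 \<le> u" "u \<le> 1" "z = (1 - u) *\<^sub>R x + u *\<^sub>R y" unfolding in_segment by blast
      have zK: "z \<in> K" using z x y SK K(2) by (auto simp: convex_contains_segment)
      have "z = c + ((1 - u) * (x \<bullet> e) + u * (y \<bullet> e)) *\<^sub>R e + ((1 - u) * (x \<bullet> f) + u * (y \<bullet> f)) *\<^sub>R f"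
        unfolding u(3) by (subst in_plane[OF x(2)], subst in_plane[OF y(2)]) (simp add: algebra_simps)
      then show "z \<in> ?S"
        by (intro in_S[OF zK, where t = 0]) (simp add: circle_pt_def add.assoc)
    qed
    interpret planar_section K ?T e f c
      by standard (use K frame TS SK SM in_plane in auto)
    have "integral {0..2 * pi} H \<le> integral {0..2 * pi} (\<lambda>t. support_fun ?S (circle_pt e f t))"
    proof (rule integral_le[OF H_integrable])
      have "continuous_on {0..2 * pi} (\<lambda>t. support_fun ?S (circle_pt e f t))"
        by (rule continuous_on_compose2[OF continuous_on_support_fun[of ?S UNIV]])
           (use cS x in \<open>auto intro: continuous_intros compact_imp_bounded\<close>)
      then show "(\<lambda>t. support_fun ?S (circle_pt e f t)) integrable_on {0..2 * pi}"
        by (rule integrable_continuous_real)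
    qed (use cS TS in \<open>auto simp: H_def intro!: support_fun_mono compact_imp_bounded\<close>)
    moreover have "intrinsic_dist (frontier K) x y \<le> ennreal (integral {0..2 * pi} H / 2)"
    proof (cases "x = y")
      case True
      have "intrinsic_dist (frontier K) (closest_point K x) (closest_point K y) \<le> ennreal (dist x y)"
        using True x K SK outside by (intro intrinsic_dist_closest_point_le) auto
      then show ?thesis using True x SK by (simp add: closest_point_self subset_iff)
    next
      case False
      define A where "A = (y - x) \<bullet> e"
      define B where "B = (y - x) \<bullet> f"
      have yx: "y - x = A *\<^sub>R e + B *\<^sub>R f"
      proof -
        have "y - x = (c + (y \<bullet> e) *\<^sub>R e + (y \<bullet> f) *\<^sub>R f) - (c + (x \<bullet> e) *\<^sub>R e + (x \<bullet> f) *\<^sub>R f)"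
          by (simp only: in_plane[OF x(2), symmetric] in_plane[OF y(2), symmetric])
        also have "\<dots> = A *\<^sub>R e + B *\<^sub>R f"
          by (simp add: A_def B_def inner_diff_left algebra_simps)
        finally show ?thesis .
      qed
      have nz: "(A, B) \<noteq> (0, 0)" using yx False by auto
      show ?thesis
      proof (rule intrinsic_dist_le_half_perimeter[of x "- A" "- B" y A B])
        fix q assume "q \<in> ?T"
        then obtain u where u: "0 \<le> u" "u \<le> 1" "q = (1 - u) *\<^sub>R x + u *\<^sub>R y" unfolding in_segment by blast
        define w where "w = y - x"
        have q: "q - x = u *\<^sub>R w" "q - y = - ((1 - u) *\<^sub>R w)"
          unfolding u(3) w_def by (simp_all add: algebra_simps)
        have AB: "A *\<^sub>R e + B *\<^sub>R f = w" "(- A) *\<^sub>R e + (- B) *\<^sub>R f = - w"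
          unfolding w_def yx by simp_all
        show "(q - x) \<bullet> ((- A) *\<^sub>R e + (- B) *\<^sub>R f) \<le> 0" "(q - y) \<bullet> (A *\<^sub>R e + B *\<^sub>R f) \<le> 0"
          unfolding q AB using u by simp_all
      qed (use nz in auto)
    qed
    ultimately show ?thesis by (meson divide_right_mono ennreal_leI order_trans zero_le_numeral)
  qed
qed

section \<open>Displacements in a prescribed direction\<close>

text \<open>The parameter at which a line leaves a convex body is a convex function of the starting point, hence
continuous on the interior. It may fail to be continuous up to the frontier, for instance at faces
parallel to \<open>u\<close>.\<close>

lemma frontier_exit_continuous:
  fixes K :: "'a::euclidean_space set"
  assumes K: "compact K" "convex K" and u: "norm u = 1"
  obtains s where "continuous_on (interior K) s" "\<And>y. y \<in> interior K \<Longrightarrow> y + s y *\<^sub>R u \<in> frontier K"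
proof -
  let ?T = "\<lambda>y. {t. y + t *\<^sub>R u \<in> K}"
  define s where "s y = Inf (?T y)" for y
  have bdd: "bdd_below (?T y)" for y
  proof -
    obtain B where B: "\<And>p. p \<in> K \<Longrightarrow> norm p \<le> B" using compact_imp_bounded[OF K(1)] by (auto simp: bounded_iff)
    have "- (B + norm y) \<le> t" if "t \<in> ?T y" for t
    proof -
      have "\<bar>t\<bar> = norm (t *\<^sub>R u)" using u by simp
      also have "\<dots> \<le> norm (y + t *\<^sub>R u) + norm y"
        using norm_triangle_ineq4[of "y + t *\<^sub>R u" y] by simp
      finally show ?thesis using B[of "y + t *\<^sub>R u"] that by simp
    qed
    then show ?thesis unfolding bdd_below_def by blast
  qed
  have closed: "closed (?T y)" for y
  proof -
    have "closed ((\<lambda>t. y + t *\<^sub>R u) -` K)"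
      using K by (intro closed_vimage continuous_intros compact_imp_closed)
    then show ?thesis by (simp add: vimage_def)
  qed
  have sK: "y + s y *\<^sub>R u \<in> K" if "y \<in> K" for y
  proof -
    have "0 \<in> ?T y" using that by simp
    then have "Inf (?T y) \<in> ?T y" using closed_contains_Inf[OF _ bdd closed] by blast
    then show ?thesis by (simp add: s_def)
  qed
  have le: "s y \<le> t" if "y + t *\<^sub>R u \<in> K" for y t
    unfolding s_def using that by (intro cInf_lower bdd) simp
  have "convex_on (interior K) s"
  proof (rule convex_onI)
    fix t :: real and x y assume "0 < t" "t < 1" and xy: "x \<in> interior K" "y \<in> interior K"
    have xyK: "x + s x *\<^sub>R u \<in> K" "y + s y *\<^sub>R u \<in> K" using xy interior_subset[of K] by (auto intro!: sK)
    have "(1 - t) *\<^sub>R (x + s x *\<^sub>R u) + t *\<^sub>R (y + s y *\<^sub>R u) \<in> K"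
      using K(2) xyK \<open>0 < t\<close> \<open>t < 1\<close> by (intro convexD) auto
    then show "s ((1 - t) *\<^sub>R x + t *\<^sub>R y) \<le> (1 - t) * s x + t * s y"
      by (intro le) (simp add: algebra_simps)
  qed (use K in \<open>simp add: convex_interior\<close>)
  then have "continuous_on (interior K) s" by (intro convex_on_continuous) auto
  moreover have "y + s y *\<^sub>R u \<in> frontier K" if "y \<in> interior K" for y
  proof -
    let ?p = "y + s y *\<^sub>R u"
    have pK: "?p \<in> K" using that interior_subset[of K] by (auto intro!: sK)
    have "?p \<notin> interior K"
    proof
      assume "?p \<in> interior K"
      then obtain r where r: "0 < r" "ball ?p r \<subseteq> K" by (auto simp: mem_interior)
      have "?p - (r / 2) *\<^sub>R u \<in> ball ?p r" using r u by (simp add: dist_norm)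
      then have "?p - (r / 2) *\<^sub>R u \<in> K" using r by blast
      then have "y + (s y - r / 2) *\<^sub>R u \<in> K" by (simp add: algebra_simps)
      from le[OF this] r show False by simp
    qed
    then show ?thesis using pK closure_subset by (auto simp: frontier_def)
  qed
  ultimately show ?thesis using that by blast
qed

text \<open>Apply \<open>\<alpha>\<close> to the frontier point \<open>\<sigma> y\<close> at which the line through \<open>y\<close> in direction \<open>u\<close> leaves \<open>K\<close>. A fixed
point of \<open>y \<mapsto> \<alpha> (\<sigma> y)\<close> would do, since \<open>\<sigma> y\<close> and \<open>y\<close> differ by a multiple of \<open>u\<close>. As \<open>\<sigma>\<close> is only
continuous in the interior, contract the map by a factor \<open>1 - r\<close> towards an interior point, apply
Brouwer's theorem to the contracted body, and let \<open>r\<close> tend to zero.\<close>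

lemma displacement_in_direction:
  fixes K :: "'a::euclidean_space set"
  assumes K: "compact K" "convex K" "interior K \<noteq> {}" and u: "norm u = 1"
    and \<alpha>: "continuous_on (frontier K) \<alpha>" "\<alpha> ` frontier K \<subseteq> frontier K"
  obtains x where "x \<in> frontier K" "\<alpha> x - x = ((\<alpha> x - x) \<bullet> u) *\<^sub>R u"
proof -
  obtain s where s: "continuous_on (interior K) s" "\<And>y. y \<in> interior K \<Longrightarrow> y + s y *\<^sub>R u \<in> frontier K"
    using frontier_exit_continuous[OF K(1,2) u] by blast
  obtain k where k: "k \<in> interior K" using K by blast
  \<comment> \<open>\<open>P\<close> is the orthogonal projection along \<open>u\<close>, and \<open>\<sigma>\<close> moves points along \<open>u\<close>.\<close>
  define \<sigma> where "\<sigma> y = y + s y *\<^sub>R u" for y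
  define P where "P z = z - (z \<bullet> u) *\<^sub>R u" for z
  have FK: "frontier K \<subseteq> K" using K by (simp add: frontier_subset_compact)
  have approx: "\<exists>x\<in>frontier K. P (x - (r *\<^sub>R k + (1 - r) *\<^sub>R \<alpha> x)) = 0" if r: "0 < r" "r \<le> 1" for r
  proof -
    let ?K = "(\<lambda>z. r *\<^sub>R k + (1 - r) *\<^sub>R z) ` K"
    let ?F = "\<lambda>y. r *\<^sub>R k + (1 - r) *\<^sub>R \<alpha> (\<sigma> y)"
    have sub: "?K \<subseteq> interior K"
    proof clarify
      fix z assume z: "z \<in> K"
      have "z - r *\<^sub>R (z - k) \<in> interior K" using K k z r by (intro mem_interior_convex_shrink) auto
      then show "r *\<^sub>R k + (1 - r) *\<^sub>R z \<in> interior K" by (simp add: algebra_simps)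
    qed
    have aff: "?K = (\<lambda>z. r *\<^sub>R k + z) ` ((\<lambda>z. (1 - r) *\<^sub>R z) ` K)" by (auto simp: image_image)
    have "compact ?K" using K unfolding aff by (intro compact_translation compact_scaling)
    moreover have "convex ?K" using K unfolding aff by (intro convex_translation convex_scaling)
    moreover have "?K \<noteq> {}" using k interior_subset by blast
    moreover have "continuous_on ?K ?F"
    proof -
      have "continuous_on ?K \<sigma>"
        unfolding \<sigma>_def using sub s(1) by (intro continuous_intros) (auto intro: continuous_on_subset)
      then have "continuous_on ?K (\<lambda>y. \<alpha> (\<sigma> y))"
        using sub s(2) by (intro continuous_on_compose2[OF \<alpha>(1)]) (auto simp: \<sigma>_def)
      then show ?thesis by (intro continuous_intros)
    qed
    moreover have "?F \<in> ?K \<rightarrow> ?K"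
    proof
      fix y assume "y \<in> ?K"
      then have "\<sigma> y \<in> frontier K" using sub s(2) by (auto simp: \<sigma>_def)
      then show "?F y \<in> ?K" using \<alpha>(2) FK by blast
    qed
    ultimately obtain y where y: "y \<in> ?K" "?F y = y" by (rule brouwer)
    have "\<sigma> y \<in> frontier K" using y(1) sub s(2) by (auto simp: \<sigma>_def)
    moreover have "P (\<sigma> y - ?F y) = 0"
      unfolding y(2) using u by (simp add: P_def \<sigma>_def norm_eq_1)
    ultimately show ?thesis by blast
  qed
  have "\<forall>n. \<exists>x\<in>frontier K. P (x - (inverse (Suc n) *\<^sub>R k + (1 - inverse (Suc n)) *\<^sub>R \<alpha> x)) = 0"
    by (intro allI approx) (auto simp: inverse_le_1_iff)
  then obtain X where X: "\<And>n. X n \<in> frontier K"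
    "\<And>n. P (X n - (inverse (Suc n) *\<^sub>R k + (1 - inverse (Suc n)) *\<^sub>R \<alpha> (X n))) = 0" by metis
  have "compact (frontier K)" using K by (simp add: compact_frontier)
  then obtain x \<phi> where x: "x \<in> frontier K" "strict_mono \<phi>" "(X \<circ> \<phi>) \<longlonglongrightarrow> x"
    using X(1) unfolding compact_def by metis
  let ?r = "\<lambda>n. inverse (real (Suc (\<phi> n)))"
  have r: "?r \<longlonglongrightarrow> 0"
    using LIMSEQ_subseq_LIMSEQ[OF LIMSEQ_inverse_real_of_nat x(2)] by (simp add: o_def)
  have Xx: "(\<lambda>n. X (\<phi> n)) \<longlonglongrightarrow> x" using x(3) by (simp add: o_def)
  have aX: "(\<lambda>n. \<alpha> (X (\<phi> n))) \<longlonglongrightarrow> \<alpha> x"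
    using continuous_on_tendsto_compose[OF \<alpha>(1) Xx x(1)] X(1) by simp
  have "(\<lambda>n. P (X (\<phi> n) - (?r n *\<^sub>R k + (1 - ?r n) *\<^sub>R \<alpha> (X (\<phi> n))))) \<longlonglongrightarrow> P (x - (0 *\<^sub>R k + (1 - 0) *\<^sub>R \<alpha> x))"
    unfolding P_def by (intro tendsto_intros r Xx aX)
  then have "P (x - \<alpha> x) = 0" using X(2) by (simp add: LIMSEQ_const_iff)
  then have "\<alpha> x - x = ((\<alpha> x - x) \<bullet> u) *\<^sub>R u" by (simp add: P_def inner_diff_left algebra_simps)
  then show ?thesis using that x(1) by blast
qed

section \<open>The mean over the unit sphere\<close>

definition ball_measure :: "'a::euclidean_space measure" where
  "ball_measure = uniform_measure lborel (ball 0 1)"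

text \<open>The mean over the unit sphere is taken as the mean over the unit ball of the function that is
constant on rays. This needs no surface measure and matches the definition of the measure on lines.\<close>

definition sphere_mean :: "('a::euclidean_space \<Rightarrow> real) \<Rightarrow> real" where
  "sphere_mean v = (\<integral>x. v (sgn x) \<partial>ball_measure)"

lemma emeasure_unit_ball:
  "emeasure lborel (ball (0::'a::euclidean_space) 1) \<noteq> 0" "emeasure lborel (ball (0::'a) 1) \<noteq> \<infinity>"
  using unit_ball_vol_pos[of "real DIM('a)"] by (simp_all add: emeasure_ball less_imp_neq[symmetric])

lemma sets_ball_measure [measurable_cong, simp]: "sets ball_measure = sets borel"
  by (simp add: ball_measure_def)

lemma space_ball_measure [simp]: "space ball_measure = UNIV"
  by (simp add: ball_measure_def)

lemma emeasure_ball_measure: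
  fixes A :: "'a::euclidean_space set"
  shows "A \<in> sets borel \<Longrightarrow> emeasure ball_measure A = emeasure lborel (ball 0 1 \<inter> A) / emeasure lborel (ball (0::'a) 1)"
  unfolding ball_measure_def by (rule emeasure_uniform_measure) auto

lemma emeasure_ball_measure_UNIV: "emeasure ball_measure (UNIV :: 'a::euclidean_space set) = 1"
  using emeasure_unit_ball[where 'a='a]
  by (simp add: emeasure_ball_measure ennreal_divide_self top.not_eq_extremum)

lemma finite_measure_ball_measure: "finite_measure ball_measure"
  by (rule finite_measureI) (simp add: emeasure_ball_measure_UNIV)

lemma measure_ball_measure_UNIV: "measure ball_measure UNIV = 1"
  by (simp add: measure_def emeasure_ball_measure_UNIV)

lemma AE_ball_measure_nonzero: "AE x in ball_measure. x \<noteq> (0::'a::euclidean_space)"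
  unfolding ball_measure_def
  by (rule AE_uniform_measureI) (auto intro!: AE_I[of _ _ "{0}"])

lemma bounded_on_sphere:
  fixes v :: "'a::euclidean_space \<Rightarrow> real"
  assumes "continuous_on UNIV v"
  obtains B where "\<And>x. \<bar>v (sgn x)\<bar> \<le> B"
proof -
  have "compact (v ` cball 0 1)"
    using assms by (intro compact_continuous_image) (auto intro: continuous_on_subset)
  then obtain B where "\<forall>y \<in> v ` cball 0 1. norm y \<le> B"
    using compact_imp_bounded bounded_iff by metis
  then have "\<bar>v x\<bar> \<le> B" if "norm x \<le> 1" for x using that by auto
  then show ?thesis using that[of B] by (simp add: norm_sgn)
qed

lemma integrable_sphere_mean:
  fixes v :: "'a::euclidean_space \<Rightarrow> real"
  assumes "continuous_on UNIV v"
  shows "integrable ball_measure (\<lambda>x. v (sgn x))"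
proof -
  obtain B where "\<And>x. \<bar>v (sgn x)\<bar> \<le> B" using bounded_on_sphere[OF assms] by blast
  moreover have "v \<in> borel_measurable borel" using assms by (rule borel_measurable_continuous_onI)
  then have "(\<lambda>x. v (sgn x)) \<in> borel_measurable ball_measure" by simp
  ultimately show ?thesis
    by (intro finite_measure.integrable_const_bound[OF finite_measure_ball_measure, of _ B]) auto
qed

lemma sphere_mean_const [simp]: "sphere_mean (\<lambda>_. c) = c"
  by (simp add: sphere_mean_def measure_ball_measure_UNIV)

lemma sphere_mean_mono:
  assumes "continuous_on UNIV v" "continuous_on UNIV w" "\<And>x. norm x = 1 \<Longrightarrow> v x \<le> w x"
  shows "sphere_mean v \<le> sphere_mean w"
  unfolding sphere_mean_def
proof (rule integral_mono_AE)
  show "AE x in ball_measure. v (sgn x) \<le> w (sgn x)"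
    using AE_ball_measure_nonzero by eventually_elim (simp add: assms(3) norm_sgn)
qed (use assms in \<open>auto intro: integrable_sphere_mean\<close>)

lemma sphere_mean_cong:
  assumes "continuous_on UNIV v" "continuous_on UNIV w" "\<And>x. norm x = 1 \<Longrightarrow> v x = w x"
  shows "sphere_mean v = sphere_mean w"
  using assms by (intro antisym sphere_mean_mono) auto

lemma sgn_orthogonal_transformation:
  assumes "orthogonal_transformation g" shows "sgn (g x) = g (sgn x)"
  using assms by (simp add: sgn_div_norm orthogonal_transformation_norm orthogonal_transformation_linear linear_cmul)

lemma measurable_orthogonal_transformation:
  "orthogonal_transformation g \<Longrightarrow> (g :: 'a::euclidean_space \<Rightarrow> 'a) \<in> borel_measurable borel"
  by (intro borel_measurable_continuous_onI linear_continuous_on linear_conv_bounded_linear[THEN iffD1]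
      orthogonal_transformation_linear)

lemma ball_measure_invariant:
  fixes g :: "'a::euclidean_space \<Rightarrow> 'a"
  assumes g: "orthogonal_transformation g"
  shows "distr ball_measure borel g = ball_measure"
proof (rule measure_eqI)
  fix A assume "A \<in> sets (distr ball_measure borel g)"
  then have A: "A \<in> sets borel" by simp
  have meas: "g \<in> borel_measurable borel" using g by (rule measurable_orthogonal_transformation)
  have B: "g -` A \<in> sets borel" using measurable_sets[OF meas A] by simp
  have "g ` (ball 0 1 \<inter> g -` A) = ball 0 1 \<inter> A"
  proof -
    have "g 0 = 0" using g by (intro linear_0 orthogonal_transformation_linear)
    then have "g ` ball 0 1 = ball 0 1" using image_orthogonal_transformation_ball[OF g, of 0 1] by simp
    moreover have "g ` (ball 0 1 \<inter> g -` A) = g ` ball 0 1 \<inter> A" by auto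
    ultimately show ?thesis by (simp only:)
  qed
  then have "emeasure lborel (ball 0 1 \<inter> g -` A) = emeasure lborel (ball 0 1 \<inter> A)"
    using emeasure_lborel_orthogonal_image(2)[OF g, of "ball 0 1 \<inter> g -` A"] B by simp
  then show "emeasure (distr ball_measure borel g) A = emeasure ball_measure A"
    using A B meas by (simp add: emeasure_distr emeasure_ball_measure)
qed simp

lemma sphere_mean_orthogonal:
  fixes g :: "'a::euclidean_space \<Rightarrow> 'a"
  assumes g: "orthogonal_transformation g" and v: "continuous_on UNIV v"
  shows "sphere_mean (\<lambda>x. v (g x)) = sphere_mean v"
proof -
  have vm: "v \<in> borel_measurable borel" using v by (rule borel_measurable_continuous_onI)
  have "sphere_mean v = (\<integral>x. v (sgn x) \<partial>distr ball_measure borel g)"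
    by (simp add: sphere_mean_def ball_measure_invariant[OF g])
  also have "\<dots> = (\<integral>x. v (sgn (g x)) \<partial>ball_measure)"
    using vm measurable_orthogonal_transformation[OF g] by (subst integral_distr) auto
  finally show ?thesis by (simp add: sphere_mean_def sgn_orthogonal_transformation[OF g])
qed

lemma sphere_mean_attained_below:
  fixes v :: "'a::euclidean_space \<Rightarrow> real"
  assumes "continuous_on UNIV v"
  obtains x where "norm x = 1" "v x \<le> sphere_mean v"
proof -
  have "sphere (0::'a) 1 \<noteq> {}" by simp
  moreover have "continuous_on (sphere 0 1) v" using assms by (rule continuous_on_subset) simp
  ultimately obtain x where x: "x \<in> sphere 0 1" "\<And>y. y \<in> sphere 0 1 \<Longrightarrow> v x \<le> v y"
    using continuous_attains_inf[OF compact_sphere] by blast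
  have "sphere_mean (\<lambda>_::'a. v x) \<le> sphere_mean v"
    by (rule sphere_mean_mono) (use x(2) assms in auto)
  then show ?thesis using that x(1) by simp
qed

section \<open>Averaging a function over finitely many rotations\<close>

definition hyperplane_reflection :: "'a::euclidean_space \<Rightarrow> 'a \<Rightarrow> 'a" where
  "hyperplane_reflection a x = x - (2 * (x \<bullet> a) / (a \<bullet> a)) *\<^sub>R a"

lemma orthogonal_hyperplane_reflection: "orthogonal_transformation (hyperplane_reflection a)"
proof (cases "a = 0")
  case True
  then have "hyperplane_reflection a = (\<lambda>x. x)" by (auto simp: hyperplane_reflection_def)
  then show ?thesis by (simp add: orthogonal_transformation_def linear_id[unfolded id_def])
next
  case False
  have "linear (hyperplane_reflection a)"
    by (rule linearI) (simp_all add: hyperplane_reflection_def inner_add_left algebra_simps add_divide_distrib)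
  moreover have "hyperplane_reflection a x \<bullet> hyperplane_reflection a y = x \<bullet> y" for x y
    using False by (simp add: hyperplane_reflection_def inner_diff_left inner_diff_right inner_commute field_simps)
  ultimately show ?thesis by (simp add: orthogonal_transformation_def)
qed

lemma hyperplane_reflection_maps:
  assumes "norm x = norm y"
  shows "hyperplane_reflection (x - y) x = y"
proof (cases "x = y")
  case True then show ?thesis by (simp add: hyperplane_reflection_def)
next
  case False
  have "x \<bullet> x = y \<bullet> y" using assms by (simp add: norm_eq)
  then have eq: "2 * (x \<bullet> (x - y)) = (x - y) \<bullet> (x - y)"
    by (simp add: inner_diff_left inner_diff_right inner_commute)
  have "2 * (x \<bullet> (x - y)) / ((x - y) \<bullet> (x - y)) = 1" unfolding eq using False by simp
  then show ?thesis unfolding hyperplane_reflection_def by (simp only: scaleR_one) simp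
qed

lemma orthogonal_maps_unit:
  fixes x y :: "'a::euclidean_space"
  assumes "norm x = 1" "norm y = 1"
  obtains g where "orthogonal_transformation g" "g x = y"
  using orthogonal_hyperplane_reflection hyperplane_reflection_maps assms by metis

text \<open>An orthogonal map moves \<open>e\<close> to \<open>e'\<close>. The reflection that corrects the image of \<open>f\<close> has its normal
perpendicular to \<open>e'\<close> and therefore leaves \<open>e'\<close> fixed.\<close>

lemma orthogonal_maps_frame:
  fixes e f e' f' :: "'a::euclidean_space"
  assumes "orthonormal_pair e f" "orthonormal_pair e' f'"
  obtains g where "orthogonal_transformation g" "g e = e'" "g f = f'"
proof -
  obtain g where g: "orthogonal_transformation g" "g e = e'"
    using orthogonal_maps_unit assms unfolding orthonormal_pair_def by metis
  let ?h = "hyperplane_reflection (g f - f')"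
  have "norm (g f) = norm f'" using g assms by (simp add: orthogonal_transformation_norm orthonormal_pair_def)
  then have 1: "?h (g f) = f'" by (rule hyperplane_reflection_maps)
  have "e' \<bullet> g f = 0" using g assms unfolding orthonormal_pair_def orthogonal_transformation_def by metis
  then have 2: "?h e' = e'"
    using assms by (simp add: hyperplane_reflection_def inner_diff_right orthonormal_pair_def)
  have "orthogonal_transformation (?h \<circ> g)"
    using orthogonal_hyperplane_reflection g(1) by (rule orthogonal_transformation_compose)
  then show ?thesis using that 1 2 g(2) by (metis comp_apply)
qed

lemma orthonormal_pair_image:
  "orthogonal_transformation g \<Longrightarrow> orthonormal_pair e f \<Longrightarrow> orthonormal_pair (g e) (g f)"
  by (simp add: orthonormal_pair_def orthogonal_transformation_norm) (simp add: orthogonal_transformation_def)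

definition circle_integral :: "('a::euclidean_space \<Rightarrow> real) \<Rightarrow> 'a \<Rightarrow> 'a \<Rightarrow> real" where
  "circle_integral v e f = integral {0..2 * pi} (\<lambda>t. v (circle_pt e f t))"

lemma circle_integrable:
  fixes v :: "'a::euclidean_space \<Rightarrow> real"
  assumes "continuous_on UNIV v"
  shows "(\<lambda>t. v (circle_pt e f t)) integrable_on {a..b}"
  by (intro integrable_continuous_real continuous_on_compose2[OF assms] continuous_intros) auto

lemma circle_integral_le:
  assumes "continuous_on UNIV v" "orthonormal_pair e f" "\<And>x. norm x = 1 \<Longrightarrow> v x \<le> b"
  shows "circle_integral v e f \<le> 2 * pi * b"
proof -
  have "circle_integral v e f \<le> integral {0..2 * pi} (\<lambda>_. b)"
    unfolding circle_integral_def using assms by (intro integral_le circle_integrable) auto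
  then show ?thesis by simp
qed

definition rotation_average :: "('a::euclidean_space \<Rightarrow> 'a) set \<Rightarrow> ('a \<Rightarrow> real) \<Rightarrow> 'a \<Rightarrow> real" where
  "rotation_average G v x = (\<Sum>g\<in>G. v (g x)) / card G"

lemma lipschitz_rotation_average:
  assumes G: "finite G" "G \<noteq> {}" "\<And>g. g \<in> G \<Longrightarrow> orthogonal_transformation g" and v: "L-lipschitz_on UNIV v"
  shows "L-lipschitz_on UNIV (rotation_average G v)"
proof (rule lipschitz_onI)
  have k: "0 < real (card G)" using G by (simp add: card_gt_0_iff)
  fix x y
  have "\<bar>(\<Sum>g\<in>G. v (g x)) - (\<Sum>g\<in>G. v (g y))\<bar> \<le> (\<Sum>g\<in>G. \<bar>v (g x) - v (g y)\<bar>)"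
    unfolding sum_subtractf[symmetric] by (rule sum_abs)
  also have "\<dots> \<le> (\<Sum>g\<in>G. L * dist x y)"
  proof (rule sum_mono)
    fix g assume g: "g \<in> G"
    have "dist (g x) (g y) = dist x y"
      using G(3)[OF g] orthogonal_transformation_isometry[of g] by simp
    then show "\<bar>v (g x) - v (g y)\<bar> \<le> L * dist x y"
      using lipschitz_onD[OF v, of "g x" "g y"] by (simp add: dist_real_def)
  qed
  finally show "dist (rotation_average G v x) (rotation_average G v y) \<le> L * dist x y"
    using k by (simp add: rotation_average_def dist_real_def diff_divide_distrib[symmetric] abs_divide
        pos_divide_le_eq mult.commute)
qed (rule lipschitz_on_nonneg[OF v])

lemma sphere_mean_rotation_average:
  assumes G: "finite G" "G \<noteq> {}" "\<And>g. g \<in> G \<Longrightarrow> orthogonal_transformation g" and v: "continuous_on UNIV v"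
  shows "sphere_mean (rotation_average G v) = sphere_mean v"
proof -
  have k: "0 < real (card G)" using G by (simp add: card_gt_0_iff)
  have vg: "continuous_on UNIV (\<lambda>x. v (g x))" if "g \<in> G" for g
    using G(3)[OF that] by (intro continuous_on_compose2[OF v] linear_continuous_on
        linear_conv_bounded_linear[THEN iffD1] orthogonal_transformation_linear) auto
  have "sphere_mean (rotation_average G v) = (\<Sum>g\<in>G. sphere_mean (\<lambda>x. v (g x))) / card G"
  proof -
    have "(\<integral>x. (\<Sum>g\<in>G. v (g (sgn x))) \<partial>ball_measure) = (\<Sum>g\<in>G. \<integral>x. v (g (sgn x)) \<partial>ball_measure)"
      by (intro Bochner_Integration.integral_sum integrable_sphere_mean[OF vg])
    then show ?thesis by (simp add: sphere_mean_def rotation_average_def)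
  qed
  also have "\<dots> = sphere_mean v" using G v k by (simp add: sphere_mean_orthogonal)
  finally show ?thesis .
qed

lemma circle_pt_orthogonal:
  "orthogonal_transformation g \<Longrightarrow> g (circle_pt e f t) = circle_pt (g e) (g f) t"
  by (simp add: circle_pt_def orthogonal_transformation_linear linear_add linear_cmul)

lemma circle_integral_rotation_average:
  assumes G: "finite G" "\<And>g. g \<in> G \<Longrightarrow> orthogonal_transformation g" and v: "continuous_on UNIV v"
  shows "circle_integral (rotation_average G v) e f = (\<Sum>g\<in>G. circle_integral v (g e) (g f)) / card G"
proof -
  have "circle_integral (rotation_average G v) e f
      = integral {0..2 * pi} (\<lambda>t. (\<Sum>g\<in>G. v (circle_pt (g e) (g f) t)) / card G)"
    unfolding circle_integral_def rotation_average_def using G by (simp add: circle_pt_orthogonal)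
  also have "\<dots> = (\<Sum>g\<in>G. circle_integral v (g e) (g f)) / card G"
    unfolding circle_integral_def using v G
    by (simp add: Henstock_Kurzweil_Integration.integral_sum circle_integrable)
  finally show ?thesis .
qed
text \<open>The properties of a function on the sphere that survive averaging over rotations. The common
Lipschitz constant \<open>L\<close> makes the gain in \<open>averaging_lowers_maximum\<close> uniform.\<close>

definition averaging_class :: "real \<Rightarrow> real \<Rightarrow> real \<Rightarrow> ('a::euclidean_space \<Rightarrow> real) \<Rightarrow> bool" where
  "averaging_class L m C v \<longleftrightarrow> L-lipschitz_on UNIV v \<and> sphere_mean v = m \<and>
     (\<forall>e f. orthonormal_pair e f \<longrightarrow> C \<le> circle_integral v e f)"

lemma averaging_class_continuous: "averaging_class L m C v \<Longrightarrow> continuous_on A v"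
  unfolding averaging_class_def by (metis lipschitz_on_continuous_on continuous_on_subset top_greatest)

lemma averaging_class_rotation_average:
  assumes G: "finite G" "G \<noteq> {}" "\<And>g. g \<in> G \<Longrightarrow> orthogonal_transformation g"
    and v: "averaging_class L m C v"
  shows "averaging_class L m C (rotation_average G v)"
proof -
  have k: "0 < real (card G)" using G by (simp add: card_gt_0_iff)
  have "C \<le> circle_integral (rotation_average G v) e f" if "orthonormal_pair e f" for e f
  proof -
    have "(\<Sum>g\<in>G. C) \<le> (\<Sum>g\<in>G. circle_integral v (g e) (g f))"
      using v that G by (intro sum_mono) (auto simp: averaging_class_def orthonormal_pair_image)
    then show ?thesis
      using k by (subst circle_integral_rotation_average[OF G(1,3) averaging_class_continuous[OF v]])
        (auto simp: pos_le_divide_eq mult.commute)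
  qed
  then show ?thesis
    using v lipschitz_rotation_average[OF G] sphere_mean_rotation_average[OF G averaging_class_continuous[OF v]]
    unfolding averaging_class_def by auto
qed

lemma finite_rotations_cover_sphere:
  fixes p :: "'a::euclidean_space"
  assumes p: "norm p = 1" and d: "0 < d"
  obtains G :: "('a \<Rightarrow> 'a) set" where "finite G" "G \<noteq> {}" "\<And>g. g \<in> G \<Longrightarrow> orthogonal_transformation g"
    "\<And>x. norm x = 1 \<Longrightarrow> \<exists>g\<in>G. dist (g x) p < d"
proof -
  let ?O = "{g :: 'a \<Rightarrow> 'a. orthogonal_transformation g}"
  have op: "open (g -` ball p d)" if "g \<in> ?O" for g
    using that by (intro open_vimage linear_continuous_on linear_conv_bounded_linear[THEN iffD1]
        orthogonal_transformation_linear) auto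
  have "sphere 0 1 \<subseteq> (\<Union>g\<in>?O. g -` ball p d)"
  proof
    fix x :: 'a assume "x \<in> sphere 0 1"
    then obtain g where "orthogonal_transformation g" "g x = p"
      using orthogonal_maps_unit[of x p] p by auto
    then show "x \<in> (\<Union>g\<in>?O. g -` ball p d)" using d by auto
  qed
  then obtain G where G: "G \<subseteq> ?O" "finite G" "sphere 0 1 \<subseteq> (\<Union>g\<in>G. g -` ball p d)"
    using compactE_image[OF compact_sphere, of ?O "\<lambda>g. g -` ball p d" 0 1] op by blast
  have cov: "\<exists>g\<in>G. dist (g x) p < d" if "norm x = 1" for x
    using G(3) that by (auto simp: subset_iff dist_commute)
  have ne: "G \<noteq> {}" using cov[OF p] by auto
  show ?thesis by (rule that[of G]) (use G(1,2) ne cov in auto)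
qed

text \<open>Somewhere \<open>v\<close> is at most its mean \<open>m\<close>, so by the Lipschitz condition it is at most \<open>b - r / 2\<close> on a
cap whose size depends only on \<open>L\<close> and \<open>r\<close>. Average over finitely many rotations such that every point is
moved into the cap by one of them: everywhere at least one of the \<open>N\<close> summands is smaller than the
bound \<open>b\<close> by \<open>r / 2\<close>. Since the number \<open>N\<close> is independent of \<open>v\<close> and \<open>b\<close>, the step can be iterated.\<close>

lemma averaging_lowers_maximum:
  fixes p :: "'a::euclidean_space"
  assumes L: "0 \<le> L" and r: "0 < r" and p: "norm p = 1"
  obtains k where "0 < k" "\<And>v b. \<lbrakk>averaging_class L m C v; \<And>x::'a. norm x = 1 \<Longrightarrow> v x \<le> b; m + r \<le> b\<rbrakk>
    \<Longrightarrow> \<exists>v'. averaging_class L m C v' \<and> (\<forall>x::'a. norm x = 1 \<longrightarrow> v' x \<le> b - k)"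
proof -
  \<comment> \<open>The summand \<open>1\<close> keeps the radius of the cap finite when \<open>L = 0\<close>.\<close>
  define d where "d = (r / 2) / (L + 1)"
  have d: "0 < d" "L * d \<le> r / 2"
  proof -
    show "0 < d" using L r by (simp add: d_def)
    have "L * d \<le> (L + 1) * d" using \<open>0 < d\<close> by (simp add: algebra_simps)
    also have "\<dots> = r / 2"
    proof -
      have "L + 1 \<noteq> 0" using L by simp
      then have "d * (L + 1) = r / 2" using d_def nonzero_eq_divide_eq by blast
      then show ?thesis by (simp only: mult.commute)
    qed
    finally show "L * d \<le> r / 2" .
  qed
  obtain G :: "('a \<Rightarrow> 'a) set" where G: "finite G" "G \<noteq> {}" "\<And>g. g \<in> G \<Longrightarrow> orthogonal_transformation g"
    "\<And>x. norm x = 1 \<Longrightarrow> \<exists>g\<in>G. dist (g x) p < d"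
    using finite_rotations_cover_sphere[OF p d(1)] by blast
  define N where "N = real (card G)"
  have N: "0 < N" using G by (simp add: N_def card_gt_0_iff)
  have "\<exists>v'. averaging_class L m C v' \<and> (\<forall>x::'a. norm x = 1 \<longrightarrow> v' x \<le> b - r / (2 * N))"
    if v: "averaging_class L m C v" and b: "\<And>x. norm x = 1 \<Longrightarrow> v x \<le> b" and mb: "m + r \<le> b" for v :: "'a \<Rightarrow> real" and b
  proof -
    obtain x0 where x0: "norm x0 = 1" "v x0 \<le> m"
    proof -
      have "sphere_mean v = m" using v by (simp add: averaging_class_def)
      then show ?thesis using sphere_mean_attained_below[OF averaging_class_continuous[OF v]] that by metis
    qed
    obtain h where h: "orthogonal_transformation h" "h p = x0" using orthogonal_maps_unit[OF p x0(1)] by blast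
    \<comment> \<open>Rotating \<open>v\<close> brings the small value to the fixed point \<open>p\<close>, so one finite set \<open>G\<close> serves for all \<open>v\<close>.\<close>
    define w where "w = rotation_average {h} v"
    have w: "averaging_class L m C w"
      unfolding w_def using h v by (intro averaging_class_rotation_average) auto
    have w_eq: "w x = v (h x)" for x by (simp add: w_def rotation_average_def)
    have wb: "w x \<le> b" if "norm x = 1" for x
      using b[of "h x"] that h(1) by (simp add: w_eq orthogonal_transformation_norm)
    have lip: "L-lipschitz_on UNIV w" using w by (simp add: averaging_class_def)
    have near: "w y \<le> b - r / 2" if "dist y p < d" for y
    proof -
      have "w y - w p \<le> L * dist y p" using lipschitz_onD[OF lip, of y p] by (simp add: dist_real_def)
      also have "\<dots> \<le> L * d" using L that by (intro mult_left_mono) auto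
      finally show ?thesis using d(2) x0(2) h(2) mb by (simp add: w_eq)
    qed
    have "rotation_average G w x \<le> b - r / (2 * N)" if x: "norm x = 1" for x
    proof -
      obtain g where g: "g \<in> G" "dist (g x) p < d" using G(4)[OF x] by blast
      have "(\<Sum>g'\<in>G - {g}. w (g' x)) \<le> (\<Sum>g'\<in>G - {g}. b)"
        using x G(3) by (intro sum_mono wb) (auto simp: orthogonal_transformation_norm)
      also have "\<dots> = (N - 1) * b"
      proof -
        have "1 \<le> card G" using N by (simp add: N_def Suc_le_eq)
        then show ?thesis using g(1) by (simp add: N_def of_nat_diff)
      qed
      finally have "(\<Sum>g\<in>G. w (g x)) \<le> (N - 1) * b + (b - r / 2)"
        using near[OF g(2)] g(1) G(1) by (simp add: sum.remove)
      also have "\<dots> = (b - r / (2 * N)) * N" using N by (simp add: field_simps)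
      finally show ?thesis using N by (simp add: rotation_average_def N_def[symmetric] pos_divide_le_eq)
    qed
    moreover have "averaging_class L m C (rotation_average G w)"
      using G w by (intro averaging_class_rotation_average) auto
    ultimately show ?thesis by blast
  qed
  moreover have "0 < r / (2 * N)" using r N by simp
  ultimately show ?thesis using that by blast
qed

lemma averaging_class_near_mean:
  assumes v: "averaging_class L m C (v :: 'a::euclidean_space \<Rightarrow> real)" and r: "0 < r"
  obtains v' where "averaging_class L m C v'" "\<And>x::'a. norm x = 1 \<Longrightarrow> v' x \<le> m + r"
proof -
  have L: "0 \<le> L" using v lipschitz_on_nonneg by (auto simp: averaging_class_def)
  obtain p :: 'a where p: "norm p = 1" using vector_choose_size[of 1] by auto
  obtain k where k: "0 < k" "\<And>v b. \<lbrakk>averaging_class L m C v; \<And>x::'a. norm x = 1 \<Longrightarrow> v x \<le> b; m + r \<le> b\<rbrakk>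
    \<Longrightarrow> \<exists>v'. averaging_class L m C v' \<and> (\<forall>x::'a. norm x = 1 \<longrightarrow> v' x \<le> b - k)"
    using averaging_lowers_maximum[OF L r p] by metis
  obtain B where B: "\<And>x. \<bar>v (sgn x)\<bar> \<le> B" using bounded_on_sphere averaging_class_continuous[OF v] by blast
  have iter: "\<exists>v'. averaging_class L m C v' \<and> (\<forall>x::'a. norm x = 1 \<longrightarrow> v' x \<le> max (m + r) (B - real n * k))" for n
  proof (induction n)
    case 0
    have "v x \<le> B" if "norm x = 1" for x
      using B[of x] that by (simp add: sgn_div_norm)
    then show ?case using v by (intro exI[of _ v]) (auto simp: le_max_iff_disj)
  next
    case (Suc n)
    then obtain v' where v': "averaging_class L m C v'"
      "\<And>x::'a. norm x = 1 \<Longrightarrow> v' x \<le> max (m + r) (B - real n * k)" by blast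
    show ?case
    proof (cases "m + r \<le> B - real n * k")
      case True
      then show ?thesis using k(2)[OF v'(1), of "B - real n * k"] v'(2)
        by (fastforce simp: algebra_simps max_def)
    next
      case False
      then show ?thesis using v' by (intro exI[of _ v']) (auto simp: le_max_iff_disj)
    qed
  qed
  obtain n where "real n * k \<ge> B - (m + r)"
    using reals_Archimedean3[OF k(1)] by (metis less_imp_le)
  then have "max (m + r) (B - real n * k) = m + r" by simp
  then show ?thesis using iter[of n] that by auto
qed

text \<open>The hypothesis passes to the averages of \<open>v\<close>, and it is evident for a function that hardly exceeds
its mean.\<close>

lemma circle_integral_bound_mean:
  fixes v :: "'a::euclidean_space \<Rightarrow> real"
  assumes v: "L-lipschitz_on UNIV v" and C: "\<And>e f. orthonormal_pair e f \<Longrightarrow> C \<le> circle_integral v e f"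
    and frame: "orthonormal_pair e0 (f0 :: 'a)"
  shows "C \<le> 2 * pi * sphere_mean v"
proof (rule field_le_epsilon)
  fix r :: real assume r: "0 < r"
  let ?m = "sphere_mean v"
  have "averaging_class L ?m C v" using v C by (simp add: averaging_class_def)
  then obtain v' where v': "averaging_class L ?m C v'" "\<And>x::'a. norm x = 1 \<Longrightarrow> v' x \<le> ?m + r / (2 * pi)"
    using averaging_class_near_mean[of L ?m C v "r / (2 * pi)"] r by auto
  have "C \<le> circle_integral v' e0 f0" using v' frame by (simp add: averaging_class_def)
  also have "\<dots> \<le> 2 * pi * (?m + r / (2 * pi))"
    using averaging_class_continuous[OF v'(1)] frame v'(2) by (rule circle_integral_le)
  also have "\<dots> = 2 * pi * ?m + r" by (simp add: field_simps)
  finally show "C \<le> 2 * pi * ?m + r" .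
qed

lemma continuous_on_circle_integral:
  fixes v :: "'a::euclidean_space \<Rightarrow> real"
  assumes v: "L-lipschitz_on UNIV v"
  shows "continuous_on UNIV (\<lambda>(e, f). circle_integral v e f)"
proof -
  have L: "0 \<le> L" using v by (rule lipschitz_on_nonneg)
  have cont: "continuous_on UNIV v" using v by (rule lipschitz_on_continuous_on)
  have diff: "circle_integral v e f - circle_integral v e' f' \<le> 4 * pi * L * dist (e, f) (e', f')" for e f e' f'
  proof -
    let ?D = "dist (e, f) (e', f')"
    have "v (circle_pt e f t) \<le> v (circle_pt e' f' t) + L * (2 * ?D)" for t
    proof -
      have "circle_pt e f t - circle_pt e' f' t = cos t *\<^sub>R (e - e') + sin t *\<^sub>R (f - f')"
        by (simp add: circle_pt_def algebra_simps)
      then have "dist (circle_pt e f t) (circle_pt e' f' t) \<le> \<bar>cos t\<bar> * norm (e - e') + \<bar>sin t\<bar> * norm (f - f')"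
        by (metis dist_norm norm_scaleR norm_triangle_ineq)
      also have "\<dots> \<le> 1 * norm (e - e') + 1 * norm (f - f')"
        by (intro add_mono mult_right_mono) auto
      also have "\<dots> \<le> ?D + ?D"
        using dist_fst_le[of "(e, f)" "(e', f')"] dist_snd_le[of "(e, f)" "(e', f')"] by (simp add: dist_norm)
      finally have "L * dist (circle_pt e f t) (circle_pt e' f' t) \<le> L * (2 * ?D)"
        using L by (intro mult_left_mono) auto
      then show ?thesis
        using lipschitz_onD[OF v, of "circle_pt e f t" "circle_pt e' f' t"] by (simp add: dist_real_def)
    qed
    then have "circle_integral v e f \<le> integral {0..2 * pi} (\<lambda>t. v (circle_pt e' f' t) + L * (2 * ?D))"
      unfolding circle_integral_def using cont
      by (intro integral_le Henstock_Kurzweil_Integration.integrable_add circle_integrable) auto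
    also have "\<dots> = circle_integral v e' f' + 2 * pi * (L * (2 * ?D))"
      unfolding circle_integral_def using cont
      by (subst Henstock_Kurzweil_Integration.integral_add) (auto intro: circle_integrable)
    finally show ?thesis by simp
  qed
  have "(4 * pi * L)-lipschitz_on UNIV (\<lambda>(e, f). circle_integral v e f)"
  proof (rule lipschitz_onI)
    fix x y :: "'a \<times> 'a"
    show "dist (case x of (e, f) \<Rightarrow> circle_integral v e f) (case y of (e, f) \<Rightarrow> circle_integral v e f)
      \<le> 4 * pi * L * dist x y"
      using diff[of "fst x" "snd x" "fst y" "snd y"] diff[of "fst y" "snd y" "fst x" "snd x"]
      by (simp add: dist_real_def case_prod_beta dist_commute abs_le_iff)
  qed (use L in simp)
  then show ?thesis by (rule lipschitz_on_continuous_on)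
qed

lemma compact_orthonormal_pairs: "compact {(e, f :: 'a::euclidean_space). orthonormal_pair e f}"
proof -
  have "{(e, f :: 'a). orthonormal_pair e f} = (sphere 0 1 \<times> sphere 0 1) \<inter> {x. fst x \<bullet> snd x = 0}"
    by (auto simp: orthonormal_pair_def)
  moreover have "closed {x :: 'a \<times> 'a. fst x \<bullet> snd x = 0}"
    by (intro closed_Collect_eq continuous_intros)
  ultimately show ?thesis by (simp add: compact_Int_closed compact_Times)
qed

text \<open>By compactness of the set of orthonormal pairs, finitely many rotations bring every pair close to
\<open>(e0, f0)\<close> at least once. The average over these rotations satisfies a bound on great circles that is
better by a fixed amount, and it has the same mean.\<close>

lemma circle_integral_strict_bound_mean:
  fixes v :: "'a::euclidean_space \<Rightarrow> real"
  assumes v: "L-lipschitz_on UNIV v" and C: "\<And>e f. orthonormal_pair e f \<Longrightarrow> C \<le> circle_integral v e f"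
    and frame: "orthonormal_pair e0 (f0 :: 'a)" and strict: "C < circle_integral v e0 f0"
  shows "C < 2 * pi * sphere_mean v"
proof -
  have cont: "continuous_on UNIV v" using v by (rule lipschitz_on_continuous_on)
  define r where "r = (circle_integral v e0 f0 - C) / 2"
  have r: "0 < r" using strict by (simp add: r_def)
  define U where "U = {x. C + r < (case x of (e, f) \<Rightarrow> circle_integral v e f)}"
  have U: "open U"
    unfolding U_def using continuous_on_circle_integral[OF v] by (intro open_Collect_less continuous_intros)
  have "(e0, f0) \<in> U" using strict by (simp add: U_def r_def field_simps)
  let ?O = "{g :: 'a \<Rightarrow> 'a. orthogonal_transformation g}"
  let ?St = "{(e, f :: 'a). orthonormal_pair e f}"
  let ?V = "\<lambda>g :: 'a \<Rightarrow> 'a. (\<lambda>(e, f). (g e, g f)) -` U"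
  have op: "open (?V g)" if "g \<in> ?O" for g
  proof -
    have g: "continuous_on UNIV g"
      using that by (intro linear_continuous_on linear_conv_bounded_linear[THEN iffD1]
          orthogonal_transformation_linear) auto
    show ?thesis
      unfolding case_prod_beta
      by (intro open_vimage[OF U] continuous_on_Pair continuous_on_compose2[OF g] continuous_intros) auto
  qed
  have "?St \<subseteq> (\<Union>g\<in>?O. ?V g)"
  proof
    fix x assume "x \<in> ?St"
    then obtain e f where x: "x = (e, f)" "orthonormal_pair e f" by auto
    then obtain g where "orthogonal_transformation g" "g e = e0" "g f = f0"
      using orthogonal_maps_frame frame by metis
    then show "x \<in> (\<Union>g\<in>?O. ?V g)" using \<open>(e0, f0) \<in> U\<close> x by auto
  qed
  then obtain G where G: "G \<subseteq> ?O" "finite G" "?St \<subseteq> (\<Union>g\<in>G. ?V g)"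
    using compactE_image[OF compact_orthonormal_pairs, of ?O ?V] op by blast
  have "G \<noteq> {}" using G(3) frame by auto
  then have N: "0 < real (card G)" using G(2) by (simp add: card_gt_0_iff)
  have orth: "orthogonal_transformation g" if "g \<in> G" for g using that G(1) by auto
  have "C + r / card G \<le> circle_integral (rotation_average G v) e f" if ef: "orthonormal_pair e f" for e f
  proof -
    have "(e, f) \<in> (\<Union>g\<in>G. ?V g)" using G(3) ef by blast
    then obtain g where "g \<in> G" "(e, f) \<in> ?V g" by blast
    then have g: "g \<in> G" "C + r < circle_integral v (g e) (g f)" by (simp_all add: U_def)
    have "(\<Sum>g'\<in>G - {g}. C) \<le> (\<Sum>g'\<in>G - {g}. circle_integral v (g' e) (g' f))"
      using C orth ef by (intro sum_mono) (auto simp: orthonormal_pair_image)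
    then have "(\<Sum>g\<in>G. C) + r \<le> (\<Sum>g\<in>G. circle_integral v (g e) (g f))"
      using g G(2) by (simp only: sum.remove[OF G(2) g(1)])
    moreover have "(C + r / card G) * card G = (\<Sum>g\<in>G. C) + r"
    proof -
      have "(C + r / k) * k = k * C + r" if "0 < k" for k :: real
        using that by (simp add: field_simps)
      from this[OF N] show ?thesis by simp
    qed
    ultimately have "(C + r / card G) * card G \<le> (\<Sum>g\<in>G. circle_integral v (g e) (g f))"
      by (simp only:)
    then have "C + r / card G \<le> (\<Sum>g\<in>G. circle_integral v (g e) (g f)) / card G"
      using pos_le_divide_eq[OF N] by blast
    then show ?thesis
      by (simp only: circle_integral_rotation_average[OF G(2) orth cont])
  qed
  then have "C + r / card G \<le> 2 * pi * sphere_mean (rotation_average G v)"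
    using lipschitz_rotation_average[OF G(2) \<open>G \<noteq> {}\<close> orth v] frame circle_integral_bound_mean by blast
  also have "\<dots> = 2 * pi * sphere_mean v"
    using sphere_mean_rotation_average[OF G(2) \<open>G \<noteq> {}\<close> orth cont] by simp
  finally show ?thesis using divide_pos_pos[OF r N] by linarith
qed

section \<open>The mean width as a mean of the support function\<close>

lemma support_fun_frontier:
  fixes K :: "'a::euclidean_space set"
  assumes K: "compact K" "K \<noteq> {}" and u: "u \<noteq> 0"
  obtains p where "p \<in> frontier K" "p \<bullet> u = support_fun K u"
proof -
  obtain p where p: "p \<in> K" "p \<bullet> u = support_fun K u" using support_fun_attained[OF K] by blast
  have "p \<notin> interior K"
  proof
    assume "p \<in> interior K"
    then obtain r where r: "0 < r" "ball p r \<subseteq> K" by (auto simp: mem_interior)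
    let ?q = "p + (r / 2 / norm u) *\<^sub>R u"
    have "?q \<in> ball p r" using r u by (simp add: dist_norm)
    then have "?q \<in> K" using r by blast
    then have "?q \<bullet> u \<le> support_fun K u" using K by (intro support_fun_ge compact_imp_bounded)
    moreover have "0 < (r / 2 / norm u) * (u \<bullet> u)" using r u by (intro mult_pos_pos divide_pos_pos) auto
    ultimately show False using p by (simp add: inner_add_left)
  qed
  then show ?thesis using that p closure_subset by (auto simp: frontier_def)
qed

lemma orth_proj_span_singleton:
  assumes u: "norm u = 1"
  shows "orth_proj (span {u}) y = (y \<bullet> u) *\<^sub>R u"
  unfolding orth_proj_def
proof (rule the_equality)
  have uu: "u \<bullet> u = 1" using u by (simp add: norm_eq_1)
  show "(y \<bullet> u) *\<^sub>R u \<in> span {u} \<and> (\<forall>z\<in>span {u}. orthogonal (y - (y \<bullet> u) *\<^sub>R u) z)"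
    using uu by (auto simp: span_singleton orthogonal_def inner_diff_left)
  fix w assume w: "w \<in> span {u} \<and> (\<forall>z\<in>span {u}. orthogonal (y - w) z)"
  then obtain k where k: "w = k *\<^sub>R u" by (auto simp: span_singleton)
  have "orthogonal (y - w) u" using w by (auto intro: span_base)
  then have "y \<bullet> u = k" using uu by (simp add: k orthogonal_def inner_diff_left)
  then show "w = (y \<bullet> u) *\<^sub>R u" using k by simp
qed

lemma width_span_singleton:
  fixes K :: "'a::euclidean_space set"
  assumes K: "compact K" "K \<noteq> {}" and u: "norm u = 1"
  shows "width (span {u}) (frontier K) = support_fun K u + support_fun K (- u)"
proof -
  let ?P = "\<lambda>y. (y \<bullet> u) *\<^sub>R u" and ?w = "support_fun K u + support_fun K (- u)"
  have u0: "u \<noteq> 0" using u by auto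
  have FK: "frontier K \<subseteq> K" using K by (simp add: frontier_subset_compact)
  have bK: "bounded K" using K by (simp add: compact_imp_bounded)
  obtain p where p: "p \<in> frontier K" "p \<bullet> u = support_fun K u" using support_fun_frontier[OF K u0] by blast
  obtain q where q: "q \<in> frontier K" "q \<bullet> (- u) = support_fun K (- u)"
    using support_fun_frontier[OF K, of "- u"] u0 by auto
  have d: "dist (?P x) (?P y) = \<bar>(x - y) \<bullet> u\<bar>" for x y
    using u by (simp add: dist_norm inner_diff_left scaleR_diff_left[symmetric])
  have eq: "width (span {u}) (frontier K) = diameter (?P ` frontier K)"
    using orth_proj_span_singleton[OF u] by (simp add: width_def)
  have le: "\<bar>(x - y) \<bullet> u\<bar> \<le> ?w" if "x \<in> K" "y \<in> K" for x y
    using support_fun_ge[OF bK that(1), of u] support_fun_ge[OF bK that(2), of u]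
      support_fun_ge[OF bK that(1), of "- u"] support_fun_ge[OF bK that(2), of "- u"]
    by (simp add: inner_diff_left abs_le_iff)
  have "bounded (?P ` frontier K)"
  proof -
    have "compact (?P ` frontier K)"
      using K by (intro compact_continuous_image continuous_intros compact_frontier)
    then show ?thesis by (rule compact_imp_bounded)
  qed
  then have "dist (?P p) (?P q) \<le> diameter (?P ` frontier K)"
    using p(1) q(1) by (intro diameter_bounded_bound imageI)
  moreover have "?w = (p - q) \<bullet> u" using p q by (simp add: inner_diff_left)
  moreover have "diameter (?P ` frontier K) \<le> ?w"
  proof (rule diameter_le)
    show "?P ` frontier K \<noteq> {} \<or> 0 \<le> ?w" using p by blast
    show "norm (x - y) \<le> ?w" if "x \<in> ?P ` frontier K" "y \<in> ?P ` frontier K" for x y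
    proof -
      obtain x' y' where "x' \<in> K" "y' \<in> K" "x = ?P x'" "y = ?P y'" using \<open>x \<in> _\<close> \<open>y \<in> _\<close> FK by blast
      then show ?thesis using le[of x' y'] d[of x' y'] by (simp add: dist_norm)
    qed
  qed
  ultimately show ?thesis using eq d[of p q] by linarith
qed

lemma mean_width_eq_mean_of_width:
  fixes K :: "'a::euclidean_space set"
  assumes K: "compact K" "K \<noteq> {}"
  shows "mean_width (frontier K) = sphere_mean (\<lambda>u. support_fun K u + support_fun K (- u))"
proof -
  let ?U = "uniform_measure (restrict_space lborel (- {0})) (ball 0 1 - {0}) :: 'a measure"
  define F where "F x = support_fun K (sgn x) + support_fun K (- sgn x)" for x :: 'a
  have cont: "continuous_on UNIV (support_fun K)"
    using K by (intro continuous_on_support_fun compact_imp_bounded)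
  have hm: "support_fun K \<in> borel_measurable borel" using cont by (rule borel_measurable_continuous_onI)
  have F: "F \<in> borel_measurable borel" unfolding F_def using hm by measurable
  have span_sgn: "span {x} = span {sgn x}" if "x \<noteq> 0" for x :: 'a
    using that span_image_scale[of "{x}" "\<lambda>_. inverse (norm x)"] by (simp add: sgn_div_norm)
  have wF: "width (span {x}) (frontier K) = F x" if "x \<noteq> 0" for x
    using that width_span_singleton[OF K, of "sgn x"] by (simp add: span_sgn F_def norm_sgn)
  have wm: "(\<lambda>L. width L (frontier K)) \<in> borel_measurable line_borel"
  proof (rule borel_measurable_iff_le[THEN iffD2], intro allI)
    fix a
    have "{x. x \<noteq> 0 \<and> span {x} \<in> {L \<in> lines. width L (frontier K) \<le> a}} = - {0} \<inter> {x. F x \<le> a}"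
      using span_singleton_in_lines wF by auto
    moreover have "{x. F x \<le> a} \<in> sets borel" using F by measurable
    ultimately show "{w \<in> space line_borel. width w (frontier K) \<le> a} \<in> sets line_borel"
      by (auto simp: sets_line_borel)
  qed
  have spU: "space ?U = - {0}" by (simp add: space_restrict_space)
  have idU: "(\<lambda>x. x) \<in> measurable ?U borel"
    by (rule measurableI) (auto simp: space_restrict_space sets_restrict_space_iff)
  have "ball_measure = distr ?U borel (\<lambda>x. x)"
  proof (rule measure_eqI)
    fix A :: "'a set" assume "A \<in> sets ball_measure"
    then have A: "A \<in> sets borel" by simp
    let ?R = "restrict_space lborel (- {0::'a})"
    have "emeasure (distr ?U borel (\<lambda>x. x)) A = emeasure ?U (A \<inter> - {0})"
      using A idU by (subst emeasure_distr) (auto simp: spU Int_commute)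
    also have "\<dots> = emeasure ?R ((ball 0 1 - {0}) \<inter> (A \<inter> - {0})) / emeasure ?R (ball 0 1 - {0})"
      using A by (intro emeasure_uniform_measure) (auto simp: sets_restrict_space_iff)
    also have "(ball 0 1 - {0}) \<inter> (A \<inter> - {0}) = (ball 0 1 \<inter> A) - {0}" by auto
    also have "emeasure ?R ((ball 0 1 \<inter> A) - {0}) = emeasure lborel ((ball 0 1 \<inter> A) - {0})"
      by (rule emeasure_restrict_space) auto
    also have "\<dots> = emeasure lborel (ball 0 1 \<inter> A)"
      using A by (intro emeasure_Diff_null_set) auto
    also have "emeasure ?R (ball 0 1 - {0}) = emeasure lborel (ball (0::'a) 1 - {0})"
      by (rule emeasure_restrict_space) auto
    also have "\<dots> = emeasure lborel (ball (0::'a) 1)"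
      by (rule emeasure_Diff_null_set) auto
    finally show "emeasure ball_measure A = emeasure (distr ?U borel (\<lambda>x. x)) A"
      using A by (simp add: emeasure_ball_measure)
  qed simp
  then have "(\<integral>x. F x \<partial>ball_measure) = (\<integral>x. F x \<partial>?U)"
    using integral_distr[OF idU F] by simp
  also have "\<dots> = (\<integral>x. width (span {x}) (frontier K) \<partial>?U)"
    by (rule Bochner_Integration.integral_cong) (auto simp: spU wF space_restrict_space)
  also have "\<dots> = mean_width (frontier K)"
    unfolding mean_width_def line_measure_def
    by (rule integral_distr[symmetric, OF measurable_span_singleton wm])
  finally show ?thesis by (simp add: sphere_mean_def F_def)
qed

lemma mean_width_eq_sphere_mean:
  fixes K :: "'a::euclidean_space set"
  assumes K: "compact K" "K \<noteq> {}"
  shows "mean_width (frontier K) = 2 * sphere_mean (support_fun K)"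
proof -
  have cont: "continuous_on UNIV (support_fun K)"
    using K by (intro continuous_on_support_fun compact_imp_bounded)
  have cont': "continuous_on UNIV (\<lambda>x. support_fun K (- x))"
    by (intro continuous_on_compose2[OF cont] continuous_intros) auto
  have "mean_width (frontier K) = sphere_mean (support_fun K) + sphere_mean (\<lambda>x. support_fun K (- x))"
    unfolding mean_width_eq_mean_of_width[OF K] sphere_mean_def
    by (intro Bochner_Integration.integral_add integrable_sphere_mean[OF cont] integrable_sphere_mean[OF cont'])
  also have "orthogonal_transformation (uminus :: 'a \<Rightarrow> 'a)"
    by (simp add: orthogonal_transformation_def linear_iff)
  then have "sphere_mean (\<lambda>x. support_fun K (- x)) = sphere_mean (support_fun K)"
    using cont by (rule sphere_mean_orthogonal)
  finally show ?thesis by simp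
qed
lemma mean_width_sphere:
  fixes c :: "'a::euclidean_space"
  assumes r: "0 < r" shows "mean_width (sphere c r) = 2 * r"
proof -
  have K: "compact (cball c r)" "cball c r \<noteq> {}" using r by auto
  have h: "support_fun (cball c r) u = c \<bullet> u + r" if u: "norm u = 1" for u
  proof (rule antisym)
    show "support_fun (cball c r) u \<le> c \<bullet> u + r"
    proof (rule support_fun_le[OF K(2)])
      fix p assume "p \<in> cball c r"
      then have "norm (p - c) \<le> r" by (simp add: dist_norm norm_minus_commute)
      moreover have "(p - c) \<bullet> u \<le> norm (p - c) * norm u" by (rule norm_cauchy_schwarz)
      ultimately show "p \<bullet> u \<le> c \<bullet> u + r" using u by (simp add: inner_diff_left)
    qed
    have "(c + r *\<^sub>R u) \<bullet> u \<le> support_fun (cball c r) u"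
      using r u by (intro support_fun_ge) (auto simp: dist_norm)
    then show "c \<bullet> u + r \<le> support_fun (cball c r) u" using u by (simp add: inner_add_left norm_eq_1)
  qed
  have cont: "continuous_on UNIV (support_fun (cball c r))" using K by (intro continuous_on_support_fun) auto
  have "mean_width (sphere c r) = sphere_mean (\<lambda>u. support_fun (cball c r) u + support_fun (cball c r) (- u))"
    using mean_width_eq_mean_of_width[OF K] r by (simp add: frontier_cball)
  also have "\<dots> = sphere_mean (\<lambda>_ :: 'a. 2 * r)"
    using h by (intro sphere_mean_cong continuous_intros continuous_on_compose2[OF cont]) auto
  finally show ?thesis by simp
qed

section \<open>Distances on a round sphere\<close>

text \<open>Two points of a sphere at polar angles \<open>a\<close> and \<open>b\<close> are closest if they lie on the same meridian.\<close>

lemma sphere_chord_lower_bound: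
  fixes p q w :: "'a::euclidean_space"
  assumes w: "norm w = 1" and r: "0 < r" and p: "norm p = r" "p \<bullet> w = r * cos a" and q: "norm q = r" "q \<bullet> w = r * cos b"
    and ab: "0 \<le> a" "a \<le> b" "b \<le> pi"
  shows "2 * r * sin ((b - a) / 2) \<le> dist p q"
proof -
  have ww: "w \<bullet> w = 1" using w by (simp add: norm_eq_1)
  have pp: "p \<bullet> p = r\<^sup>2" "q \<bullet> q = r\<^sup>2" using p q by (simp_all add: dot_square_norm)
  define p' q' where "p' = p - (p \<bullet> w) *\<^sub>R w" and "q' = q - (q \<bullet> w) *\<^sub>R w"
  have sq: "(r * cos x)\<^sup>2 = r\<^sup>2 - (r * sin x)\<^sup>2" for x
    by (simp add: power_mult_distrib cos_squared_eq algebra_simps)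
  have s: "0 \<le> sin a" "0 \<le> sin b" using ab by (auto intro!: sin_ge_zero)
  have "(norm p')\<^sup>2 = r\<^sup>2 - (r * cos a)\<^sup>2"
    unfolding p'_def power2_norm_eq_inner using pp p ww
    by (simp add: inner_diff_left inner_diff_right inner_commute power2_eq_square)
  then have "(norm p')\<^sup>2 = (r * sin a)\<^sup>2" by (simp add: sq)
  then have np: "norm p' = r * sin a" by (rule power2_eq_imp_eq) (use s r in auto)
  have "(norm q')\<^sup>2 = r\<^sup>2 - (r * cos b)\<^sup>2"
    unfolding q'_def power2_norm_eq_inner using pp q ww
    by (simp add: inner_diff_left inner_diff_right inner_commute power2_eq_square)
  then have "(norm q')\<^sup>2 = (r * sin b)\<^sup>2" by (simp add: sq)
  then have nq: "norm q' = r * sin b" by (rule power2_eq_imp_eq) (use s r in auto)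
  have "p \<bullet> q = p' \<bullet> q' + (r * cos a) * (r * cos b)"
    unfolding p'_def q'_def using p q ww by (simp add: inner_diff_left inner_diff_right inner_commute)
  also have "p' \<bullet> q' \<le> (r * sin a) * (r * sin b)"
    using norm_cauchy_schwarz[of p' q'] np nq by simp
  finally have pq: "p \<bullet> q \<le> r\<^sup>2 * cos (b - a)" by (simp add: cos_diff power2_eq_square algebra_simps)
  have c: "cos (b - a) = 1 - 2 * (sin ((b - a) / 2))\<^sup>2"
    using cos_double_sin[of "(b - a) / 2"] by (simp only: times_divide_eq_right nonzero_mult_div_cancel_left)
  have "(2 * r * sin ((b - a) / 2))\<^sup>2 = 2 * r\<^sup>2 * (1 - cos (b - a))"
    unfolding c by (simp add: power_mult_distrib)
  also have "\<dots> \<le> p \<bullet> p + q \<bullet> q - 2 * (p \<bullet> q)" using pp pq by (simp add: algebra_simps)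
  also have "\<dots> = (dist p q)\<^sup>2"
    unfolding dist_norm power2_norm_eq_inner by (simp add: inner_diff_left inner_diff_right inner_commute)
  finally show ?thesis by (rule power2_le_imp_le) simp
qed

text \<open>The polar angle with respect to the starting point runs continuously from \<open>0\<close> to \<open>pi\<close>. At the
first times when it passes the multiples of \<open>pi / m\<close> the path takes steps of at least the chord of
this angle.\<close>

lemma path_length_antipodal:
  fixes c :: "'a::euclidean_space"
  assumes g: "path g" "path_image g \<subseteq> sphere c r" and r: "0 < r"
    and ends: "pathfinish g - c = - (pathstart g - c)"
  shows "ennreal (pi * r) \<le> path_length g"
proof -
  define w where "w = (1 / r) *\<^sub>R (g 0 - c)"
  define f where "f t = ((g t - c) \<bullet> w) / r" for t
  have on_sphere: "norm (g t - c) = r" if "t \<in> {0..1}" for t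
  proof -
    have "g t \<in> sphere c r" using g(2) that unfolding path_image_def by blast
    then show ?thesis by (simp add: dist_norm norm_minus_commute)
  qed
  have w: "norm w = 1" using on_sphere[of 0] r by (simp add: w_def)
  have cont: "continuous_on {0..1} f"
    unfolding f_def using g(1) r by (auto simp: path_def intro!: continuous_intros)
  have f0: "f 0 = 1"
  proof -
    have "(g 0 - c) \<bullet> (g 0 - c) = r * r" using on_sphere[of 0] by (simp add: dot_square_norm power2_eq_square)
    then show ?thesis using r by (simp add: f_def w_def)
  qed
  have "g 1 - c = - (g 0 - c)" using ends by (simp add: pathstart_def pathfinish_def)
  then have "f 1 = - f 0" by (simp only: f_def inner_minus_left minus_divide_left)
  then have f1: "f 1 = - 1" using f0 by simp
  have bound: "ennreal (real m * (2 * r * sin (pi / real m / 2))) \<le> path_length g" if m: "0 < m" for m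
  proof -
    \<comment> \<open>First passage times: the sets decrease in \<open>i\<close>, so their infima form a partition.\<close>
    define A where "A i = {t \<in> {0..1}. f t \<le> cos (real i * (pi / m))}" for i
    define t where "t i = (if i \<le> m then Inf (A i) else 1)" for i
    have angle: "0 \<le> real i * (pi / m)" "real i * (pi / m) \<le> pi" if "i \<le> m" for i
      using that m by (auto simp: field_simps)
    have ti: "t i \<in> {0..1} \<and> f (t i) = cos (real i * (pi / m))" if i: "i \<le> m" for i
    proof -
      have 1: "1 \<in> A i" using f1 by (simp add: A_def)
      have bdd: "bdd_below (A i)" by (auto simp: A_def bdd_below_def)
      have "closed (A i)" unfolding A_def by (rule continuous_on_closed_Collect_le[OF cont continuous_on_const]) simp
      then have "Inf (A i) \<in> A i" using 1 bdd by (intro closed_contains_Inf) auto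
      then have T: "Inf (A i) \<in> {0..1}" "f (Inf (A i)) \<le> cos (real i * (pi / m))" by (auto simp: A_def)
      obtain s where s: "0 \<le> s" "s \<le> Inf (A i)" "f s = cos (real i * (pi / m))"
        using IVT2'[of f "Inf (A i)" "cos (real i * (pi / m))" 0] T f0 continuous_on_subset[OF cont] by auto
      then have "s \<in> A i" using T by (auto simp: A_def)
      then have "Inf (A i) \<le> s" using bdd by (rule cInf_lower)
      then have "s = Inf (A i)" using s by simp
      then show ?thesis using i s T by (simp add: t_def)
    qed
    have mono: "mono_on {..m} t"
    proof (rule mono_onI)
      fix i j assume ij: "i \<in> {..m}" "j \<in> {..m}" "i \<le> j"
      have "real i * (pi / m) \<le> real j * (pi / m)" using ij by (intro mult_right_mono) auto
      then have "cos (real j * (pi / m)) \<le> cos (real i * (pi / m))"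
        using ij angle[of i] angle[of j] by (intro cos_monotone_0_pi_le) auto
      then have "A j \<subseteq> A i" by (auto simp: A_def)
      moreover have "1 \<in> A j" using f1 by (simp add: A_def)
      ultimately have "Inf (A i) \<le> Inf (A j)" by (intro cInf_superset_mono) (auto simp: A_def bdd_below_def)
      then show "t i \<le> t j" using ij by (simp add: t_def)
    qed
    have step: "2 * r * sin (pi / m / 2) \<le> dist (g (t i)) (g (t (Suc i)))" if i: "i < m" for i
    proof -
      have "2 * r * sin ((real (Suc i) * (pi / m) - real i * (pi / m)) / 2) \<le> dist (g (t i) - c) (g (t (Suc i)) - c)"
      proof (rule sphere_chord_lower_bound[OF w r])
        show "(g (t i) - c) \<bullet> w = r * cos (real i * (pi / m))"
          using ti[of i] i r by (simp add: f_def field_simps)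
        show "(g (t (Suc i)) - c) \<bullet> w = r * cos (real (Suc i) * (pi / m))"
          using ti[of "Suc i"] i r by (simp add: f_def field_simps)
        show "norm (g (t i) - c) = r" "norm (g (t (Suc i)) - c) = r"
          using ti[of i] ti[of "Suc i"] i by (auto intro: on_sphere)
        show "0 \<le> real i * (pi / m)" "real (Suc i) * (pi / m) \<le> pi" using angle(1)[of i] angle(2)[of "Suc i"] i by (simp_all del: of_nat_Suc)
        show "real i * (pi / m) \<le> real (Suc i) * (pi / m)" by (intro mult_right_mono) auto
      qed
      also have "real (Suc i) * (pi / m) - real i * (pi / m) = pi / m" by (simp only: of_nat_Suc distrib_right)
      finally show ?thesis by (simp add: dist_norm)
    qed
    have "real m * (2 * r * sin (pi / m / 2)) = (\<Sum>i<m. 2 * r * sin (pi / m / 2))" by simp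
    also have "\<dots> \<le> (\<Sum>i<m. dist (g (t i)) (g (t (Suc i))))" by (rule sum_mono) (use step in auto)
    finally have "ennreal (real m * (2 * r * sin (pi / m / 2))) \<le> (\<Sum>i<m. ennreal (dist (g (t i)) (g (t (Suc i)))))"
      by (simp add: sum_ennreal ennreal_leI)
    also have "\<dots> \<le> path_length g" using mono ti by (intro path_length_ge_sum) auto
    finally show ?thesis .
  qed
  have "(\<lambda>m. real m * (2 * r * sin (pi / real m / 2))) \<longlonglongrightarrow> pi * r"
  proof -
    have sin: "((\<lambda>x. sin x / x) \<longlongrightarrow> 1) (at (0::real))"
      using DERIV_sin[of 0] by (simp add: has_field_derivative_iff)
    have "(\<lambda>m. pi / real m / 2) \<longlonglongrightarrow> 0"
      using lim_const_over_n[of "pi / 2"] by (simp add: divide_divide_eq_left mult.commute)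
    then have "filterlim (\<lambda>m. pi / real m / 2) (at 0) sequentially"
      by (auto simp: filterlim_at intro!: eventually_sequentiallyI[of 1])
    from filterlim_compose[OF sin this]
    have "(\<lambda>m. sin (pi / real m / 2) / (pi / real m / 2) * (pi * r)) \<longlonglongrightarrow> 1 * (pi * r)"
      by (intro tendsto_mult tendsto_const)
    moreover have "\<forall>\<^sub>F m in sequentially. sin (pi / real m / 2) / (pi / real m / 2) * (pi * r) = real m * (2 * r * sin (pi / real m / 2))"
      by (rule eventually_sequentiallyI[of 1]) simp
    ultimately have "(\<lambda>m. real m * (2 * r * sin (pi / real m / 2))) \<longlonglongrightarrow> 1 * (pi * r)"
      by (rule Lim_transform_eventually)
    then show ?thesis by simp
  qed
  from tendsto_ennrealI[OF this] show ?thesis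
    by (rule tendsto_upperbound) (use bound in \<open>auto intro!: eventually_sequentiallyI[of 1]\<close>)
qed

lemma intrinsic_dist_antipodal:
  fixes c :: "'a::euclidean_space"
  assumes r: "0 < r"
  shows "ennreal (pi * r) \<le> intrinsic_dist (sphere c r) x (c - (x - c))"
  unfolding intrinsic_dist_def using r
  by (intro INF_greatest path_length_antipodal[of _ c r]) auto

lemma circle_integral_linear: "circle_integral (\<lambda>u. q \<bullet> u) e f = 0"
proof -
  have "((\<lambda>t. q \<bullet> circle_pt e f t) has_integral
      ((q \<bullet> e) * sin (2 * pi) - (q \<bullet> f) * cos (2 * pi)) - ((q \<bullet> e) * sin 0 - (q \<bullet> f) * cos 0)) {0..2 * pi}"
    by (rule fundamental_theorem_of_calculus)
      (auto simp: circle_pt_def inner_add_right has_real_derivative_iff_has_vector_derivative[symmetric]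
        intro!: derivative_eq_intros)
  then show ?thesis unfolding circle_integral_def by (simp add: integral_unique)
qed

lemma circle_integral_mono:
  assumes "continuous_on UNIV v" "continuous_on UNIV w" "orthonormal_pair e f" "\<And>u. norm u = 1 \<Longrightarrow> v u \<le> w u"
  shows "circle_integral v e f \<le> circle_integral w e f"
  unfolding circle_integral_def using assms by (intro integral_le circle_integrable) auto

lemma circle_integral_support_fun_nonneg:
  assumes "bounded S" "S \<noteq> {}" "orthonormal_pair e f"
  shows "0 \<le> circle_integral (support_fun S) e f"
proof -
  obtain p where "p \<in> S" using assms by blast
  then have "circle_integral (\<lambda>u. p \<bullet> u) e f \<le> circle_integral (support_fun S) e f"
    using assms by (intro circle_integral_mono continuous_on_support_fun support_fun_ge continuous_intros)
  then show ?thesis by (simp add: circle_integral_linear)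
qed

lemma exists_orthogonal_unit:
  fixes a b :: "'a::euclidean_space"
  assumes "3 \<le> DIM('a)"
  obtains f where "norm f = 1" "f \<bullet> a = 0" "f \<bullet> b = 0"
proof -
  have "dim {a, b} \<le> card {a, b}" by (rule dim_le_card') simp
  also have "\<dots> \<le> 2" by (simp add: card_insert_if)
  finally have "dim {a, b} < DIM('a)" using assms by simp
  then obtain x where x: "x \<noteq> 0" "\<And>y. y \<in> span {a, b} \<Longrightarrow> orthogonal x y"
    using orthogonal_to_subspace_exists by metis
  have "x \<bullet> a = 0" "x \<bullet> b = 0" using x(2) by (auto simp: orthogonal_def span_base)
  then show ?thesis using x(1) by (intro that[of "(1 / norm x) *\<^sub>R x"]) auto
qed

text \<open>If \<open>y\<close> is not antipodal to \<open>x\<close> then the midpoint of the two points differs from the centre \<open>c\<close> by a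
vector \<open>m \<noteq> 0\<close>. The plane through \<open>x\<close> and \<open>y\<close> perpendicular to \<open>m\<close>, available in dimension three or more,
cuts the ball in a disc of radius less than \<open>r\<close>.\<close>

lemma intrinsic_dist_nonantipodal:
  fixes c :: "'a::euclidean_space"
  assumes dim: "3 \<le> DIM('a)" and r: "0 < r" and x: "x \<in> sphere c r" and y: "y \<in> sphere c r" and ne: "y \<noteq> c - (x - c)"
  shows "intrinsic_dist (sphere c r) x y < ennreal (pi * r)"
proof -
  define m where "m = (1 / 2) *\<^sub>R (x + y) - c"
  have "(x + y) - 2 *\<^sub>R c = 2 *\<^sub>R m" by (simp add: m_def algebra_simps)
  then have m0: "m \<noteq> 0" using ne by (auto simp: algebra_simps scaleR_2)
  have nx: "(x - c) \<bullet> (x - c) = r\<^sup>2" "(y - c) \<bullet> (y - c) = r\<^sup>2"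
    using x y by (auto simp: dot_square_norm dist_norm norm_minus_commute)
  have perp: "(y - x) \<bullet> m = 0"
  proof -
    have "(y - x) \<bullet> (2 *\<^sub>R m) = (y - c) \<bullet> (y - c) - (x - c) \<bullet> (x - c)"
      unfolding \<open>(x + y) - 2 *\<^sub>R c = 2 *\<^sub>R m\<close>[symmetric]
      by (simp add: inner_diff_left inner_diff_right inner_add_right inner_commute algebra_simps scaleR_2)
    then show ?thesis using nx by simp
  qed
  obtain e where e: "norm e = 1" "e \<bullet> m = 0" "y - x = norm (y - x) *\<^sub>R e"
  proof (cases "x = y")
    case True
    then show ?thesis using exists_orthogonal_unit[OF dim, of m m] that by auto
  next
    case False
    then show ?thesis using perp by (intro that[of "(1 / norm (y - x)) *\<^sub>R (y - x)"]) auto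
  qed
  obtain f where f: "norm f = 1" "f \<bullet> m = 0" "f \<bullet> e = 0" using exists_orthogonal_unit[OF dim, of m e] by blast
  have frame: "orthonormal_pair e f" using e f by (simp add: orthonormal_pair_def inner_commute)
  have ee: "e \<bullet> e = 1" "e \<bullet> f = 0" using e f by (auto simp: norm_eq_1 inner_commute)
  define q where "q = x - (x \<bullet> e) *\<^sub>R e - (x \<bullet> f) *\<^sub>R f"
  let ?S = "plane_slice (cball c r) e f q"
  have xS: "x \<in> ?S" using x by (simp add: plane_slice_def q_def)
  have yx: "y = x + norm (y - x) *\<^sub>R e" using e(3) by (metis add.commute diff_add_cancel)
  have yS: "y \<in> ?S"
  proof -
    have "y \<bullet> e = x \<bullet> e + norm (y - x)" "y \<bullet> f = x \<bullet> f"
      using ee by (subst yx, simp add: inner_add_left)+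
    then have "y = q + (y \<bullet> e) *\<^sub>R e + (y \<bullet> f) *\<^sub>R f"
      using yx by (simp add: q_def algebra_simps)
    then show ?thesis using y by (simp add: plane_slice_def)
  qed
  define \<rho> where "\<rho> = sqrt (r\<^sup>2 - (norm m)\<^sup>2)"
  have in_disc: "norm (p - (c + m)) \<le> \<rho>" if p: "p \<in> ?S" for p
  proof -
    have "q \<bullet> m = x \<bullet> m" using e f by (simp add: q_def inner_diff_left)
    moreover have "p \<bullet> m = q \<bullet> m"
    proof -
      have "p = q + (p \<bullet> e) *\<^sub>R e + (p \<bullet> f) *\<^sub>R f" using p by (simp add: plane_slice_def)
      then have "p \<bullet> m = (q + (p \<bullet> e) *\<^sub>R e + (p \<bullet> f) *\<^sub>R f) \<bullet> m" by simp
      then show ?thesis using e f by (simp add: inner_add_left)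
    qed
    moreover have "(x - c) \<bullet> m = m \<bullet> m"
    proof -
      have "x - c = m - (1 / 2) *\<^sub>R (y - x)" by (simp add: m_def algebra_simps flip: scaleR_2)
      then show ?thesis using perp by (simp add: inner_diff_left)
    qed
    ultimately have pm: "(p - c) \<bullet> m = m \<bullet> m" by (simp add: inner_diff_left)
    have "norm (p - c) \<le> r" using p by (simp add: plane_slice_def dist_norm norm_minus_commute)
    then have pc: "(p - c) \<bullet> (p - c) \<le> r\<^sup>2" using r by (simp add: dot_square_norm power_mono)
    have "(norm (p - (c + m)))\<^sup>2 = (p - c) \<bullet> (p - c) - 2 * ((p - c) \<bullet> m) + m \<bullet> m"
    proof -
      have "p - (c + m) = (p - c) - m" by simp
      then show ?thesis unfolding power2_norm_eq_inner by (simp only: inner_diff_left[of "p - c" m] inner_diff_right[of _ "p - c" m] inner_commute[of m "p - c"])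
    qed
    also have "\<dots> \<le> r\<^sup>2 - (norm m)\<^sup>2" using pm pc by (simp add: dot_square_norm)
    finally show ?thesis unfolding \<rho>_def by (rule real_le_rsqrt)
  qed
  have "0 \<le> \<rho>" using in_disc[OF xS] norm_ge_zero order_trans by blast
  have "\<rho> < r"
  proof -
    have "\<rho> < sqrt (r\<^sup>2)" unfolding \<rho>_def using m0 by (intro real_sqrt_less_mono) simp
    then show ?thesis using r by simp
  qed
  have bS: "bounded ?S" by (rule bounded_subset[of "cball c r"]) (auto simp: plane_slice_def)
  have contS: "continuous_on UNIV (support_fun ?S)" using bS xS by (intro continuous_on_support_fun) auto
  have le: "support_fun ?S u \<le> (c + m) \<bullet> u + \<rho>" if u: "norm u = 1" for u
  proof (rule support_fun_le)
    fix p assume "p \<in> ?S"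
    have "(p - (c + m)) \<bullet> u \<le> norm (p - (c + m)) * norm u" by (rule norm_cauchy_schwarz)
    also have "\<dots> \<le> \<rho>" using in_disc[OF \<open>p \<in> ?S\<close>] u by simp
    finally show "p \<bullet> u \<le> (c + m) \<bullet> u + \<rho>" by (simp add: inner_diff_left)
  qed (use xS in auto)
  have "circle_integral (support_fun ?S) e f \<le> circle_integral (\<lambda>u. (c + m) \<bullet> u + \<rho>) e f"
    using le by (intro circle_integral_mono contS frame continuous_intros)
  also have "\<dots> = circle_integral (\<lambda>u. (c + m) \<bullet> u) e f + 2 * pi * \<rho>"
    unfolding circle_integral_def
    by (subst Henstock_Kurzweil_Integration.integral_add) (auto intro!: circle_integrable continuous_intros)
  finally have "circle_integral (support_fun ?S) e f / 2 \<le> pi * \<rho>" by (simp add: circle_integral_linear)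
  moreover have fr: "frontier (cball c r) = sphere c r" using r by (simp add: frontier_cball)
  have "intrinsic_dist (sphere c r) x y \<le> ennreal (circle_integral (support_fun ?S) e f / 2)"
    using intrinsic_dist_le_slice[of "cball c r" e f x q y] frame xS yS x y r fr
    unfolding circle_integral_def by simp
  ultimately have "intrinsic_dist (sphere c r) x y \<le> ennreal (pi * \<rho>)"
    by (meson ennreal_leI order_trans)
  also have "\<dots> < ennreal (pi * r)" using \<open>\<rho> < r\<close> \<open>0 \<le> \<rho>\<close> by (simp add: ennreal_less_iff)
  finally show ?thesis .
qed

section \<open>Convex bodies with full planar slices are balls\<close>

lemma circle_through:
  fixes v z :: "'a::euclidean_space"
  assumes dim: "2 \<le> DIM('a)" and v: "norm v = 1" and z: "norm z = 1"
  obtains f t where "orthonormal_pair v f" "0 \<le> t" "t < 2 * pi" "z = circle_pt v f t"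
proof -
  have vv: "v \<bullet> v = 1" using v by (simp add: norm_eq_1)
  define q where "q = z - (z \<bullet> v) *\<^sub>R v"
  obtain f where f: "norm f = 1" "v \<bullet> f = 0" "q = norm q *\<^sub>R f"
  proof (cases "q = 0")
    case True
    have "dim {v} < DIM('a)" using dim dim_le_card'[of "{v}"] by simp
    then obtain x where x: "x \<noteq> 0" "\<And>y. y \<in> span {v} \<Longrightarrow> orthogonal x y"
      using orthogonal_to_subspace_exists by metis
    have "x \<bullet> v = 0" using x(2)[of v] by (auto simp: orthogonal_def span_base)
    then show ?thesis using True x(1) by (intro that[of "(1 / norm x) *\<^sub>R x"]) (auto simp: inner_commute)
  next
    case False
    have "v \<bullet> q = 0" using vv by (simp add: q_def inner_diff_right inner_commute)
    then show ?thesis using False by (intro that[of "(1 / norm q) *\<^sub>R q"]) auto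
  qed
  have zq: "z = (z \<bullet> v) *\<^sub>R v + norm q *\<^sub>R f" unfolding f(3)[symmetric] by (simp add: q_def)
  have "(z \<bullet> v)\<^sup>2 + (norm q)\<^sup>2 = z \<bullet> z"
    unfolding power2_norm_eq_inner q_def using vv
    by (simp add: inner_diff_left inner_diff_right inner_commute power2_eq_square)
  then have "(z \<bullet> v)\<^sup>2 + (norm q)\<^sup>2 = 1" using z by (simp add: dot_square_norm)
  then obtain t where "0 \<le> t" "t < 0 + 2 * pi" "(z \<bullet> v) *\<^sub>R v + norm q *\<^sub>R f = circle_pt v f t"
    by (rule exists_circle_pt)
  moreover have "orthonormal_pair v f" using v f by (simp add: orthonormal_pair_def)
  ultimately show ?thesis using that[of f t] zq by simp
qed

text \<open>The hypothesis says that passing from \<open>v\<close> to a point at angle \<open>d\<close> costs at most a factor \<open>cos d\<close>.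
Dividing an arc of length \<open>t\<close> into \<open>n\<close> steps costs \<open>cos (t / n) ^ n\<close>, which tends to one.
The lemma is used for the width and for the distance from the centre to the supporting hyperplane.\<close>

lemma sphere_function_constant:
  fixes g :: "'a::euclidean_space \<Rightarrow> real"
  assumes dim: "2 \<le> DIM('a)" and nonneg: "\<And>v. norm v = 1 \<Longrightarrow> 0 \<le> g v"
    and cos: "\<And>v z. norm v = 1 \<Longrightarrow> norm z = 1 \<Longrightarrow> g v * (v \<bullet> z) \<le> g z"
    and v: "norm v = 1" and z: "norm z = 1"
  shows "g v = g z"
proof -
  have le: "g v \<le> g z" if v: "norm v = 1" and z: "norm z = 1" for v z
  proof -
    obtain f t where f: "orthonormal_pair v f" "0 \<le> t" "z = circle_pt v f t"
      using circle_through[OF dim v z] by metis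
    have bound: "g v * (1 - t\<^sup>2 / 2 / real n) \<le> g z" if n: "real n > t" "0 < n" for n
    proof -
      define d where "d = t / real n"
      have d: "0 \<le> d" "d \<le> 1" "real n * d = t" using n f(2) by (simp_all add: d_def)
      have cosd: "1 - d\<^sup>2 / 2 \<le> cos d"
      proof -
        have "cos d = 1 - 2 * (sin (d / 2))\<^sup>2"
          using cos_double_sin[of "d / 2"] by simp
        moreover have "(sin (d / 2))\<^sup>2 \<le> (d / 2)\<^sup>2"
          by (rule abs_le_square_iff[THEN iffD1, OF abs_sin_x_le_abs_x])
        ultimately show ?thesis by (simp add: power_divide)
      qed
      have d2: "0 \<le> 1 - d\<^sup>2 / 2" using d power_le_one[of d 2] by simp
      have "g v * (1 - d\<^sup>2 / 2) ^ k \<le> g (circle_pt v f (k * d))" for k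
      proof (induction k)
        case 0 then show ?case by (simp add: circle_pt_def)
      next
        case (Suc k)
        let ?x = "circle_pt v f (k * d)" and ?y = "circle_pt v f (Suc k * d)"
        have "g v * (1 - d\<^sup>2 / 2) ^ Suc k = (g v * (1 - d\<^sup>2 / 2) ^ k) * (1 - d\<^sup>2 / 2)" by simp
        also have "\<dots> \<le> g ?x * (1 - d\<^sup>2 / 2)" using Suc.IH d2 by (rule mult_right_mono)
        also have "\<dots> \<le> g ?x * cos d" using cosd nonneg f(1) by (intro mult_left_mono) auto
        also have "cos d = ?x \<bullet> ?y"
          unfolding inner_circle_pt[OF f(1)] by (simp add: algebra_simps)
        also have "g ?x * (?x \<bullet> ?y) \<le> g ?y" using f(1) by (intro cos) auto
        finally show ?case .
      qed
      from this[of n] have "g v * (1 - d\<^sup>2 / 2) ^ n \<le> g z" using d(3) f(3) by simp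
      moreover have "1 + real n * (- (d\<^sup>2 / 2)) \<le> (1 + - (d\<^sup>2 / 2)) ^ n"
        using d2 by (intro Bernoulli_inequality) simp
      moreover have "1 + real n * (- (d\<^sup>2 / 2)) = 1 - t\<^sup>2 / 2 / real n"
        using n by (simp add: d_def power_divide power2_eq_square)
      ultimately show ?thesis using nonneg[OF v] mult_left_mono[of "1 - t\<^sup>2 / 2 / real n" "(1 - d\<^sup>2 / 2) ^ n" "g v"] by simp
    qed
    have "(\<lambda>n. g v * (1 - t\<^sup>2 / 2 / real n)) \<longlonglongrightarrow> g v * (1 - 0)"
      by (intro tendsto_mult tendsto_diff tendsto_const lim_const_over_n)
    moreover obtain N where "real N > t" using reals_Archimedean2 by blast
    then have "\<forall>\<^sub>F n in sequentially. g v * (1 - t\<^sup>2 / 2 / real n) \<le> g z"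
      using f(2) by (intro eventually_sequentiallyI[of "Suc N"] bound) auto
    ultimately have "g v * (1 - 0) \<le> g z" by (rule tendsto_upperbound) simp
    then show ?thesis by simp
  qed
  show ?thesis using le[OF v z] le[OF z v] by simp
qed

text \<open>The hypothesis says that the lines through \<open>P v\<close> in direction \<open>v\<close> pairwise meet. Take for \<open>c\<close> the
common point of the lines in two coordinate directions. The line in a third coordinate direction
passes through \<open>c\<close> because it meets both, and every other direction is compared with all three, since it may
be a linear combination of two of them.\<close>

lemma concurrent_normals:
  fixes P :: "'a::euclidean_space \<Rightarrow> 'a"
  assumes dim: "3 \<le> DIM('a)"
    and coplanar: "\<And>v z. norm v = 1 \<Longrightarrow> norm z = 1 \<Longrightarrow> \<exists>a b. P z - P v = a *\<^sub>R v + b *\<^sub>R z"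
  obtains c where "\<And>z. norm z = 1 \<Longrightarrow> \<exists>k. P z = c + k *\<^sub>R z"
proof -
  obtain B :: "'a set" where B: "B \<subseteq> Basis" "card B = 3"
    using dim obtain_subset_with_card_n by metis
  then obtain b1 b2 b3 where b: "B = {b1, b2, b3}" "b1 \<noteq> b2" "b1 \<noteq> b3" "b2 \<noteq> b3"
    using card_3_iff by metis
  have mem: "b1 \<in> Basis" "b2 \<in> Basis" "b3 \<in> Basis" using B b by auto
  have nb: "norm b1 = 1" "norm b2 = 1" "norm b3 = 1" using mem by auto
  have ip: "b1 \<bullet> b1 = 1" "b2 \<bullet> b2 = 1" "b3 \<bullet> b3 = 1" "b1 \<bullet> b2 = 0" "b2 \<bullet> b1 = 0"
    "b1 \<bullet> b3 = 0" "b3 \<bullet> b1 = 0" "b2 \<bullet> b3 = 0" "b3 \<bullet> b2 = 0"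
    using mem b by (auto simp: inner_Basis)
  obtain s t where st: "P b1 - P b2 = s *\<^sub>R b2 + t *\<^sub>R b1" using coplanar[OF nb(2,1)] by blast
  define c where "c = P b1 - t *\<^sub>R b1"
  have c1: "P b1 = c + t *\<^sub>R b1" by (simp add: c_def)
  have c2: "P b2 = c + (- s) *\<^sub>R b2" using st by (simp add: c_def algebra_simps)
  have off: "\<exists>a b. P z - c = a *\<^sub>R v + b *\<^sub>R z" if vz: "norm v = 1" "norm z = 1" "P v = c + k *\<^sub>R v" for v z k
  proof -
    obtain a b where "P z - P v = a *\<^sub>R v + b *\<^sub>R z" using coplanar[OF vz(1,2)] by blast
    then have "P z - c = (a + k) *\<^sub>R v + b *\<^sub>R z" using vz(3) by (simp add: algebra_simps)
    then show ?thesis by blast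
  qed
  obtain k3 where c3: "P b3 = c + k3 *\<^sub>R b3"
  proof -
    obtain a1 k1 where 1: "P b3 - c = a1 *\<^sub>R b1 + k1 *\<^sub>R b3" using off[OF nb(1,3) c1] by blast
    obtain a2 k2 where 2: "P b3 - c = a2 *\<^sub>R b2 + k2 *\<^sub>R b3" using off[OF nb(2,3) c2] by blast
    have "(P b3 - c) \<bullet> b1 = a1" unfolding 1 by (simp add: inner_add_left ip)
    moreover have "(P b3 - c) \<bullet> b1 = 0" unfolding 2 by (simp add: inner_add_left ip)
    ultimately show ?thesis using 1 by (intro that[of k1]) (simp add: algebra_simps)
  qed
  have "\<exists>k. P z = c + k *\<^sub>R z" if z: "norm z = 1" for z
  proof -
    obtain a1 k1 where 1: "P z - c = a1 *\<^sub>R b1 + k1 *\<^sub>R z" using off[OF nb(1) z c1] by blast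
    obtain a2 k2 where 2: "P z - c = a2 *\<^sub>R b2 + k2 *\<^sub>R z" using off[OF nb(2) z c2] by blast
    obtain a3 k3 where 3: "P z - c = a3 *\<^sub>R b3 + k3 *\<^sub>R z" using off[OF nb(3) z c3] by blast
    have "a1 = 0 \<or> a2 = 0 \<or> a3 = 0"
    proof (cases "k1 = k2")
      case True
      then have "a1 *\<^sub>R b1 = a2 *\<^sub>R b2" using 1 2 by simp
      then have "(a1 *\<^sub>R b1) \<bullet> b1 = (a2 *\<^sub>R b2) \<bullet> b1" by simp
      then show ?thesis by (simp add: ip)
    next
      case False
      have 12: "(k2 - k1) *\<^sub>R z = a1 *\<^sub>R b1 - a2 *\<^sub>R b2" using 1 2 by (simp add: algebra_simps)
      have "(k2 - k1) * (z \<bullet> b3) = 0"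
        using arg_cong[OF 12, of "\<lambda>x. x \<bullet> b3"] by (simp add: inner_diff_left ip)
      then have z3: "z \<bullet> b3 = 0" using False by simp
      have 13: "(k3 - k1) *\<^sub>R z = a1 *\<^sub>R b1 - a3 *\<^sub>R b3" using 1 3 by (simp add: algebra_simps)
      show ?thesis
        using arg_cong[OF 13, of "\<lambda>x. x \<bullet> b3"] z3 by (simp add: inner_diff_left ip)
    qed
    then have "P z - c = k1 *\<^sub>R z \<or> P z - c = k2 *\<^sub>R z \<or> P z - c = k3 *\<^sub>R z"
      using 1 2 3 by auto
    then show ?thesis by (metis add.commute diff_add_cancel)
  qed
  then show ?thesis using that by blast
qed

lemma cball_from_support_fun:
  fixes K :: "'a::euclidean_space set"
  assumes K: "compact K" "convex K" "K \<noteq> {}" and h: "\<And>u. norm u = 1 \<Longrightarrow> support_fun K u = c \<bullet> u + r" and r: "0 \<le> r"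
  shows "K = cball c r"
proof (intro set_eqI iffI)
  fix x assume x: "x \<in> K"
  show "x \<in> cball c r"
  proof (cases "x = c")
    case False
    let ?u = "(1 / norm (x - c)) *\<^sub>R (x - c)"
    have u: "norm ?u = 1" using False by simp
    have "x \<bullet> ?u \<le> c \<bullet> ?u + r" using support_fun_ge[OF compact_imp_bounded[OF K(1)] x, of ?u] h[OF u] by simp
    then have "(x - c) \<bullet> ?u \<le> r" by (simp only: inner_diff_left)
    moreover have "(x - c) \<bullet> ?u = norm (x - c)" using False by (simp add: dot_square_norm power2_eq_square)
    ultimately show ?thesis by (simp add: dist_norm norm_minus_commute)
  qed (use r in simp)
next
  fix y assume y: "y \<in> cball c r"
  show "y \<in> K"
  proof (rule ccontr)
    assume "y \<notin> K"
    then obtain a b where ab: "a \<bullet> y < b" "\<And>x. x \<in> K \<Longrightarrow> b < a \<bullet> x"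
      using separating_hyperplane_closed_point[OF K(2) compact_imp_closed[OF K(1)]] by metis
    have a0: "a \<noteq> 0" using ab K(3) by force
    let ?u = "(- 1 / norm a) *\<^sub>R a"
    have u: "norm ?u = 1" using a0 by simp
    obtain p where p: "p \<in> K" "p \<bullet> ?u = support_fun K ?u" using support_fun_attained[OF K(1,3)] by blast
    have "p \<bullet> ?u < y \<bullet> ?u"
    proof -
      have "a \<bullet> y < a \<bullet> p" using ab(1) ab(2)[OF p(1)] by simp
      then show ?thesis using a0 by (simp add: inner_commute divide_strict_right_mono)
    qed
    then have "r < (y - c) \<bullet> ?u" using p(2) h[OF u] by (simp only: inner_diff_left)
    also have "\<dots> \<le> norm (y - c) * norm ?u" by (rule norm_cauchy_schwarz)
    finally have "r < norm (y - c)" using u by simp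
    then show False using y by (simp add: dist_norm norm_minus_commute)
  qed
qed

text \<open>If the compact convex face with normal \<open>w\<close> missed the line through \<open>x\<close> in direction \<open>v\<close>, then it would be
strictly separated from the point of the line in the same hyperplane. In dimension at least three
there is a plane through the line whose trace in that hyperplane is parallel to the separating
hyperplane, and it would miss the face.\<close>

lemma chord_meets_face:
  fixes K :: "'a::euclidean_space set"
  assumes dim: "3 \<le> DIM('a)" and K: "compact K" "convex K" and v: "norm v = 1" and w: "w = v \<or> w = - v"
    and planes: "\<And>f. orthonormal_pair v f \<Longrightarrow> \<exists>p\<in>K. \<exists>a b. p = x + a *\<^sub>R v + b *\<^sub>R f \<and> p \<bullet> w = support_fun K w"
  shows "x + (support_fun K w - x \<bullet> w) *\<^sub>R w \<in> K"
proof (rule ccontr)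
  let ?F = "{p \<in> K. p \<bullet> w = support_fun K w}" and ?q = "x + (support_fun K w - x \<bullet> w) *\<^sub>R w"
  assume "?q \<notin> K"
  have F: "convex ?F" "closed ?F"
  proof -
    have eq: "?F = K \<inter> {p. w \<bullet> p = support_fun K w}" by (auto simp: inner_commute)
    show "convex ?F" unfolding eq using K by (intro convex_Int convex_hyperplane)
    show "closed ?F" unfolding eq using K by (intro closed_Int closed_hyperplane compact_imp_closed)
  qed
  have "?q \<notin> ?F" using \<open>?q \<notin> K\<close> by simp
  from separating_hyperplane_closed_point[OF F this]
  obtain z b where z: "z \<bullet> ?q < b" "\<forall>p\<in>?F. b < z \<bullet> p" by blast
  obtain f where f: "norm f = 1" "f \<bullet> v = 0" "f \<bullet> z = 0" using exists_orthogonal_unit[OF dim, of v z] by blast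
  then have "orthonormal_pair v f" using v by (simp add: orthonormal_pair_def inner_commute)
  then obtain p s t where p: "p \<in> K" "p = x + s *\<^sub>R v + t *\<^sub>R f" "p \<bullet> w = support_fun K w" using planes by blast
  have fw: "f \<bullet> w = 0" using f w by auto
  have vw: "v = (v \<bullet> w) *\<^sub>R w" using w v by (auto simp: norm_eq_1)
  have "support_fun K w - x \<bullet> w = s * (v \<bullet> w)"
    unfolding p(3)[symmetric] p(2) by (simp add: inner_add_left fw)
  then have "(support_fun K w - x \<bullet> w) *\<^sub>R w = s *\<^sub>R v"
    by (simp only: scaleR_scaleR[symmetric] vw[symmetric])
  then have "p = ?q + t *\<^sub>R f" using p(2) by simp
  then have "z \<bullet> p = z \<bullet> ?q" using f(3) by (simp add: inner_add_right inner_commute)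
  then show False using z p by auto
qed

text \<open>The points \<open>P v\<close> and \<open>Q v\<close> are the end points of the chord on the line for the direction \<open>v\<close>. They lie in
the faces with normals \<open>v\<close> and \<open>- v\<close>, so their difference is the width \<open>W v\<close> times \<open>v\<close>, and since
\<open>W\<close> is the support function of the difference body, it satisfies the cosine inequality and is constant.
A body of constant width has diameter \<open>W\<close>, so a point in the face with normal \<open>z\<close> can only be
\<open>P z\<close>. Applying the hypothesis to the plane spanned by \<open>v\<close> and \<open>z\<close> shows that the lines for \<open>v\<close> and \<open>z\<close>
are coplanar. So \<open>P z = c + k z *\<^sub>R z\<close> for a centre \<open>c\<close>, and \<open>k\<close> is constant by the cosine inequality
once more.\<close>

lemma ball_from_full_slices:
  fixes K :: "'a::euclidean_space set"
  assumes dim: "3 \<le> DIM('a)" and K: "compact K" "convex K" "interior K \<noteq> {}"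
    and full: "\<And>v. norm v = 1 \<Longrightarrow> \<exists>x. \<forall>f t. orthonormal_pair v f \<longrightarrow> 0 \<le> t \<longrightarrow> t \<le> 2 * pi \<longrightarrow>
      (\<exists>p\<in>K. \<exists>a b. p = x + a *\<^sub>R v + b *\<^sub>R f \<and> p \<bullet> circle_pt v f t = support_fun K (circle_pt v f t))"
  obtains c r where "0 < r" "K = cball c r"
proof -
  let ?h = "support_fun K"
  have ne: "K \<noteq> {}" using K(3) interior_subset by blast
  have bK: "bounded K" using K(1) by (rule compact_imp_bounded)
  have dim2: "2 \<le> DIM('a)" using dim by simp
  obtain X where X: "\<And>v f t. norm v = 1 \<Longrightarrow> orthonormal_pair v f \<Longrightarrow> 0 \<le> t \<Longrightarrow> t \<le> 2 * pi \<Longrightarrow>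
      \<exists>p\<in>K. \<exists>a b. p = X v + a *\<^sub>R v + b *\<^sub>R f \<and> p \<bullet> circle_pt v f t = ?h (circle_pt v f t)"
    using full by metis
  define P where "P v = X v + (?h v - X v \<bullet> v) *\<^sub>R v" for v
  define Q where "Q v = X v + (?h (- v) - X v \<bullet> (- v)) *\<^sub>R (- v)" for v
  have PK: "P v \<in> K" if v: "norm v = 1" for v
    unfolding P_def
    by (rule chord_meets_face[OF dim K(1,2) v]) (use X[OF v, of _ 0] in \<open>auto simp: circle_pt_def\<close>)
  have QK: "Q v \<in> K" if v: "norm v = 1" for v
    unfolding Q_def
    by (rule chord_meets_face[OF dim K(1,2) v]) (use X[OF v, of _ pi] in \<open>auto simp: circle_pt_def\<close>)
  have Pv: "P v \<bullet> v = ?h v" and Qv: "Q v \<bullet> (- v) = ?h (- v)" if "norm v = 1" for v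
    using that by (simp_all add: P_def Q_def inner_add_left inner_diff_left norm_eq_1)
  define W where "W v = ?h v + ?h (- v)" for v
  have PQ: "P v - Q v = W v *\<^sub>R v" for v
    by (simp add: P_def Q_def W_def algebra_simps)
  have diff_le: "(a - b) \<bullet> z \<le> W z" if "a \<in> K" "b \<in> K" for a b z
    using support_fun_ge[OF bK that(1), of z] support_fun_ge[OF bK that(2), of "- z"]
    by (simp add: W_def inner_diff_left)
  have W_const: "W v = W z" if "norm v = 1" "norm z = 1" for v z
  proof (rule sphere_function_constant[OF dim2 _ _ that])
    fix v z :: 'a assume v: "norm v = 1" and z: "norm z = 1"
    show "0 \<le> W v" using diff_le[OF PK[OF v] PK[OF v], of v] by simp
    show "W v * (v \<bullet> z) \<le> W z" using diff_le[OF PK[OF v] QK[OF v], of z] by (simp add: PQ)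
  qed
  have unique: "a = P z" if z: "norm z = 1" and a: "a \<in> K" "a \<bullet> z = ?h z" for a z
  proof -
    have W0: "0 \<le> W z" using diff_le[OF PK[OF z] PK[OF z], of z] by simp
    have "norm (a - Q z) \<le> W z"
    proof (cases "a = Q z")
      case False
      let ?d = "(1 / norm (a - Q z)) *\<^sub>R (a - Q z)"
      have d: "norm ?d = 1" using False by simp
      have "(a - Q z) \<bullet> ?d = norm (a - Q z)" using False by (simp add: dot_square_norm power2_eq_square)
      then show ?thesis using diff_le[OF a(1) QK[OF z], of ?d] W_const[OF d z] by simp
    qed (use W0 in simp)
    then have n: "(a - Q z) \<bullet> (a - Q z) \<le> (W z)\<^sup>2" using W0 by (simp add: dot_square_norm power_mono)
    have iz: "(a - Q z) \<bullet> z = W z" using a(2) Qv[OF z] by (simp add: inner_diff_left W_def)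
    have zz: "z \<bullet> z = 1" using z by (simp add: norm_eq_1)
    have "(norm ((a - Q z) - W z *\<^sub>R z))\<^sup>2 = (a - Q z) \<bullet> (a - Q z) - 2 * (W z * ((a - Q z) \<bullet> z)) + (W z)\<^sup>2 * (z \<bullet> z)"
      unfolding power2_norm_eq_inner
      by (simp only: inner_diff_left[of "a - Q z" "W z *\<^sub>R z"] inner_diff_right[of _ "a - Q z" "W z *\<^sub>R z"]
          inner_scaleR_left inner_scaleR_right inner_commute[of z "a - Q z"]) (simp add: power2_eq_square algebra_simps)
    also have "\<dots> \<le> 0" using n unfolding iz zz by (simp add: power2_eq_square)
    finally have "(a - Q z) - W z *\<^sub>R z = 0" by simp
    then show ?thesis using PQ[of z] by (simp add: algebra_simps)
  qed
  have coplanar: "\<exists>a b. P z - P v = a *\<^sub>R v + b *\<^sub>R z" if v: "norm v = 1" and z: "norm z = 1" for v z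
  proof -
    obtain f t where f: "orthonormal_pair v f" "0 \<le> t" "t < 2 * pi" "z = circle_pt v f t"
      using circle_through[OF dim2 v z] by metis
    obtain p a b where p: "p \<in> K" "p = X v + a *\<^sub>R v + b *\<^sub>R f" "p \<bullet> z = ?h z"
      using X[OF v f(1,2)] f(3,4) by (metis less_imp_le)
    have pz: "p = P z" using unique[OF z p(1,3)] .
    show ?thesis
    proof (cases "sin t = 0")
      case False
      have fe: "f = (1 / sin t) *\<^sub>R (z - cos t *\<^sub>R v)" using False by (simp add: f(4) circle_pt_def)
      have bf: "b *\<^sub>R f = (b / sin t) *\<^sub>R (z - cos t *\<^sub>R v)" by (subst fe) simp
      have "P z - P v = (a - (?h v - X v \<bullet> v)) *\<^sub>R v + b *\<^sub>R f"
        unfolding pz[symmetric] p(2) by (simp add: P_def algebra_simps)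
      then have "P z - P v = (a - (?h v - X v \<bullet> v)) *\<^sub>R v + (b / sin t) *\<^sub>R (z - cos t *\<^sub>R v)"
        by (simp only: bf)
      then have "P z - P v = (a - (?h v - X v \<bullet> v) - b / sin t * cos t) *\<^sub>R v + (b / sin t) *\<^sub>R z"
        by (simp add: algebra_simps)
      then show ?thesis by blast
    next
      case True
      then have "\<bar>cos t\<bar> = 1" using sin_zero_abs_cos_one by blast
      then have "z = v \<or> z = - v" using True f(4) by (auto simp: circle_pt_def abs_if split: if_splits)
      then show ?thesis
      proof
        assume "z = v"
        then have "P z - P v = 0 *\<^sub>R v + 0 *\<^sub>R z" by simp
        then show ?thesis by blast
      next
        assume zv: "z = - v"
        have "Q v = P z" using QK[OF v] Qv[OF v] by (intro unique[OF z]) (simp_all add: zv)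
        then have "P z - P v = (- W v) *\<^sub>R v + 0 *\<^sub>R z" using PQ[of v] by (simp add: algebra_simps)
        then show ?thesis by blast
      qed
    qed
  qed
  obtain c where c: "\<And>z. norm z = 1 \<Longrightarrow> \<exists>k. P z = c + k *\<^sub>R z"
    using concurrent_normals[OF dim coplanar] by blast
  then obtain k where k: "\<And>z. norm z = 1 \<Longrightarrow> P z = c + k z *\<^sub>R z" by metis
  have hk: "?h z = c \<bullet> z + k z" if "norm z = 1" for z
    using Pv[OF that] k[OF that] that by (simp add: inner_add_left norm_eq_1)
  have cosk: "k v * (v \<bullet> z) \<le> k z" if "norm v = 1" "norm z = 1" for v z
    using support_fun_ge[OF bK PK[OF that(1)], of z] hk[OF that(2)] k[OF that(1)] by (simp add: inner_add_left)
  have k0: "0 \<le> k z" if z: "norm z = 1" for z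
  proof -
    obtain f where "norm f = 1" "f \<bullet> z = 0" using exists_orthogonal_unit[OF dim, of z z] by blast
    then show ?thesis using cosk[of f z] z by simp
  qed
  obtain b :: 'a where b: "b \<in> Basis" using nonempty_Basis by blast
  have nb: "norm b = 1" using b by simp
  have kb: "k z = k b" if z: "norm z = 1" for z
    by (rule sphere_function_constant[OF dim2 _ _ z nb]) (rule k0, assumption, rule cosk)
  have ball: "K = cball c (k b)"
  proof (rule cball_from_support_fun[OF K(1,2) ne])
    show "?h u = c \<bullet> u + k b" if "norm u = 1" for u using hk[OF that] kb[OF that] by simp
    show "0 \<le> k b" using nb by (rule k0)
  qed
  have "k b \<noteq> 0" using K(3) ball by auto
  then have "0 < k b" using k0[OF nb] by simp
  from that[OF this ball] show ?thesis .
qed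

section \<open>The displacement inequality and its equality case\<close>

text \<open>One and the same point \<open>x\<close> serves for all planes that contain the direction \<open>e\<close>; the equality case
depends on this.\<close>

lemma displacement_le_slice_perimeter:
  fixes K :: "'a::euclidean_space set"
  assumes K: "compact K" "convex K" "interior K \<noteq> {}"
    and \<alpha>: "continuous_on (frontier K) \<alpha>" "\<alpha> ` frontier K \<subseteq> frontier K"
    and e: "norm e = 1"
  obtains x where "x \<in> frontier K"
    "\<And>f. orthonormal_pair e f \<Longrightarrow> x \<in> plane_slice K e f (x - (x \<bullet> e) *\<^sub>R e - (x \<bullet> f) *\<^sub>R f)"
    "\<And>f. orthonormal_pair e f \<Longrightarrow> min_displacement (frontier K) \<alpha>
      \<le> ennreal (circle_integral (support_fun (plane_slice K e f (x - (x \<bullet> e) *\<^sub>R e - (x \<bullet> f) *\<^sub>R f))) e f / 2)"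
proof -
  obtain x where x: "x \<in> frontier K" "\<alpha> x - x = ((\<alpha> x - x) \<bullet> e) *\<^sub>R e"
    using displacement_in_direction[OF K e \<alpha>] by blast
  have FK: "frontier K \<subseteq> K" using K by (simp add: frontier_subset_compact)
  let ?c = "\<lambda>f. x - (x \<bullet> e) *\<^sub>R e - (x \<bullet> f) *\<^sub>R f"
  have xS: "x \<in> plane_slice K e f (?c f)" for f
    using x(1) FK by (auto simp: plane_slice_def)
  have "min_displacement (frontier K) \<alpha> \<le> ennreal (circle_integral (support_fun (plane_slice K e f (?c f))) e f / 2)"
    if f: "orthonormal_pair e f" for f
  proof -
    define k where "k = (\<alpha> x - x) \<bullet> e"
    have ax: "\<alpha> x = x + k *\<^sub>R e" using x(2) unfolding k_def by (metis add.commute diff_add_cancel)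
    have "e \<bullet> e = 1" "e \<bullet> f = 0" using f by (auto simp: orthonormal_pair_def norm_eq_1)
    then have "\<alpha> x = ?c f + (\<alpha> x \<bullet> e) *\<^sub>R e + (\<alpha> x \<bullet> f) *\<^sub>R f"
      unfolding ax by (simp add: inner_add_left algebra_simps)
    then have aS: "\<alpha> x \<in> plane_slice K e f (?c f)" using x(1) \<alpha>(2) FK by (auto simp: plane_slice_def)
    have "min_displacement (frontier K) \<alpha> \<le> intrinsic_dist (frontier K) x (\<alpha> x)"
      unfolding min_displacement_def using x(1) by (rule INF_lower)
    also have "\<dots> \<le> ennreal (circle_integral (support_fun (plane_slice K e f (?c f))) e f / 2)"
      unfolding circle_integral_def using x(1) \<alpha>(2) by (intro intrinsic_dist_le_slice K f xS aS) auto
    finally show ?thesis .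
  qed
  then show ?thesis using that x(1) xS by blast
qed

text \<open>Half the perimeter of each slice lies between \<open>m\<close> and half the integral of \<open>h\<close>, which is \<open>m\<close>. So the
support functions of the slice and of \<open>K\<close>, being continuous and ordered, coincide on the circle of
directions of the plane.\<close>

lemma ball_if_equality:
  fixes K :: "'a::euclidean_space set"
  assumes dim: "3 \<le> DIM('a)" and K: "compact K" "convex K" "interior K \<noteq> {}"
    and \<alpha>: "continuous_on (frontier K) \<alpha>" "\<alpha> ` frontier K \<subseteq> frontier K"
    and m: "0 \<le> m" "min_displacement (frontier K) \<alpha> = ennreal m"
    and eq: "\<And>e f. orthonormal_pair e f \<Longrightarrow> circle_integral (support_fun K) e f = 2 * m"
  obtains c r where "0 < r" "K = cball c r"
proof -
  let ?h = "support_fun K"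
  have ne: "K \<noteq> {}" using K(3) interior_subset by blast
  have bK: "bounded K" using K(1) by (rule compact_imp_bounded)
  have conth: "continuous_on UNIV ?h" using bK ne by (rule continuous_on_support_fun)
  have "\<exists>x. \<forall>f t. orthonormal_pair v f \<longrightarrow> 0 \<le> t \<longrightarrow> t \<le> 2 * pi \<longrightarrow>
      (\<exists>p\<in>K. \<exists>a b. p = x + a *\<^sub>R v + b *\<^sub>R f \<and> p \<bullet> circle_pt v f t = ?h (circle_pt v f t))"
    if v: "norm v = 1" for v
  proof -
    obtain x where x: "x \<in> frontier K"
      "\<And>f. orthonormal_pair v f \<Longrightarrow> x \<in> plane_slice K v f (x - (x \<bullet> v) *\<^sub>R v - (x \<bullet> f) *\<^sub>R f)"
      "\<And>f. orthonormal_pair v f \<Longrightarrow> min_displacement (frontier K) \<alpha>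
        \<le> ennreal (circle_integral (support_fun (plane_slice K v f (x - (x \<bullet> v) *\<^sub>R v - (x \<bullet> f) *\<^sub>R f))) v f / 2)"
      using displacement_le_slice_perimeter[OF K \<alpha> v] by metis
    have "\<exists>p\<in>K. \<exists>a b. p = x + a *\<^sub>R v + b *\<^sub>R f \<and> p \<bullet> circle_pt v f t = ?h (circle_pt v f t)"
      if f: "orthonormal_pair v f" and t: "0 \<le> t" "t \<le> 2 * pi" for f t
    proof -
      let ?c = "x - (x \<bullet> v) *\<^sub>R v - (x \<bullet> f) *\<^sub>R f"
      define S where "S = plane_slice K v f ?c"
      have cS: "compact S" unfolding S_def using K(1) by (rule compact_plane_slice)
      have Sne: "S \<noteq> {}" using x(2)[OF f] by (auto simp: S_def)
      have bS: "bounded S" using cS by (rule compact_imp_bounded)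
      have SK: "S \<subseteq> K" by (auto simp: S_def plane_slice_def)
      have contS: "continuous_on UNIV (support_fun S)" using bS Sne by (rule continuous_on_support_fun)
      have le: "support_fun S u \<le> ?h u" for u using bK SK Sne by (rule support_fun_mono)
      have nonneg: "0 \<le> circle_integral (support_fun S) v f"
        using bS Sne f by (rule circle_integral_support_fun_nonneg)
      have "ennreal m \<le> ennreal (circle_integral (support_fun S) v f / 2)"
        using x(3)[OF f] m(2) by (simp add: S_def)
      then have "m \<le> circle_integral (support_fun S) v f / 2" using nonneg by simp
      then have "integral {0..2 * pi} (\<lambda>t. ?h (circle_pt v f t) - support_fun S (circle_pt v f t)) \<le> 0"
        using eq[OF f] circle_integrable[OF conth] circle_integrable[OF contS]
        by (simp add: Henstock_Kurzweil_Integration.integral_diff circle_integral_def)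
      moreover have "0 \<le> integral {0..2 * pi} (\<lambda>t. ?h (circle_pt v f t) - support_fun S (circle_pt v f t))"
        using le by (intro Henstock_Kurzweil_Integration.integral_nonneg
          Henstock_Kurzweil_Integration.integrable_diff circle_integrable conth contS) auto
      ultimately have int0: "integral {0..2 * pi} (\<lambda>t. ?h (circle_pt v f t) - support_fun S (circle_pt v f t)) = 0"
        by simp
      have "continuous_on {0..2 * pi} (\<lambda>t. ?h (circle_pt v f t) - support_fun S (circle_pt v f t))"
        by (intro continuous_intros continuous_on_compose2[OF conth] continuous_on_compose2[OF contS]) auto
      from integral_eq_0_iff[OF this] int0 le t
      have "?h (circle_pt v f t) - support_fun S (circle_pt v f t) = 0" by auto
      moreover obtain p where p: "p \<in> S" "p \<bullet> circle_pt v f t = support_fun S (circle_pt v f t)"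
        using support_fun_attained[OF cS Sne] by blast
      moreover have "p = x + (p \<bullet> v - x \<bullet> v) *\<^sub>R v + (p \<bullet> f - x \<bullet> f) *\<^sub>R f"
      proof -
        have "p = ?c + (p \<bullet> v) *\<^sub>R v + (p \<bullet> f) *\<^sub>R f" using p(1) unfolding S_def plane_slice_def by blast
        also have "\<dots> = x + (p \<bullet> v - x \<bullet> v) *\<^sub>R v + (p \<bullet> f - x \<bullet> f) *\<^sub>R f" by (simp add: algebra_simps)
        finally show ?thesis .
      qed
      ultimately show ?thesis using SK by (intro bexI[of _ p] exI conjI) auto
    qed
    then show ?thesis by blast
  qed
  then show ?thesis using ball_from_full_slices[OF dim K] that by blast
qed

theorem theorem1p5:
  fixes n :: nat and M :: "'a::euclidean_space set" and \<alpha> :: "'a \<Rightarrow> 'a"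
  assumes "n \<ge> 1"
    and "DIM('a) = n + 1"
    and "closed_convex_hypersurface M"
    and "continuous_on M \<alpha>"
    and "\<alpha> ` M \<subseteq> M"
  shows "ennreal (mean_width M) \<ge> ennreal (2 / pi) * min_displacement M \<alpha> \<and>
    (n \<ge> 2 \<longrightarrow>
      (ennreal (mean_width M) = ennreal (2 / pi) * min_displacement M \<alpha> \<longleftrightarrow>
        (\<exists>c r. r > 0 \<and> M = sphere c r \<and> (\<forall>x\<in>M. \<alpha> x = c - (x - c)))))"
proof -
  obtain K where K: "compact K" "convex K" "interior K \<noteq> {}" and M: "M = frontier K"
    using assms(3) unfolding closed_convex_hypersurface_def by blast
  note \<alpha> = assms(4,5)[unfolded M]
  let ?\<mu> = "min_displacement M \<alpha>" and ?h = "support_fun K"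
  have ne: "K \<noteq> {}" using K(3) interior_subset by blast
  have bK: "bounded K" using K(1) by (rule compact_imp_bounded)
  have conth: "continuous_on UNIV ?h" using bK ne by (rule continuous_on_support_fun)
  obtain B where "\<And>p. p \<in> K \<Longrightarrow> norm p \<le> B" using bK by (auto simp: bounded_iff)
  then have lip: "B-lipschitz_on UNIV ?h" by (rule support_fun_lipschitz[OF ne])
  have mw: "mean_width M = 2 * sphere_mean ?h" unfolding M by (rule mean_width_eq_sphere_mean[OF K(1) ne])
  have le: "0 \<le> circle_integral ?h e f" "?\<mu> \<le> ennreal (circle_integral ?h e f / 2)" if ef: "orthonormal_pair e f" for e f
  proof -
    have e: "norm e = 1" using ef by (simp add: orthonormal_pair_def)
    obtain x where x: "x \<in> plane_slice K e f (x - (x \<bullet> e) *\<^sub>R e - (x \<bullet> f) *\<^sub>R f)"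
      "?\<mu> \<le> ennreal (circle_integral (support_fun (plane_slice K e f (x - (x \<bullet> e) *\<^sub>R e - (x \<bullet> f) *\<^sub>R f))) e f / 2)"
      using displacement_le_slice_perimeter[OF K \<alpha> e] ef unfolding M by metis
    define S where "S = plane_slice K e f (x - (x \<bullet> e) *\<^sub>R e - (x \<bullet> f) *\<^sub>R f)"
    have S: "S \<subseteq> K" "S \<noteq> {}" "bounded S"
      using x(1) bounded_subset[OF bK] by (auto simp: S_def plane_slice_def)
    have "circle_integral (support_fun S) e f \<le> circle_integral ?h e f"
      by (intro circle_integral_mono conth continuous_on_support_fun support_fun_mono S bK ef)
    then show "?\<mu> \<le> ennreal (circle_integral ?h e f / 2)"
      using x(2) unfolding S_def[symmetric] by (meson divide_right_mono ennreal_leI order_trans zero_le_numeral)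
    show "0 \<le> circle_integral ?h e f" using bK ne ef by (rule circle_integral_support_fun_nonneg)
  qed
  \<comment> \<open>The space has at least one great circle, which makes \<open>\<mu>\<close> finite.\<close>
  obtain v :: 'a where "v \<in> Basis" using nonempty_Basis by blast
  then have v: "norm v = 1" by simp
  have dim2: "2 \<le> DIM('a)" using assms(1,2) by simp
  obtain e0 f0 :: 'a where frame: "orthonormal_pair e0 f0"
    using circle_through[OF dim2 v v] by blast
  have "?\<mu> < top" using le(2)[OF frame] ennreal_less_top order_le_less_trans by blast
  then obtain m where m: "0 \<le> m" "?\<mu> = ennreal m" by (cases ?\<mu>) auto
  have C: "2 * m \<le> circle_integral ?h e f" if "orthonormal_pair e f" for e f
    using le[OF that] m by simp
  have bound: "2 / pi * m \<le> mean_width M"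
    using circle_integral_bound_mean[OF lip C frame] mw by (simp add: field_simps)
  have \<mu>: "ennreal (2 / pi) * ?\<mu> = ennreal (2 / pi * m)"
    unfolding m(2) by (rule ennreal_mult[symmetric]) (use m(1) in auto)
  have ineq: "ennreal (2 / pi) * ?\<mu> \<le> ennreal (mean_width M)" unfolding \<mu> using bound by (rule ennreal_leI)
  moreover have "ennreal (mean_width M) = ennreal (2 / pi) * ?\<mu> \<longleftrightarrow>
        (\<exists>c r. r > 0 \<and> M = sphere c r \<and> (\<forall>x\<in>M. \<alpha> x = c - (x - c)))" (is "?L \<longleftrightarrow> ?R") if n: "n \<ge> 2"
  proof
    have dim: "3 \<le> DIM('a)" using n assms(2) by simp
    assume ?L
    then have mwm: "mean_width M = 2 / pi * m"
      unfolding \<mu> using bound m(1) by (metis divide_nonneg_pos ennreal_inj mult_nonneg_nonneg order_trans pi_gt_zero zero_le_numeral)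
    have eq: "circle_integral ?h e f = 2 * m" if ef: "orthonormal_pair e f" for e f
    proof (rule ccontr)
      assume "circle_integral ?h e f \<noteq> 2 * m"
      then have "2 * m < circle_integral ?h e f" using C[OF ef] by simp
      then have "2 * m < 2 * pi * sphere_mean ?h" using lip C ef by (intro circle_integral_strict_bound_mean)
      then show False using mw mwm by (simp add: field_simps)
    qed
    obtain c r where cr: "0 < r" "K = cball c r"
      using ball_if_equality[OF dim K \<alpha> m(1) m(2)[unfolded M] eq] by blast
    have Ms: "M = sphere c r" using cr M by (simp add: frontier_cball)
    have mr: "m = pi * r" using mwm mean_width_sphere[OF cr(1), of c] Ms by (simp add: field_simps)
    have "\<alpha> x = c - (x - c)" if x: "x \<in> M" for x
    proof (rule ccontr)
      assume "\<alpha> x \<noteq> c - (x - c)"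
      moreover have "\<alpha> x \<in> M" using x assms(5) by blast
      ultimately have "intrinsic_dist M x (\<alpha> x) < ?\<mu>"
        using intrinsic_dist_nonantipodal[OF dim cr(1), of x c "\<alpha> x"] x m(2) mr Ms by simp
      moreover have "?\<mu> \<le> intrinsic_dist M x (\<alpha> x)"
        unfolding min_displacement_def using x by (rule INF_lower)
      ultimately show False by simp
    qed
    then show ?R using cr Ms by blast
  next
    assume ?R
    then obtain c r where cr: "r > 0" "M = sphere c r" "\<And>x. x \<in> M \<Longrightarrow> \<alpha> x = c - (x - c)" by blast
    have "ennreal (pi * r) \<le> ?\<mu>"
      unfolding min_displacement_def
      using intrinsic_dist_antipodal[OF cr(1), of c] cr by (intro INF_greatest) simp
    then have "pi * r \<le> m" using m cr(1) by simp
    then have "mean_width M \<le> 2 / pi * m" using mean_width_sphere[OF cr(1), of c] cr(2) by (simp add: field_simps)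
    then have "ennreal (mean_width M) \<le> ennreal (2 / pi) * ?\<mu>" unfolding \<mu> by (rule ennreal_leI)
    then show ?L using ineq by (rule antisym)
  qed
  ultimately show ?thesis by blast
qed

end
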